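(* Let $X$ be a normal complex analytic variety whose canonical divisor is $\mathbb{Q}$-Cartier. Let $\rho:\tilde X\to X$ be a locally projective crepant resolution and let $\tilde\sigma\in\Gamma(X,\mathcal{P}^{\tilde X,\sharp}_{\mathbb{Z}})$ be a section of relatively ample classes for $\tilde X\to X$. Then there is a canonical gerbe $\mathcal{L}_{\tilde\sigma}$ on $X$ such that $\tilde X\to X$ is globally projective with a relatively ample line bundle locally in the class $\tilde\sigma$ if and only if $\mathcal{L}_{\tilde\sigma}$ is trivial.
   Context: A crepant resolution $\rho:\tilde X\to X$ is a proper birational morphism with $\tilde X$ smooth and $K_{\tilde X}=\rho^*K_X$; it is locally projective if $X$ has an open covering over each member of which $\rho$ is projective, and globally projective if there is a $\rho$-relatively ample line bundle on $\tilde X$. For $U\subseteq X$ open, $\operatorname{Pic}(\rho^{-1}(U)/U):=\operatorname{Pic}(\rho^{-1}(U))/\rho^*\operatorname{Pic}(U)$. $\mathcal{P}^{\tilde X}_{\mathbb{Z}}$ is the presheaf $U\mapsto\operatorname{Pic}(\rho^{-1}(U)/U)$ on $X$ and $\mathcal{P}^{\tilde X,\sharp}_{\mathbb{Z}}$ is its sheafification. A section of the latter is a section of relatively ample classes if locally on $X$ it is the class of a line bundle on $\rho^{-1}(U)$ that is ample relative to $U$. A line bundle on $\tilde X$ is locally in the class $\tilde\sigma$ if its image in $\Gamma(X,\mathcal{P}^{\tilde X,\sharp}_{\mathbb{Z}})$ is $\tilde\sigma$. The canonical gerbe is the $\mathcal{O}_X^\times$-gerbe (torsor under the stack of line bundles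 on $X$) given by $$\mathcal{L}_{\tilde\sigma}(U)=\{\text{line bundles on }\rho^{-1}(U)\text{ whose image in }\Gamma(U,\mathcal{P}^{\tilde X,\sharp}_{\mathbb{Z}})\text{ is }\tilde\sigma|_U\},$$ a substack of the pushforward to $X$ of the stack of line bundles on $\tilde X$, on which line bundles on $X$ act by tensoring with their pullbacks. It is trivial if it is equivalent, compatibly with this action, to the stack of line bundles on $X$ with the usual tensor product action. *)

theory Defs
  imports "HOL-Analysis.Analysis" "Jordan_Normal_Form.Determinant"
begin

section \<open>Reduced complex analytic spaces\<close>

text \<open>
  The space \<open>\<complex>\<^sup>n\<close> is the set of sequences vanishing from index \<open>n\<close> on; the product topology of
  \<open>nat \<Rightarrow> complex\<close> induces the Euclidean topology on it.  This lets the dimension vary from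
  point to point of a space.
\<close>

definition Cn :: "nat \<Rightarrow> (nat \<Rightarrow> complex) set" where
  "Cn n = {z. \<forall>i\<ge>n. z i = 0}"

definition Cn_top :: "nat \<Rightarrow> (nat \<Rightarrow> complex) topology" where
  "Cn_top n = subtopology euclidean (Cn n)"

text \<open>Complex (Frechet) differentiability at every point of the open set \<open>D \<subseteq> \<complex>\<^sup>n\<close>.\<close>

definition holo_Cn :: "nat \<Rightarrow> (nat \<Rightarrow> complex) set \<Rightarrow> ((nat \<Rightarrow> complex) \<Rightarrow> complex) \<Rightarrow> bool" where
  "holo_Cn n D f \<longleftrightarrow> (\<forall>z\<in>D. \<exists>a :: nat \<Rightarrow> complex.
     ((\<lambda>w. cmod (f w - f z - (\<Sum>i<n. a i * (w i - z i))) / (\<Sum>i<n. cmod (w i - z i)))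
        \<longlongrightarrow> 0) (at z within D))"

text \<open>
  A structure sheaf (and, below, any line bundle) is a sheaf of complex valued functions
  \<open>F W\<close>, \<open>W\<close> open in \<open>U\<close>.  Elements of \<open>F W\<close> are total functions of which only the values on \<open>W\<close>
  matter; the second clause contains both this saturation (\<open>V = W\<close>) and the gluing axiom.
\<close>

definition function_sheaf :: "'a topology \<Rightarrow> 'a set \<Rightarrow> ('a set \<Rightarrow> ('a \<Rightarrow> complex) set) \<Rightarrow> bool" where
  "function_sheaf T U F \<longleftrightarrow>
     (\<forall>W s. s \<in> F W \<longrightarrow> openin T W \<and> W \<subseteq> U) \<and>
     (\<forall>W s. openin T W \<and> W \<subseteq> U \<and>
        (\<forall>x\<in>W. \<exists>V t. openin T V \<and> x \<in> V \<and> V \<subseteq> W \<and> t \<in> F V \<and> (\<forall>z\<in>V. s z = t z))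
        \<longrightarrow> s \<in> F W) \<and>
     (\<forall>W V s. s \<in> F W \<and> openin T V \<and> V \<subseteq> W \<longrightarrow> s \<in> F V)"

record 'a cspace =
  ctop :: "'a topology"
  hol :: "'a set \<Rightarrow> ('a \<Rightarrow> complex) set"

abbreviation pts :: "'a cspace \<Rightarrow> 'a set" where
  "pts X \<equiv> topspace (ctop X)"

definition lb_res :: "'a set \<Rightarrow> ('a set \<Rightarrow> ('a \<Rightarrow> complex) set) \<Rightarrow> 'a set \<Rightarrow> ('a \<Rightarrow> complex) set" where
  "lb_res V L = (\<lambda>W. if W \<subseteq> V then L W else {})"

definition csub :: "'a cspace \<Rightarrow> 'a set \<Rightarrow> 'a cspace" where
  "csub X U = \<lparr>ctop = subtopology (ctop X) U, hol = lb_res U (hol X)\<rparr>"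

definition holomorphic_map :: "'a cspace \<Rightarrow> 'b cspace \<Rightarrow> ('a \<Rightarrow> 'b) \<Rightarrow> bool" where
  "holomorphic_map X Y f \<longleftrightarrow> continuous_map (ctop X) (ctop Y) f \<and>
     (\<forall>W g. g \<in> hol Y W \<longrightarrow> g \<circ> f \<in> hol X {x \<in> pts X. f x \<in> W})"

definition biholomorphic_map :: "'a cspace \<Rightarrow> 'b cspace \<Rightarrow> ('a \<Rightarrow> 'b) \<Rightarrow> bool" where
  "biholomorphic_map X Y f \<longleftrightarrow> homeomorphic_map (ctop X) (ctop Y) f \<and>
     (\<forall>W g. openin (ctop Y) W \<longrightarrow> (g \<in> hol Y W \<longleftrightarrow> g \<circ> f \<in> hol X {x \<in> pts X. f x \<in> W}))"

definition analytic_subset :: "'a cspace \<Rightarrow> 'a set \<Rightarrow> bool" where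
  "analytic_subset X Z \<longleftrightarrow> Z \<subseteq> pts X \<and>
     (\<forall>x\<in>pts X. \<exists>W F. openin (ctop X) W \<and> x \<in> W \<and> finite F \<and> F \<subseteq> hol X W \<and>
        Z \<inter> W = {w\<in>W. \<forall>f\<in>F. f w = 0})"

text \<open>Reduced local model: a subset \<open>A\<close> of \<open>\<complex>\<^sup>n\<close> with the functions that locally extend to
  holomorphic functions on open subsets of \<open>\<complex>\<^sup>n\<close>.\<close>

definition model :: "nat \<Rightarrow> (nat \<Rightarrow> complex) set \<Rightarrow> (nat \<Rightarrow> complex) cspace" where
  "model n A = \<lparr>ctop = subtopology (Cn_top n) A,
     hol = (\<lambda>W. {f. openin (subtopology (Cn_top n) A) W \<and>
       (\<forall>p\<in>W. \<exists>V g. openin (Cn_top n) V \<and> p \<in> V \<and> holo_Cn n V g \<and> (\<forall>z\<in>V \<inter> W. f z = g z))})\<rparr>"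

definition complex_space :: "'a cspace \<Rightarrow> bool" where
  "complex_space X \<longleftrightarrow> Hausdorff_space (ctop X) \<and> function_sheaf (ctop X) (pts X) (hol X) \<and>
     (\<forall>x\<in>pts X. \<exists>U n D A \<phi>. openin (ctop X) U \<and> x \<in> U \<and> openin (Cn_top n) D \<and>
        analytic_subset (model n D) A \<and> biholomorphic_map (csub X U) (model n A) \<phi>)"

definition nowhere_dense :: "'a cspace \<Rightarrow> 'a set \<Rightarrow> bool" where
  "nowhere_dense X Z \<longleftrightarrow> (ctop X) interior_of ((ctop X) closure_of Z) = {}"

text \<open>
  Normality of a reduced complex space in the sense of Oka, H. Cartan and Grauert--Remmert:
  every weakly holomorphic function (holomorphic off a nowhere dense analytic subset and
  locally bounded) is holomorphic.
\<close>

definition normal_space_cx :: "'a cspace \<Rightarrow> bool" where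
  "normal_space_cx X \<longleftrightarrow> (\<forall>U Z f. openin (ctop X) U \<and> analytic_subset (csub X U) Z \<and>
      nowhere_dense (csub X U) Z \<and> f \<in> hol X (U - Z) \<and>
      (\<forall>x\<in>U. \<exists>V B. openin (ctop X) V \<and> x \<in> V \<and> V \<subseteq> U \<and> (\<forall>y\<in>V - Z. cmod (f y) \<le> B))
      \<longrightarrow> (\<exists>g\<in>hol X U. \<forall>y\<in>U - Z. g y = f y))"

definition smooth_chart :: "'a cspace \<Rightarrow> nat \<Rightarrow> 'a set \<Rightarrow> ('a \<Rightarrow> nat \<Rightarrow> complex) \<Rightarrow> bool" where
  "smooth_chart X n U \<phi> \<longleftrightarrow> openin (ctop X) U \<and>
     (\<exists>D. openin (Cn_top n) D \<and> biholomorphic_map (csub X U) (model n D) \<phi>)"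

definition Reg :: "'a cspace \<Rightarrow> 'a set" where
  "Reg X = {x. \<exists>n U \<phi>. smooth_chart X n U \<phi> \<and> x \<in> U}"

definition smooth_cx :: "'a cspace \<Rightarrow> bool" where
  "smooth_cx X \<longleftrightarrow> Reg X = pts X"

section \<open>Pluricanonical forms\<close>

definition jacobian :: "nat \<Rightarrow> ((nat \<Rightarrow> complex) \<Rightarrow> nat \<Rightarrow> complex) \<Rightarrow> (nat \<Rightarrow> complex) \<Rightarrow> complex" where
  "jacobian n F z = Determinant.det (Matrix.mat n n (\<lambda>(i, j). deriv (\<lambda>t. F (z(j := t)) i) (z j)))"

type_synonym 'a form = "nat \<Rightarrow> 'a set \<Rightarrow> ('a \<Rightarrow> nat \<Rightarrow> complex) \<Rightarrow> 'a \<Rightarrow> complex"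

text \<open>
  A section over the open set \<open>W \<subseteq> Reg X\<close> of the \<open>m\<close>-th tensor power of the canonical bundle,
  given by its coefficients: \<open>\<eta> n U \<phi>\<close> is the coefficient of
  \<open>(d\<phi>\<^sub>0 \<and> \<dots> \<and> d\<phi>\<^sub>n\<^sub>-\<^sub>1)\<^sup>\<otimes>\<^sup>m\<close> in the chart \<open>(U, \<phi>)\<close>.
\<close>

definition pluricanonical :: "'a cspace \<Rightarrow> nat \<Rightarrow> 'a set \<Rightarrow> 'a form \<Rightarrow> bool" where
  "pluricanonical X m W \<eta> \<longleftrightarrow>
     (\<forall>n U \<phi>. smooth_chart X n U \<phi> \<longrightarrow> \<eta> n U \<phi> \<in> hol X (U \<inter> W)) \<and>
     (\<forall>n U \<phi> V \<psi>. smooth_chart X n U \<phi> \<and> smooth_chart X n V \<psi> \<longrightarrow>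
        (\<forall>p\<in>U \<inter> V \<inter> W. \<eta> n U \<phi> p = jacobian n (\<psi> \<circ> inv_into U \<phi>) (\<phi> p) ^ m * \<eta> n V \<psi> p))"

text \<open>
  The reflexive sheaf \<open>\<O>\<^sub>X(m K\<^sub>X)\<close> has the sections \<open>V \<mapsto> pluricanonical X m (V \<inter> Reg X)\<close>.
  The section \<open>\<eta>\<close> over \<open>U\<close> is a free generator if multiplication by \<open>\<eta>\<close> is an isomorphism
  \<open>\<O>\<^sub>U \<rightarrow> \<O>\<^sub>U(m K\<^sub>X)\<close>.
\<close>

definition canonical_generator :: "'a cspace \<Rightarrow> nat \<Rightarrow> 'a set \<Rightarrow> 'a form \<Rightarrow> bool" where
  "canonical_generator X m U \<eta> \<longleftrightarrow> openin (ctop X) U \<and> pluricanonical X m (U \<inter> Reg X) \<eta> \<and>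
     (\<forall>V \<zeta>. openin (ctop X) V \<and> V \<subseteq> U \<and> pluricanonical X m (V \<inter> Reg X) \<zeta> \<longrightarrow>
        (\<exists>f\<in>hol X V.
           (\<forall>n C \<phi>. smooth_chart X n C \<phi> \<longrightarrow> (\<forall>p\<in>V \<inter> C. \<zeta> n C \<phi> p = f p * \<eta> n C \<phi> p)) \<and>
           (\<forall>g\<in>hol X V.
              (\<forall>n C \<phi>. smooth_chart X n C \<phi> \<longrightarrow> (\<forall>p\<in>V \<inter> C. \<zeta> n C \<phi> p = g p * \<eta> n C \<phi> p))
              \<longrightarrow> (\<forall>p\<in>V. g p = f p))))"

definition canonical_Cartier :: "'a cspace \<Rightarrow> nat \<Rightarrow> bool" where
  "canonical_Cartier X m \<longleftrightarrow> (\<forall>x\<in>pts X. \<exists>U \<eta>. x \<in> U \<and> canonical_generator X m U \<eta>)"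

definition canonical_Q_Cartier :: "'a cspace \<Rightarrow> bool" where
  "canonical_Q_Cartier X \<longleftrightarrow> (\<exists>m\<ge>1. canonical_Cartier X m)"

section \<open>Crepant resolutions\<close>

definition over :: "'b cspace \<Rightarrow> ('b \<Rightarrow> 'a) \<Rightarrow> 'a set \<Rightarrow> 'b set" where
  "over Y \<rho> U = {y \<in> pts Y. \<rho> y \<in> U}"

definition proper_bimeromorphic :: "'b cspace \<Rightarrow> 'a cspace \<Rightarrow> ('b \<Rightarrow> 'a) \<Rightarrow> bool" where
  "proper_bimeromorphic Y X \<rho> \<longleftrightarrow> holomorphic_map Y X \<rho> \<and> proper_map (ctop Y) (ctop X) \<rho> \<and>
     (\<exists>Z. analytic_subset X Z \<and> nowhere_dense X Z \<and> nowhere_dense Y (over Y \<rho> Z) \<and>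
        biholomorphic_map (csub Y (over Y \<rho> (pts X - Z))) (csub X (pts X - Z)) \<rho>)"

definition pulls_back_to ::
  "'b cspace \<Rightarrow> 'a cspace \<Rightarrow> ('b \<Rightarrow> 'a) \<Rightarrow> nat \<Rightarrow> 'a set \<Rightarrow> 'a form \<Rightarrow> 'b form \<Rightarrow> bool" where
  "pulls_back_to Y X \<rho> m U \<eta> \<theta> \<longleftrightarrow>
     (\<forall>n V \<phi> C \<psi>. smooth_chart Y n V \<phi> \<and> smooth_chart X n C \<psi> \<longrightarrow>
        (\<forall>p\<in>V. \<rho> p \<in> C \<inter> U \<longrightarrow>
           \<theta> n V \<phi> p = jacobian n (\<psi> \<circ> \<rho> \<circ> inv_into V \<phi>) (\<phi> p) ^ m * \<eta> n C \<psi> (\<rho> p)))"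

text \<open>
  \<open>K\<^sub>Y = \<rho>\<^sup>*K\<^sub>X\<close> as \<open>\<rat>\<close>-divisors: for some \<open>m \<ge> 1\<close> with \<open>m K\<^sub>X\<close> Cartier, the pull-back of
  forms over \<open>Reg X\<close> extends to an isomorphism \<open>\<rho>\<^sup>*\<O>\<^sub>X(m K\<^sub>X) \<rightarrow> \<O>\<^sub>Y(m K\<^sub>Y)\<close>, i.e. it sends
  local generators to local generators.
\<close>

definition crepant_resolution :: "'b cspace \<Rightarrow> 'a cspace \<Rightarrow> ('b \<Rightarrow> 'a) \<Rightarrow> bool" where
  "crepant_resolution Y X \<rho> \<longleftrightarrow> complex_space Y \<and> smooth_cx Y \<and> proper_bimeromorphic Y X \<rho> \<and>
     (\<exists>m\<ge>1. canonical_Cartier X m \<and>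
        (\<forall>U \<eta>. canonical_generator X m U \<eta> \<longrightarrow>
           (\<exists>\<theta>. canonical_generator Y m (over Y \<rho> U) \<theta> \<and> pulls_back_to Y X \<rho> m U \<eta> \<theta>)))"

section \<open>Line bundles\<close>

text \<open>
  A line bundle on the open set \<open>U\<close> is a locally free \<open>\<O>\<^sub>U\<close>-module of rank one, given by its
  holomorphic sections.  Each fibre is identified with \<open>\<complex>\<close> (as a vector space, independently for
  each point), so that sections become functions; the local frames \<open>e\<close> below are nowhere zero
  but otherwise arbitrary functions, and they carry the holomorphic structure.  Any
  one-dimensional fibre can be so identified, so up to isomorphism this is every line bundle:
  transition functions \<open>g\<^sub>i\<^sub>j\<close> are the quotients of frames \<open>e\<^sub>j / e\<^sub>i\<close>.
\<close>

type_synonym 'a lb = "'a set \<Rightarrow> ('a \<Rightarrow> complex) set"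

definition line_bundle :: "'a cspace \<Rightarrow> 'a set \<Rightarrow> 'a lb \<Rightarrow> bool" where
  "line_bundle X U L \<longleftrightarrow> openin (ctop X) U \<and> function_sheaf (ctop X) U L \<and>
     (\<forall>x\<in>U. \<exists>V e. openin (ctop X) V \<and> x \<in> V \<and> V \<subseteq> U \<and> (\<forall>z\<in>V. e z \<noteq> 0) \<and>
        (\<forall>W s. openin (ctop X) W \<and> W \<subseteq> V \<longrightarrow>
           (s \<in> L W \<longleftrightarrow> (\<exists>f\<in>hol X W. \<forall>z\<in>W. s z = f z * e z))))"

text \<open>Isomorphisms are fibrewise multiplications by non-zero scalars \<open>h x\<close> that identify the
  holomorphic sections.\<close>

definition lb_iso :: "'a cspace \<Rightarrow> 'a set \<Rightarrow> 'a lb \<Rightarrow> 'a lb \<Rightarrow> ('a \<Rightarrow> complex) set" where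
  "lb_iso X U L L' = {h \<in> extensional U. (\<forall>x\<in>U. h x \<noteq> 0) \<and>
     (\<forall>W s. openin (ctop X) W \<and> W \<subseteq> U \<longrightarrow> (s \<in> L W \<longleftrightarrow> (\<lambda>x. h x * s x) \<in> L' W))}"

text \<open>Since \<open>\<complex> \<otimes> \<complex> = \<complex>\<close> by multiplication, sections of a tensor product are locally products.\<close>

definition lb_tensor :: "'a cspace \<Rightarrow> 'a lb \<Rightarrow> 'a lb \<Rightarrow> 'a lb" where
  "lb_tensor X L M W = {s. openin (ctop X) W \<and>
     (\<forall>x\<in>W. \<exists>V a b. openin (ctop X) V \<and> x \<in> V \<and> V \<subseteq> W \<and> a \<in> L V \<and> b \<in> M V \<and>
        (\<forall>z\<in>V. s z = a z * b z))}"

definition lb_trivial :: "'a cspace \<Rightarrow> 'a set \<Rightarrow> 'a lb" where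
  "lb_trivial X U = lb_res U (hol X)"

primrec lb_pow :: "'a cspace \<Rightarrow> 'a set \<Rightarrow> 'a lb \<Rightarrow> nat \<Rightarrow> 'a lb" where
  "lb_pow X U L 0 = lb_trivial X U"
| "lb_pow X U L (Suc k) = lb_tensor X L (lb_pow X U L k)"

definition lb_pull :: "'b cspace \<Rightarrow> ('b \<Rightarrow> 'a) \<Rightarrow> 'a lb \<Rightarrow> 'b lb" where
  "lb_pull Y \<rho> M W = {s. openin (ctop Y) W \<and>
     (\<forall>y\<in>W. \<exists>V f U t. openin (ctop Y) V \<and> y \<in> V \<and> V \<subseteq> W \<and> f \<in> hol Y V \<and> t \<in> M U \<and>
        \<rho> ` V \<subseteq> U \<and> (\<forall>z\<in>V. s z = f z * t (\<rho> z)))}"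

section \<open>Relative ampleness\<close>

definition cprod :: "'a cspace \<Rightarrow> 'b cspace \<Rightarrow> ('a \<times> 'b) cspace" where
  "cprod X Y = \<lparr>ctop = prod_topology (ctop X) (ctop Y),
     hol = (\<lambda>W. {f. openin (prod_topology (ctop X) (ctop Y)) W \<and>
       (\<forall>p\<in>W. \<exists>U V k l g h D F. p \<in> U \<times> V \<and> U \<times> V \<subseteq> W \<and>
          (\<forall>i::nat. g i \<in> hol X U) \<and> (\<forall>i::nat. h i \<in> hol Y V) \<and>
          openin (ctop X) U \<and> openin (ctop Y) V \<and>
          openin (Cn_top (k + l)) D \<and> holo_Cn (k + l) D F \<and>
          (\<forall>x\<in>U. \<forall>y\<in>V.
             (let v = (\<lambda>i. if i < k then g i x else if i < k + l then h (i - k) y else 0)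
              in v \<in> D \<and> f (x, y) = F v)))})\<rparr>"

text \<open>\<open>\<P>\<^sup>N\<close> as the set of punctured lines in \<open>\<complex>\<^sup>N\<^sup>+\<^sup>1\<close>, with the quotient topology and the functions
  whose composition with \<open>\<complex>\<^sup>N\<^sup>+\<^sup>1 - 0 \<rightarrow> \<P>\<^sup>N\<close> is holomorphic.\<close>

definition proj_pt :: "(nat \<Rightarrow> complex) \<Rightarrow> (nat \<Rightarrow> complex) set" where
  "proj_pt z = {w. \<exists>c. c \<noteq> 0 \<and> w = (\<lambda>i. c * z i)}"

definition CP_open :: "nat \<Rightarrow> (nat \<Rightarrow> complex) set set \<Rightarrow> bool" where
  "CP_open N S \<longleftrightarrow> S \<subseteq> proj_pt ` (Cn (N + 1) - {\<lambda>_. 0}) \<and> openin (Cn_top (N + 1)) (\<Union>S)"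

lemma proj_pt_iff: "w \<in> proj_pt z \<longleftrightarrow> (\<exists>c. c \<noteq> 0 \<and> (\<forall>i. w i = c * z i))"
  unfolding proj_pt_def mem_Collect_eq fun_eq_iff ..

lemma proj_pt_subset:
  assumes "u \<in> proj_pt a" "u \<in> proj_pt b"
  shows "proj_pt a \<subseteq> proj_pt b"
proof
  fix v assume "v \<in> proj_pt a"
  then obtain e where e: "e \<noteq> 0" "\<forall>i. v i = e * a i" unfolding proj_pt_iff by (elim exE conjE)
  obtain c where c: "c \<noteq> 0" "\<forall>i. u i = c * a i"
    using assms(1) unfolding proj_pt_iff by (elim exE conjE)
  obtain d where d: "d \<noteq> 0" "\<forall>i. u i = d * b i"
    using assms(2) unfolding proj_pt_iff by (elim exE conjE)
  have "v i = (e * d / c) * b i" for i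
  proof -
    have "c * a i = d * b i" using spec[OF c(2), of i] spec[OF d(2), of i] by (rule trans[OF sym])
    then have "a i = d * b i / c" using c(1) by (metis nonzero_mult_div_cancel_left)
    then show ?thesis using spec[OF e(2), of i] by simp
  qed
  moreover have "e * d / c \<noteq> 0" using c(1) d(1) e(1) by simp
  ultimately show "v \<in> proj_pt b" unfolding proj_pt_iff by (intro exI[of _ "e * d / c"] conjI allI)
qed

lemma istopology_CP_open: "istopology (CP_open N)"
proof -
  have int: "\<Union>(S \<inter> S') = \<Union>S \<inter> \<Union>S'" if S: "CP_open N S" "CP_open N S'" for S S'
  proof
    show "\<Union>S \<inter> \<Union>S' \<subseteq> \<Union>(S \<inter> S')"
    proof
      fix w assume "w \<in> \<Union>S \<inter> \<Union>S'"
      then obtain l l' where l: "l \<in> S" "w \<in> l" "l' \<in> S'" "w \<in> l'" by (elim IntE UnionE)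
      obtain z where z: "l = proj_pt z" using S(1) l(1) unfolding CP_open_def by (meson imageE subsetD)
      obtain z' where z': "l' = proj_pt z'" using S(2) l(3) unfolding CP_open_def by (meson imageE subsetD)
      have "l = l'" using l proj_pt_subset unfolding z z' by (meson subset_antisym)
      then show "w \<in> \<Union>(S \<inter> S')" using l by (meson IntI UnionI)
    qed
  qed (rule Union_Int_subset)
  show ?thesis unfolding istopology_def
  proof (intro conjI allI impI)
    fix S S' assume h: "CP_open N S" "CP_open N S'"
    then show "CP_open N (S \<inter> S')"
      using int[OF h] unfolding CP_open_def by (metis le_infI1 openin_Int)
  next
    fix K assume h: "\<forall>S\<in>K. CP_open N S"
    have "\<Union>(\<Union>K) = \<Union>(Union ` K)" by blast
    moreover have "openin (Cn_top (N + 1)) (\<Union>(Union ` K))"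
      using h unfolding CP_open_def by (intro openin_Union) blast
    moreover have "\<Union>K \<subseteq> proj_pt ` (Cn (N + 1) - {\<lambda>_. 0})"
      using h unfolding CP_open_def by (meson Sup_least)
    ultimately show "CP_open N (\<Union>K)" unfolding CP_open_def by simp
  qed
qed

definition CP :: "nat \<Rightarrow> (nat \<Rightarrow> complex) set cspace" where
  "CP N = \<lparr>ctop = topology (CP_open N),
     hol = (\<lambda>W. {f. CP_open N W \<and> holo_Cn (N + 1) (\<Union>W) (\<lambda>z. f (proj_pt z))})\<rparr>"

text \<open>Homeomorphism onto a closed subset inducing surjections on stalks of structure sheaves.\<close>

definition closed_embedding :: "'a cspace \<Rightarrow> 'b cspace \<Rightarrow> ('a \<Rightarrow> 'b) \<Rightarrow> bool" where
  "closed_embedding X Y j \<longleftrightarrow> holomorphic_map X Y j \<and> embedding_map (ctop X) (ctop Y) j \<and>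
     closedin (ctop Y) (j ` pts X) \<and>
     (\<forall>x V f. x \<in> V \<and> f \<in> hol X V \<longrightarrow>
        (\<exists>V' W g. openin (ctop X) V' \<and> x \<in> V' \<and> V' \<subseteq> V \<and> g \<in> hol Y W \<and> j ` V' \<subseteq> W \<and>
           (\<forall>z\<in>V'. f z = g (j z))))"

text \<open>
  A line bundle on \<open>\<rho>\<^sup>-\<^sup>1(V)\<close> is very ample over \<open>V\<close> if it has sections without common zeros that
  define a closed embedding of \<open>\<rho>\<^sup>-\<^sup>1(V)\<close> into \<open>V \<times> \<P>\<^sup>N\<close> over \<open>V\<close>; it is ample relative to \<open>U\<close> if,
  locally on \<open>U\<close>, some positive power of it is very ample.
\<close>

definition rel_very_ample :: "'b cspace \<Rightarrow> 'a cspace \<Rightarrow> ('b \<Rightarrow> 'a) \<Rightarrow> 'a set \<Rightarrow> 'b lb \<Rightarrow> bool" where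
  "rel_very_ample Y X \<rho> V L \<longleftrightarrow> (\<exists>N s.
     (\<forall>i\<le>N. s i \<in> L (over Y \<rho> V)) \<and> (\<forall>y\<in>over Y \<rho> V. \<exists>i\<le>N. s i y \<noteq> 0) \<and>
     closed_embedding (csub Y (over Y \<rho> V)) (cprod (csub X V) (CP N))
       (\<lambda>y. (\<rho> y, proj_pt (\<lambda>i. if i \<le> N then s i y else 0))))"

definition rel_ample :: "'b cspace \<Rightarrow> 'a cspace \<Rightarrow> ('b \<Rightarrow> 'a) \<Rightarrow> 'a set \<Rightarrow> 'b lb \<Rightarrow> bool" where
  "rel_ample Y X \<rho> U L \<longleftrightarrow> line_bundle Y (over Y \<rho> U) L \<and>
     (\<forall>x\<in>U. \<exists>V m. openin (ctop X) V \<and> x \<in> V \<and> V \<subseteq> U \<and> m \<ge> 1 \<and>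
        rel_very_ample Y X \<rho> V
          (lb_pow Y (over Y \<rho> V) (lb_res (over Y \<rho> V) L) m))"

definition locally_projective :: "'b cspace \<Rightarrow> 'a cspace \<Rightarrow> ('b \<Rightarrow> 'a) \<Rightarrow> bool" where
  "locally_projective Y X \<rho> \<longleftrightarrow>
     (\<forall>x\<in>pts X. \<exists>U L. openin (ctop X) U \<and> x \<in> U \<and> rel_ample Y X \<rho> U L)"

section \<open>Sheafification of the relative Picard presheaf\<close>

text \<open>
  For a presheaf \<open>F\<close> on \<open>T\<close>, \<open>res V W\<close> being the restriction from \<open>F V\<close> to \<open>F W\<close>, the sections of
  the sheafification are the functions into the stalks that are locally given by sections of \<open>F\<close>.
\<close>

definition germ :: "'a topology \<Rightarrow> ('a set \<Rightarrow> 's set) \<Rightarrow> ('a set \<Rightarrow> 'a set \<Rightarrow> 's \<Rightarrow> 's) \<Rightarrow>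
    'a \<Rightarrow> 'a set \<Rightarrow> 's \<Rightarrow> ('a set \<times> 's) set" where
  "germ T F res x U a = {(V, b). openin T V \<and> x \<in> V \<and> b \<in> F V \<and>
     (\<exists>W. openin T W \<and> x \<in> W \<and> W \<subseteq> U \<inter> V \<and> res U W a = res V W b)}"

definition sheafification :: "'a topology \<Rightarrow> ('a set \<Rightarrow> 's set) \<Rightarrow> ('a set \<Rightarrow> 'a set \<Rightarrow> 's \<Rightarrow> 's) \<Rightarrow>
    'a set \<Rightarrow> ('a \<Rightarrow> ('a set \<times> 's) set) set" where
  "sheafification T F res U = {\<sigma> \<in> extensional U.
     \<forall>x\<in>U. \<exists>V a. openin T V \<and> x \<in> V \<and> V \<subseteq> U \<and> a \<in> F V \<and> (\<forall>y\<in>V. \<sigma> y = germ T F res y V a)}"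

text \<open>Elements of \<open>Pic(\<rho>\<^sup>-\<^sup>1(U)) / \<rho>\<^sup>* Pic(U)\<close> are cosets, written as sets of line bundles.\<close>

definition rel_Pic_class :: "'b cspace \<Rightarrow> 'a cspace \<Rightarrow> ('b \<Rightarrow> 'a) \<Rightarrow> 'a set \<Rightarrow> 'b lb \<Rightarrow> 'b lb set" where
  "rel_Pic_class Y X \<rho> U L = {L'. line_bundle Y (over Y \<rho> U) L' \<and>
     (\<exists>M. line_bundle X U M \<and> lb_iso Y (over Y \<rho> U) L' (lb_tensor Y L (lb_pull Y \<rho> M)) \<noteq> {})}"

definition rel_Pic :: "'b cspace \<Rightarrow> 'a cspace \<Rightarrow> ('b \<Rightarrow> 'a) \<Rightarrow> 'a set \<Rightarrow> 'b lb set set" where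
  "rel_Pic Y X \<rho> U = rel_Pic_class Y X \<rho> U ` {L. line_bundle Y (over Y \<rho> U) L}"

definition rel_Pic_res :: "'b cspace \<Rightarrow> 'a cspace \<Rightarrow> ('b \<Rightarrow> 'a) \<Rightarrow> 'a set \<Rightarrow> 'a set \<Rightarrow>
    'b lb set \<Rightarrow> 'b lb set" where
  "rel_Pic_res Y X \<rho> U V c = (\<Union>L\<in>c. rel_Pic_class Y X \<rho> V (lb_res (over Y \<rho> V) L))"

type_synonym ('a, 'b) rel_Pic_section = "'a \<Rightarrow> ('a set \<times> 'b lb set) set"

definition rel_Pic_sheaf :: "'b cspace \<Rightarrow> 'a cspace \<Rightarrow> ('b \<Rightarrow> 'a) \<Rightarrow> 'a set \<Rightarrow>
    ('a, 'b) rel_Pic_section set" where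
  "rel_Pic_sheaf Y X \<rho> U = sheafification (ctop X) (rel_Pic Y X \<rho>) (rel_Pic_res Y X \<rho>) U"

text \<open>The image in \<open>rel_Pic_sheaf Y X \<rho> U\<close> of a line bundle on \<open>\<rho>\<^sup>-\<^sup>1(U)\<close>.\<close>

definition lb_section :: "'b cspace \<Rightarrow> 'a cspace \<Rightarrow> ('b \<Rightarrow> 'a) \<Rightarrow> 'a set \<Rightarrow> 'b lb \<Rightarrow>
    ('a, 'b) rel_Pic_section" where
  "lb_section Y X \<rho> U L =
     (\<lambda>x\<in>U. germ (ctop X) (rel_Pic Y X \<rho>) (rel_Pic_res Y X \<rho>) x U (rel_Pic_class Y X \<rho> U L))"

definition rel_ample_section :: "'b cspace \<Rightarrow> 'a cspace \<Rightarrow> ('b \<Rightarrow> 'a) \<Rightarrow>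
    ('a, 'b) rel_Pic_section \<Rightarrow> bool" where
  "rel_ample_section Y X \<rho> \<sigma> \<longleftrightarrow>
     (\<forall>x\<in>pts X. \<exists>U L. openin (ctop X) U \<and> x \<in> U \<and> rel_ample Y X \<rho> U L \<and>
        restrict \<sigma> U = lb_section Y X \<rho> U L)"

definition locally_in_class :: "'b cspace \<Rightarrow> 'a cspace \<Rightarrow> ('b \<Rightarrow> 'a) \<Rightarrow>
    ('a, 'b) rel_Pic_section \<Rightarrow> 'b lb \<Rightarrow> bool" where
  "locally_in_class Y X \<rho> \<sigma> L \<longleftrightarrow> line_bundle Y (pts Y) L \<and> lb_section Y X \<rho> (pts X) L = \<sigma>"

section \<open>Stacks in groupoids, module stacks and torsors\<close>

text \<open>
  All morphisms are invertible.  \<open>rso V\<close> and \<open>rsm V\<close> restrict objects and morphisms to \<open>V\<close>;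
  restriction is strictly functorial here, as it is for line bundles given by their sections.
\<close>

record ('a, 'o, 'm) gpresheaf =
  Ob :: "'a set \<Rightarrow> 'o set"
  Iso :: "'a set \<Rightarrow> 'o \<Rightarrow> 'o \<Rightarrow> 'm set"
  cmp :: "'a set \<Rightarrow> 'm \<Rightarrow> 'm \<Rightarrow> 'm"
  idn :: "'a set \<Rightarrow> 'o \<Rightarrow> 'm"
  rso :: "'a set \<Rightarrow> 'o \<Rightarrow> 'o"
  rsm :: "'a set \<Rightarrow> 'm \<Rightarrow> 'm"

definition groupoid_presheaf :: "'a topology \<Rightarrow> ('a, 'o, 'm, 'z) gpresheaf_scheme \<Rightarrow> bool" where
  "groupoid_presheaf T S \<longleftrightarrow>
     (\<forall>U. openin T U \<longrightarrow>
        (\<forall>x\<in>Ob S U. idn S U x \<in> Iso S U x x) \<and>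
        (\<forall>x\<in>Ob S U. \<forall>y\<in>Ob S U. \<forall>f\<in>Iso S U x y.
           cmp S U f (idn S U x) = f \<and> cmp S U (idn S U y) f = f \<and>
           (\<exists>g\<in>Iso S U y x. cmp S U g f = idn S U x \<and> cmp S U f g = idn S U y) \<and>
           (\<forall>z\<in>Ob S U. \<forall>g\<in>Iso S U y z. cmp S U g f \<in> Iso S U x z \<and>
              (\<forall>w\<in>Ob S U. \<forall>h\<in>Iso S U z w.
                 cmp S U h (cmp S U g f) = cmp S U (cmp S U h g) f)))) \<and>
     (\<forall>U V. openin T U \<and> openin T V \<and> V \<subseteq> U \<longrightarrow>
        (\<forall>x\<in>Ob S U. rso S V x \<in> Ob S V \<and> rsm S V (idn S U x) = idn S V (rso S V x)) \<and>
        (\<forall>x\<in>Ob S U. \<forall>y\<in>Ob S U. \<forall>f\<in>Iso S U x y.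
           rsm S V f \<in> Iso S V (rso S V x) (rso S V y) \<and>
           (\<forall>z\<in>Ob S U. \<forall>g\<in>Iso S U y z.
              rsm S V (cmp S U g f) = cmp S V (rsm S V g) (rsm S V f)))) \<and>
     (\<forall>U. openin T U \<longrightarrow>
        (\<forall>x\<in>Ob S U. rso S U x = x \<and> (\<forall>y\<in>Ob S U. \<forall>f\<in>Iso S U x y. rsm S U f = f))) \<and>
     (\<forall>U V W. openin T U \<and> openin T V \<and> openin T W \<and> W \<subseteq> V \<and> V \<subseteq> U \<longrightarrow>
        (\<forall>x\<in>Ob S U. rso S W (rso S V x) = rso S W x \<and>
           (\<forall>y\<in>Ob S U. \<forall>f\<in>Iso S U x y. rsm S W (rsm S V f) = rsm S W f)))"

definition isos_glue :: "'a topology \<Rightarrow> ('a, 'o, 'm, 'z) gpresheaf_scheme \<Rightarrow> bool" where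
  "isos_glue T S \<longleftrightarrow> (\<forall>U \<U>. openin T U \<and> (\<forall>V\<in>\<U>. openin T V) \<and> \<Union>\<U> = U \<longrightarrow>
     (\<forall>x\<in>Ob S U. \<forall>y\<in>Ob S U. \<forall>f.
        (\<forall>V\<in>\<U>. f V \<in> Iso S V (rso S V x) (rso S V y)) \<and>
        (\<forall>V\<in>\<U>. \<forall>W\<in>\<U>. rsm S (V \<inter> W) (f V) = rsm S (V \<inter> W) (f W))
        \<longrightarrow> (\<exists>!g. g \<in> Iso S U x y \<and> (\<forall>V\<in>\<U>. rsm S V g = f V))))"

definition effective_descent :: "'a topology \<Rightarrow> ('a, 'o, 'm, 'z) gpresheaf_scheme \<Rightarrow> bool" where
  "effective_descent T S \<longleftrightarrow> (\<forall>U \<U>. openin T U \<and> (\<forall>V\<in>\<U>. openin T V) \<and> \<Union>\<U> = U \<longrightarrow>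
     (\<forall>x f.
        (\<forall>V\<in>\<U>. x V \<in> Ob S V) \<and>
        (\<forall>V\<in>\<U>. \<forall>W\<in>\<U>. f V W \<in> Iso S (V \<inter> W) (rso S (V \<inter> W) (x V)) (rso S (V \<inter> W) (x W))) \<and>
        (\<forall>V\<in>\<U>. \<forall>W\<in>\<U>. \<forall>Z\<in>\<U>.
           cmp S (V \<inter> W \<inter> Z) (rsm S (V \<inter> W \<inter> Z) (f W Z)) (rsm S (V \<inter> W \<inter> Z) (f V W))
           = rsm S (V \<inter> W \<inter> Z) (f V Z))
        \<longrightarrow> (\<exists>y\<in>Ob S U. \<exists>\<psi>. (\<forall>V\<in>\<U>. \<psi> V \<in> Iso S V (rso S V y) (x V)) \<and>
              (\<forall>V\<in>\<U>. \<forall>W\<in>\<U>. cmp S (V \<inter> W) (f V W) (rsm S (V \<inter> W) (\<psi> V))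
                 = rsm S (V \<inter> W) (\<psi> W)))))"

definition is_stack :: "'a topology \<Rightarrow> ('a, 'o, 'm, 'z) gpresheaf_scheme \<Rightarrow> bool" where
  "is_stack T S \<longleftrightarrow> groupoid_presheaf T S \<and> isos_glue T S \<and> effective_descent T S"

text \<open>
  A stack with a tensor product, and a stack on which it acts.  The tensor product of line
  bundles given by functions is strictly associative and unital, so associators and unitors of
  actions are identities.
\<close>

record ('a, 'o, 'm) tstack = "('a, 'o, 'm) gpresheaf" +
  tns :: "'a set \<Rightarrow> 'o \<Rightarrow> 'o \<Rightarrow> 'o"
  tnsm :: "'a set \<Rightarrow> 'm \<Rightarrow> 'm \<Rightarrow> 'm"
  tone :: "'a set \<Rightarrow> 'o"

record ('a, 'p, 'n, 'o, 'm) mstack = "('a, 'o, 'm) gpresheaf" +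
  act :: "'a set \<Rightarrow> 'p \<Rightarrow> 'o \<Rightarrow> 'o"
  actm :: "'a set \<Rightarrow> 'n \<Rightarrow> 'm \<Rightarrow> 'm"

definition regular :: "('a, 'p, 'n) tstack \<Rightarrow> ('a, 'p, 'n, 'p, 'n) mstack" where
  "regular P = \<lparr>Ob = Ob P, Iso = Iso P, cmp = cmp P, idn = idn P, rso = rso P, rsm = rsm P,
     act = tns P, actm = tnsm P\<rparr>"

definition module_stack :: "'a topology \<Rightarrow> ('a, 'p, 'n) tstack \<Rightarrow> ('a, 'p, 'n, 'o, 'm) mstack \<Rightarrow> bool"
  where
  "module_stack T P S \<longleftrightarrow> is_stack T S \<and>
     (\<forall>U. openin T U \<longrightarrow>
        (\<forall>p\<in>Ob P U. \<forall>x\<in>Ob S U. act S U p x \<in> Ob S U \<and>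
           actm S U (idn P U p) (idn S U x) = idn S U (act S U p x)) \<and>
        (\<forall>p\<in>Ob P U. \<forall>q\<in>Ob P U. \<forall>a\<in>Iso P U p q.
         \<forall>x\<in>Ob S U. \<forall>y\<in>Ob S U. \<forall>f\<in>Iso S U x y.
           actm S U a f \<in> Iso S U (act S U p x) (act S U q y) \<and>
           (\<forall>r\<in>Ob P U. \<forall>b\<in>Iso P U q r. \<forall>z\<in>Ob S U. \<forall>g\<in>Iso S U y z.
              actm S U (cmp P U b a) (cmp S U g f) = cmp S U (actm S U b g) (actm S U a f)) \<and>
           actm S U (idn P U (tone P U)) f = f \<and>
           (\<forall>p'\<in>Ob P U. \<forall>q'\<in>Ob P U. \<forall>a'\<in>Iso P U p' q'.
              actm S U (tnsm P U a' a) f = actm S U a' (actm S U a f))) \<and>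
        tone P U \<in> Ob P U \<and>
        (\<forall>x\<in>Ob S U. act S U (tone P U) x = x \<and>
           (\<forall>p\<in>Ob P U. \<forall>q\<in>Ob P U. tns P U p q \<in> Ob P U \<and>
              act S U (tns P U p q) x = act S U p (act S U q x)))) \<and>
     (\<forall>U V. openin T U \<and> openin T V \<and> V \<subseteq> U \<longrightarrow>
        (\<forall>p\<in>Ob P U. \<forall>x\<in>Ob S U. rso S V (act S U p x) = act S V (rso P V p) (rso S V x)) \<and>
        (\<forall>p\<in>Ob P U. \<forall>q\<in>Ob P U. \<forall>a\<in>Iso P U p q.
         \<forall>x\<in>Ob S U. \<forall>y\<in>Ob S U. \<forall>f\<in>Iso S U x y.
           rsm S V (actm S U a f) = actm S V (rsm P V a) (rsm S V f)))"

text \<open>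
  Torsor under \<open>P\<close>: locally non-empty, and for every object \<open>x\<close> over \<open>U\<close> the functor
  \<open>p \<mapsto> p \<cdot> x\<close> from \<open>P(U)\<close> to \<open>S(U)\<close> is an equivalence.  For \<open>P\<close> the stack of line bundles on \<open>X\<close>
  this is what is meant by an \<open>\<O>\<^sub>X\<^sup>\<times>\<close>-gerbe.
\<close>

definition torsor :: "'a topology \<Rightarrow> ('a, 'p, 'n) tstack \<Rightarrow> ('a, 'p, 'n, 'o, 'm) mstack \<Rightarrow> bool" where
  "torsor T P S \<longleftrightarrow> module_stack T P (regular P) \<and> module_stack T P S \<and>
     (\<forall>t\<in>topspace T. \<exists>U. openin T U \<and> t \<in> U \<and> Ob S U \<noteq> {}) \<and>
     (\<forall>U. openin T U \<longrightarrow> (\<forall>x\<in>Ob S U.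
        (\<forall>p\<in>Ob P U. \<forall>q\<in>Ob P U.
           bij_betw (\<lambda>a. actm S U a (idn S U x)) (Iso P U p q)
             (Iso S U (act S U p x) (act S U q x))) \<and>
        (\<forall>y\<in>Ob S U. \<exists>p\<in>Ob P U. Iso S U (act S U p x) y \<noteq> {})))"

text \<open>
  A morphism of module stacks \<open>S \<rightarrow> S'\<close>: functors \<open>Fo U, Fm U\<close> with coherent natural isomorphisms
  \<open>\<beta> U V x : F\<^sub>V(x|V) \<rightarrow> F\<^sub>U(x)|V\<close> and \<open>\<gamma> U p x : F\<^sub>U(p \<cdot> x) \<rightarrow> p \<cdot> F\<^sub>U(x)\<close>.
\<close>

definition module_morphism :: "'a topology \<Rightarrow> ('a, 'p, 'n) tstack \<Rightarrow>
    ('a, 'p, 'n, 'o, 'm) mstack \<Rightarrow> ('a, 'p, 'n, 'u, 'v) mstack \<Rightarrow>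
    ('a set \<Rightarrow> 'o \<Rightarrow> 'u) \<Rightarrow> ('a set \<Rightarrow> 'm \<Rightarrow> 'v) \<Rightarrow>
    ('a set \<Rightarrow> 'a set \<Rightarrow> 'o \<Rightarrow> 'v) \<Rightarrow> ('a set \<Rightarrow> 'p \<Rightarrow> 'o \<Rightarrow> 'v) \<Rightarrow> bool" where
  "module_morphism T P S S' Fo Fm \<beta> \<gamma> \<longleftrightarrow>
     \<comment> \<open>functors\<close>
     (\<forall>U. openin T U \<longrightarrow>
        (\<forall>x\<in>Ob S U. Fo U x \<in> Ob S' U \<and> Fm U (idn S U x) = idn S' U (Fo U x)) \<and>
        (\<forall>x\<in>Ob S U. \<forall>y\<in>Ob S U. \<forall>f\<in>Iso S U x y. Fm U f \<in> Iso S' U (Fo U x) (Fo U y) \<and>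
           (\<forall>z\<in>Ob S U. \<forall>g\<in>Iso S U y z. Fm U (cmp S U g f) = cmp S' U (Fm U g) (Fm U f)))) \<and>
     \<comment> \<open>compatibility with restriction\<close>
     (\<forall>U V. openin T U \<and> openin T V \<and> V \<subseteq> U \<longrightarrow>
        (\<forall>x\<in>Ob S U. \<beta> U V x \<in> Iso S' V (Fo V (rso S V x)) (rso S' V (Fo U x))) \<and>
        (\<forall>x\<in>Ob S U. \<forall>y\<in>Ob S U. \<forall>f\<in>Iso S U x y.
           cmp S' V (rsm S' V (Fm U f)) (\<beta> U V x) = cmp S' V (\<beta> U V y) (Fm V (rsm S V f)))) \<and>
     (\<forall>U V W. openin T U \<and> openin T V \<and> openin T W \<and> W \<subseteq> V \<and> V \<subseteq> U \<longrightarrow>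
        (\<forall>x\<in>Ob S U. \<beta> U W x = cmp S' W (rsm S' W (\<beta> U V x)) (\<beta> V W (rso S V x)))) \<and>
     \<comment> \<open>compatibility with the action\<close>
     (\<forall>U. openin T U \<longrightarrow>
        (\<forall>p\<in>Ob P U. \<forall>x\<in>Ob S U. \<gamma> U p x \<in> Iso S' U (Fo U (act S U p x)) (act S' U p (Fo U x))) \<and>
        (\<forall>p\<in>Ob P U. \<forall>q\<in>Ob P U. \<forall>a\<in>Iso P U p q.
         \<forall>x\<in>Ob S U. \<forall>y\<in>Ob S U. \<forall>f\<in>Iso S U x y.
           cmp S' U (actm S' U a (Fm U f)) (\<gamma> U p x) = cmp S' U (\<gamma> U q y) (Fm U (actm S U a f))) \<and>
        (\<forall>x\<in>Ob S U. \<gamma> U (tone P U) x = idn S' U (Fo U x) \<and>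
           (\<forall>p\<in>Ob P U. \<forall>q\<in>Ob P U. \<gamma> U (tns P U p q) x =
              cmp S' U (actm S' U (idn P U p) (\<gamma> U q x)) (\<gamma> U p (act S U q x))))) \<and>
     (\<forall>U V. openin T U \<and> openin T V \<and> V \<subseteq> U \<longrightarrow>
        (\<forall>p\<in>Ob P U. \<forall>x\<in>Ob S U.
           cmp S' V (rsm S' V (\<gamma> U p x)) (\<beta> U V (act S U p x)) =
           cmp S' V (actm S' V (idn P V (rso P V p)) (\<beta> U V x)) (\<gamma> V (rso P V p) (rso S V x))))"

definition module_equivalent :: "'a topology \<Rightarrow> ('a, 'p, 'n) tstack \<Rightarrow>
    ('a, 'p, 'n, 'o, 'm) mstack \<Rightarrow> ('a, 'p, 'n, 'u, 'v) mstack \<Rightarrow> bool" where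
  "module_equivalent T P S S' \<longleftrightarrow> (\<exists>Fo Fm \<beta> \<gamma>. module_morphism T P S S' Fo Fm \<beta> \<gamma> \<and>
     (\<forall>U. openin T U \<longrightarrow>
        (\<forall>x\<in>Ob S U. \<forall>y\<in>Ob S U. bij_betw (Fm U) (Iso S U x y) (Iso S' U (Fo U x) (Fo U y))) \<and>
        (\<forall>y\<in>Ob S' U. \<exists>x\<in>Ob S U. Iso S' U (Fo U x) y \<noteq> {})))"

section \<open>The canonical gerbe\<close>

definition Pic_stack :: "'a cspace \<Rightarrow> ('a, 'a lb, 'a \<Rightarrow> complex) tstack" where
  "Pic_stack X = \<lparr>
     Ob = (\<lambda>U. {L. line_bundle X U L}),
     Iso = lb_iso X,
     cmp = (\<lambda>U g f. \<lambda>x\<in>U. g x * f x),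
     idn = (\<lambda>U L. \<lambda>x\<in>U. 1),
     rso = lb_res,
     rsm = (\<lambda>V h. restrict h V),
     tns = (\<lambda>U. lb_tensor X),
     tnsm = (\<lambda>U h k. \<lambda>x\<in>U. h x * k x),
     tone = lb_trivial X\<rparr>"

text \<open>The full substack of the push-forward of the stack of line bundles on \<open>Y\<close>.\<close>

definition canonical_gerbe :: "'b cspace \<Rightarrow> 'a cspace \<Rightarrow> ('b \<Rightarrow> 'a) \<Rightarrow> ('a, 'b) rel_Pic_section \<Rightarrow>
    ('a, 'a lb, 'a \<Rightarrow> complex, 'b lb, 'b \<Rightarrow> complex) mstack" where
  "canonical_gerbe Y X \<rho> \<sigma> = \<lparr>
     Ob = (\<lambda>U. {L. line_bundle Y (over Y \<rho> U) L \<and> lb_section Y X \<rho> U L = restrict \<sigma> U}),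
     Iso = (\<lambda>U. lb_iso Y (over Y \<rho> U)),
     cmp = (\<lambda>U g f. \<lambda>y\<in>over Y \<rho> U. g y * f y),
     idn = (\<lambda>U L. \<lambda>y\<in>over Y \<rho> U. 1),
     rso = (\<lambda>V. lb_res (over Y \<rho> V)),
     rsm = (\<lambda>V h. restrict h (over Y \<rho> V)),
     act = (\<lambda>U M L. lb_tensor Y (lb_pull Y \<rho> M) L),
     actm = (\<lambda>U h k. \<lambda>y\<in>over Y \<rho> U. h (\<rho> y) * k y)\<rparr>"

definition trivial_gerbe :: "'a cspace \<Rightarrow> ('a, 'a lb, 'a \<Rightarrow> complex, 'o, 'm) mstack \<Rightarrow> bool" where
  "trivial_gerbe X S \<longleftrightarrow>
     module_equivalent (ctop X) (Pic_stack X) (regular (Pic_stack X)) S"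

end

theory Submission
  imports Defs
begin

text \<open>
  Everything about line bundles is checked on local frames.  The geometric input is that
  holomorphic functions on \<open>\<rho>\<^sup>-\<^sup>1(U)\<close> descend to \<open>U\<close>: off the nowhere dense set \<open>Z\<close> where \<open>\<rho>\<close> is
  not an isomorphism, \<open>f \<circ> \<rho>\<^sup>-\<^sup>1\<close> is holomorphic, by properness it is locally bounded, so by
  normality it extends over \<open>Z\<close>, and the extension pulls back to \<open>f\<close> by density.  Hence
  automorphisms of bundles on \<open>\<rho>\<^sup>-\<^sup>1(U)\<close> are units on \<open>U\<close>, so twisting by \<open>\<rho>\<^sup>*M\<close> is fully faithful,
  and two bundles that are isomorphic locally over \<open>U\<close> differ by some \<open>\<rho>\<^sup>*M\<close>.  It follows that two
  bundles have the same image in the sheafified relative Picard presheaf iff they are isomorphic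
  locally over the base, which makes the canonical gerbe a stack and a torsor.  A torsor is
  trivial iff it has a global object \<open>L\<close> (send \<open>M\<close> to \<open>\<rho>\<^sup>*M \<otimes> L\<close>), and a global object is locally over the
  base isomorphic to the given relatively ample bundles, hence relatively ample.
\<close>

section \<open>Holomorphic functions on complex spaces\<close>

text \<open>Fibres are identified with the complex numbers point by point, so a morphism of bundles
  is one function on points, composition is multiplication, and an isomorphism by the constant 1 is
  an equality. Associativity of tensor products and compatibility with restriction thus become
  equations, as the strict form of module stacks demands; in return \<open>restrict\<close> and
  saturation must track that only values on the current open set count. A germ in the sheafified
  presheaf is a set of pairs of an open set and a coset. Both the open set and the twist by a bundle
  from the base disappear once bundles are compared over small neighbourhoods of a point of the
  base, that is, near a whole fibre; the relation \<open>near\<close> records this. Neighbourhoods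
  of points upstairs would not do, since all line bundles are isomorphic there. Frames upstairs
  exist only on small sets, whereas descent needs functions on full preimages. What descends is
  therefore a quotient in which the frame upstairs cancels.\<close>

lemma Cn_dist_pos:
  assumes "w \<in> Cn n" "z \<in> Cn n" "w \<noteq> z"
  shows "(\<Sum>i<n. cmod (w i - z i)) > 0"
proof -
  obtain i where i: "w i \<noteq> z i" using assms(3) by auto
  then have "i < n" using assms(1,2) unfolding Cn_def mem_Collect_eq by (metis not_le)
  then show ?thesis using i by (intro sum_pos2[of _ i]) auto
qed

text \<open>Sequences carry only the product topology here, no norm; convergence of the coordinate
  sum, the denominator in \<open>holo_Cn\<close>, comes from continuity of each coordinate.\<close>

lemma coords_tendsto_0: "((\<lambda>w :: nat \<Rightarrow> complex. \<Sum>i<n. cmod (w i - z i)) \<longlongrightarrow> 0) (at z within D)"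
proof -
  have "((\<lambda>w. w i) \<longlongrightarrow> z i) (at z within D)" for i
    using continuous_on_product_coordinates[of i, THEN continuous_on_subset, of "insert z D"]
    unfolding continuous_on_def by (meson UNIV_I insertCI subset_UNIV subset_insertI tendsto_within_subset)
  then have "((\<lambda>w. \<Sum>i<n. cmod (w i - z i)) \<longlongrightarrow> (\<Sum>i<n. cmod (z i - z i))) (at z within D)"
    by (intro tendsto_intros)
  then show ?thesis by simp
qed

lemma linear_form_bound:
  fixes a d :: "nat \<Rightarrow> complex"
  shows "cmod (\<Sum>i<n. a i * d i) \<le> (\<Sum>i<n. cmod (a i)) * (\<Sum>i<n. cmod (d i))"
proof -
  have "cmod (\<Sum>i<n. a i * d i) \<le> (\<Sum>i<n. cmod (a i) * cmod (d i))"
    by (rule order_trans[OF norm_sum]) (simp add: norm_mult)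
  also have "\<dots> \<le> (\<Sum>i<n. (\<Sum>j<n. cmod (a j)) * cmod (d i))"
    by (intro sum_mono mult_right_mono member_le_sum) auto
  finally show ?thesis by (simp add: sum_distrib_left)
qed

lemma linear_form_quotient_bound:
  fixes a d :: "nat \<Rightarrow> complex"
  shows "cmod (\<Sum>i<n. a i * d i) / (\<Sum>i<n. cmod (d i)) \<le> (\<Sum>i<n. cmod (a i))"
\<comment> \<open>A zero denominator makes the quotient 0 by the convention for division, so the
  bound holds for every \<open>d\<close>, including the difference at the base point itself.\<close>
proof (cases "(\<Sum>i<n. cmod (d i)) = 0")
  case False
  then have "(\<Sum>i<n. cmod (d i)) > 0" by (simp add: order_less_le sum_nonneg)
  then show ?thesis using linear_form_bound[of a d n] by (simp add: divide_le_eq)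
qed (simp add: sum_nonneg)

section \<open>Complex differentiability: restriction, continuity, products, inverses\<close>

lemma holo_Cn_subset: "holo_Cn n D f \<Longrightarrow> D' \<subseteq> D \<Longrightarrow> holo_Cn n D' f"
  unfolding holo_Cn_def
proof
  fix z assume D: "\<forall>z\<in>D. \<exists>a. ((\<lambda>w. cmod (f w - f z - (\<Sum>i<n. a i * (w i - z i))) / (\<Sum>i<n. cmod (w i - z i)))
        \<longlongrightarrow> 0) (at z within D)" "D' \<subseteq> D" "z \<in> D'"
  then obtain a where "((\<lambda>w. cmod (f w - f z - (\<Sum>i<n. a i * (w i - z i))) / (\<Sum>i<n. cmod (w i - z i)))
        \<longlongrightarrow> 0) (at z within D)" by (meson subsetD)
  from tendsto_within_subset[OF this D(2)]
  show "\<exists>a. ((\<lambda>w. cmod (f w - f z - (\<Sum>i<n. a i * (w i - z i))) / (\<Sum>i<n. cmod (w i - z i)))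
        \<longlongrightarrow> 0) (at z within D')" by (rule exI[of _ a])
qed

lemma holo_Cn_const: "holo_Cn n D (\<lambda>_. c)"
  unfolding holo_Cn_def by (intro ballI exI[of _ "\<lambda>_. 0"]) simp

text \<open>The increment of \<open>f\<close> is at most the difference quotient times the distance
  plus the linear form, and both tend to 0. The quotient can be cleared only where the distance is
  positive, which is where \<open>D \<subseteq> Cn n\<close> enters.\<close>

lemma holo_Cn_continuous:
  assumes "holo_Cn n D f" "D \<subseteq> Cn n"
  shows "continuous_on D f"
  unfolding continuous_on_def
proof
  fix z assume z: "z \<in> D"
  let ?N = "\<lambda>w. \<Sum>i<n. cmod (w i - z i)"
  obtain a where a: "((\<lambda>w. cmod (f w - f z - (\<Sum>i<n. a i * (w i - z i))) / ?N w) \<longlongrightarrow> 0) (at z within D)"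
    using assms(1) z unfolding holo_Cn_def by blast
  let ?K = "\<Sum>i<n. cmod (a i)"
  have lim: "((\<lambda>w. cmod (f w - f z - (\<Sum>i<n. a i * (w i - z i))) / ?N w * ?N w + ?K * ?N w) \<longlongrightarrow> 0 * 0 + ?K * 0)
      (at z within D)"
    by (intro tendsto_intros a coords_tendsto_0)
  have "\<forall>\<^sub>F w in at z within D. norm (f w - f z) \<le>
     cmod (f w - f z - (\<Sum>i<n. a i * (w i - z i))) / ?N w * ?N w + ?K * ?N w"
    unfolding eventually_at_filter
  proof (intro always_eventually allI impI)
    fix w assume w: "w \<noteq> z" "w \<in> D"
    then have "?N w > 0" using z assms(2) Cn_dist_pos by blast
    then have "cmod (f w - f z - (\<Sum>i<n. a i * (w i - z i))) / ?N w * ?N w =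
      cmod (f w - f z - (\<Sum>i<n. a i * (w i - z i)))" by (intro nonzero_eq_divide_eq[THEN iffD1]) auto
    moreover have "norm (f w - f z) \<le> cmod (f w - f z - (\<Sum>i<n. a i * (w i - z i))) + cmod (\<Sum>i<n. a i * (w i - z i))"
      by norm
    ultimately show "norm (f w - f z) \<le>
      cmod (f w - f z - (\<Sum>i<n. a i * (w i - z i))) / ?N w * ?N w + ?K * ?N w"
      using linear_form_bound[of a "\<lambda>i. w i - z i" n] by linarith
  qed
  then have "((\<lambda>w. f w - f z) \<longlongrightarrow> 0) (at z within D)"
    using lim unfolding mult_zero_left mult_zero_right add_0 by (rule Lim_null_comparison)
  then show "(f \<longlongrightarrow> f z) (at z within D)" by (simp add: LIM_zero_iff)
qed

lemma holo_Cn_mult: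
  assumes f: "holo_Cn n D f" and g: "holo_Cn n D g" and D: "D \<subseteq> Cn n"
  shows "holo_Cn n D (\<lambda>z. f z * g z)"
  unfolding holo_Cn_def
proof
  fix z assume z: "z \<in> D"
  let ?N = "\<lambda>w. \<Sum>i<n. cmod (w i - z i)"
  obtain a where a: "((\<lambda>w. cmod (f w - f z - (\<Sum>i<n. a i * (w i - z i))) / ?N w) \<longlongrightarrow> 0) (at z within D)"
    using f z unfolding holo_Cn_def by blast
  obtain b where b: "((\<lambda>w. cmod (g w - g z - (\<Sum>i<n. b i * (w i - z i))) / ?N w) \<longlongrightarrow> 0) (at z within D)"
    using g z unfolding holo_Cn_def by blast
  let ?A = "\<lambda>w. \<Sum>i<n. a i * (w i - z i)" and ?B = "\<lambda>w. \<Sum>i<n. b i * (w i - z i)"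
  let ?K = "\<Sum>i<n. cmod (a i)"
  have gz: "(g \<longlongrightarrow> g z) (at z within D)"
    using holo_Cn_continuous[OF g D] z unfolding continuous_on_def by blast
  have lim: "((\<lambda>w. cmod (f w - f z - ?A w) / ?N w * cmod (g w) + ?K * cmod (g w - g z)
     + cmod (f z) * (cmod (g w - g z - ?B w) / ?N w)) \<longlongrightarrow> 0 * cmod (g z) + ?K * cmod (g z - g z) + cmod (f z) * 0)
     (at z within D)"
    by (intro tendsto_intros a b gz)
  have le: "cmod (f w * g w - f z * g z - (\<Sum>i<n. (a i * g z + f z * b i) * (w i - z i))) / ?N w
      \<le> cmod (f w - f z - ?A w) / ?N w * cmod (g w) + ?K * cmod (g w - g z)
     + cmod (f z) * (cmod (g w - g z - ?B w) / ?N w)" for w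
  proof -
    have "(\<Sum>i<n. (a i * g z + f z * b i) * (w i - z i)) = ?A w * g z + f z * ?B w"
      unfolding sum_distrib_left sum_distrib_right sum.distrib[symmetric]
      by (intro sum.cong refl) (simp add: algebra_simps)
    \<comment> \<open>Product rule with three error terms: the remainder of \<open>f\<close>, the
      remainder of \<open>g\<close>, and a mixed term whose linear form divided by the distance
      stays below \<open>?K\<close> while \<open>g w - g z\<close> tends to 0.\<close>
    then have "f w * g w - f z * g z - (\<Sum>i<n. (a i * g z + f z * b i) * (w i - z i)) =
       (f w - f z - ?A w) * g w + ?A w * (g w - g z) + f z * (g w - g z - ?B w)"
      by (simp add: algebra_simps)
    then have "cmod (f w * g w - f z * g z - (\<Sum>i<n. (a i * g z + f z * b i) * (w i - z i))) \<le>
      cmod ((f w - f z - ?A w) * g w) + cmod (?A w * (g w - g z)) + cmod (f z * (g w - g z - ?B w))"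
      by (simp only:) (rule order_trans[OF norm_triangle_ineq add_right_mono[OF norm_triangle_ineq]])
    then have "cmod (f w * g w - f z * g z - (\<Sum>i<n. (a i * g z + f z * b i) * (w i - z i))) / ?N w \<le>
      (cmod (f w - f z - ?A w) * cmod (g w) + cmod (?A w) * cmod (g w - g z) + cmod (f z) * cmod (g w - g z - ?B w)) / ?N w"
      by (intro divide_right_mono) (simp_all add: norm_mult sum_nonneg)
    also have "\<dots> = cmod (f w - f z - ?A w) / ?N w * cmod (g w) + cmod (?A w) / ?N w * cmod (g w - g z)
     + cmod (f z) * (cmod (g w - g z - ?B w) / ?N w)" by (simp add: add_divide_distrib)
    also have "\<dots> \<le> cmod (f w - f z - ?A w) / ?N w * cmod (g w) + ?K * cmod (g w - g z)
     + cmod (f z) * (cmod (g w - g z - ?B w) / ?N w)"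
      using linear_form_quotient_bound[of a "\<lambda>i. w i - z i" n]
      by (intro add_right_mono add_left_mono mult_right_mono) simp_all
    finally show ?thesis .
  qed
  have "((\<lambda>w. cmod (f w * g w - f z * g z - (\<Sum>i<n. (a i * g z + f z * b i) * (w i - z i))) / ?N w)
      \<longlongrightarrow> 0) (at z within D)"
    by (rule Lim_null_comparison[where g = "\<lambda>w. cmod (f w - f z - ?A w) / ?N w * cmod (g w) + ?K * cmod (g w - g z)
     + cmod (f z) * (cmod (g w - g z - ?B w) / ?N w)"])
      (use lim le in \<open>simp_all add: sum_nonneg\<close>)
  then show "\<exists>c. ((\<lambda>w. cmod (f w * g w - f z * g z - (\<Sum>i<n. c i * (w i - z i))) / ?N w)
      \<longlongrightarrow> 0) (at z within D)" by (intro exI[of _ "\<lambda>i. a i * g z + f z * b i"])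
qed

lemma holo_Cn_inverse:
  assumes f: "holo_Cn n D f" and nz: "\<And>z. z \<in> D \<Longrightarrow> f z \<noteq> 0" and D: "D \<subseteq> Cn n"
  shows "holo_Cn n D (\<lambda>z. inverse (f z))"
  unfolding holo_Cn_def
proof
  fix z assume z: "z \<in> D"
  let ?N = "\<lambda>w. \<Sum>i<n. cmod (w i - z i)"
  obtain a where a: "((\<lambda>w. cmod (f w - f z - (\<Sum>i<n. a i * (w i - z i))) / ?N w) \<longlongrightarrow> 0) (at z within D)"
    using f z unfolding holo_Cn_def by blast
  let ?A = "\<lambda>w. \<Sum>i<n. a i * (w i - z i)"
  let ?K = "\<Sum>i<n. cmod (a i)"
  have fz: "(f \<longlongrightarrow> f z) (at z within D)"
    using holo_Cn_continuous[OF f D] z unfolding continuous_on_def by blast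
  let ?b = "\<lambda>w. cmod (f w - f z - ?A w) / ?N w * cmod (inverse (f w * f z)) +
     ?K * cmod ((f w - f z) * inverse (f w * (f z)\<^sup>2))"
  have "(?b \<longlongrightarrow> 0 * cmod (inverse (f z * f z)) + ?K * cmod ((f z - f z) * inverse (f z * (f z)\<^sup>2)))
     (at z within D)"
    using nz[OF z] by (intro tendsto_intros a fz) auto
  then have lim: "(?b \<longlongrightarrow> 0) (at z within D)" by simp
  have le: "cmod (inverse (f w) - inverse (f z) - (\<Sum>i<n. (- a i / (f z)\<^sup>2) * (w i - z i))) / ?N w \<le> ?b w"
    if w: "w \<in> D" for w
  proof -
    have "(\<Sum>i<n. (- a i / (f z)\<^sup>2) * (w i - z i)) = (\<Sum>i<n. (- 1 / (f z)\<^sup>2) * (a i * (w i - z i)))"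
      by (intro sum.cong refl) simp
    also have "\<dots> = - ?A w / (f z)\<^sup>2" by (simp only: sum_distrib_left[symmetric]) simp
    finally have s: "(\<Sum>i<n. (- a i / (f z)\<^sup>2) * (w i - z i)) = - ?A w / (f z)\<^sup>2" .
    \<comment> \<open>The remainder of the inverse splits into the remainder of \<open>f\<close> and
      a mixed term, both bounded as in the product rule.\<close>
    have alg: "inverse p - inverse q - (- A / q\<^sup>2) = - ((p - q - A) * inverse (p * q))
        + A * ((p - q) * inverse (p * q\<^sup>2))" if "p \<noteq> 0" "q \<noteq> 0" for p q A :: complex
      using that by (simp add: field_simps power2_eq_square)
    have "cmod (inverse (f w) - inverse (f z) - (\<Sum>i<n. (- a i / (f z)\<^sup>2) * (w i - z i)))
       \<le> cmod ((f w - f z - ?A w) * inverse (f w * f z)) + cmod (?A w * ((f w - f z) * inverse (f w * (f z)\<^sup>2)))"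
      unfolding s alg[OF nz[OF w] nz[OF z]] by (rule order_trans[OF norm_triangle_ineq]) simp
    then have "cmod (inverse (f w) - inverse (f z) - (\<Sum>i<n. (- a i / (f z)\<^sup>2) * (w i - z i))) / ?N w
       \<le> (cmod (f w - f z - ?A w) * cmod (inverse (f w * f z)) +
          cmod (?A w) * cmod ((f w - f z) * inverse (f w * (f z)\<^sup>2))) / ?N w"
      by (intro divide_right_mono) (simp_all add: norm_mult sum_nonneg)
    also have "\<dots> = cmod (f w - f z - ?A w) / ?N w * cmod (inverse (f w * f z)) +
          cmod (?A w) / ?N w * cmod ((f w - f z) * inverse (f w * (f z)\<^sup>2))"
      by (simp add: add_divide_distrib)
    also have "\<dots> \<le> ?b w"
      using linear_form_quotient_bound[of a "\<lambda>i. w i - z i" n]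
      by (intro add_left_mono mult_right_mono) simp_all
    finally show ?thesis .
  qed
  \<comment> \<open>The estimate uses \<open>f w \<noteq> 0\<close> and is known only on
    \<open>D\<close>, so it enters as an eventual statement; the product estimate held at every
    point.\<close>
  have "\<forall>\<^sub>F w in at z within D.
     norm (cmod (inverse (f w) - inverse (f z) - (\<Sum>i<n. (- a i / (f z)\<^sup>2) * (w i - z i))) / ?N w) \<le> ?b w"
    unfolding eventually_at_filter using le by (intro always_eventually) (simp add: sum_nonneg)
  then have "((\<lambda>w. cmod (inverse (f w) - inverse (f z) - (\<Sum>i<n. (- a i / (f z)\<^sup>2) * (w i - z i))) / ?N w)
      \<longlongrightarrow> 0) (at z within D)"
    using lim by (rule Lim_null_comparison)
  then show "\<exists>c. ((\<lambda>w. cmod (inverse (f w) - inverse (f z) - (\<Sum>i<n. c i * (w i - z i))) / ?N w)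
      \<longlongrightarrow> 0) (at z within D)" by (intro exI[of _ "\<lambda>i. - a i / (f z)\<^sup>2"])
qed

section \<open>Holomorphic functions on reduced local models\<close>

lemma openin_Cn_top_subset: "openin (Cn_top n) V \<Longrightarrow> V \<subseteq> Cn n"
  unfolding Cn_top_def by (drule openin_subset) simp

lemma openin_Cn_preimage:
  assumes "openin (Cn_top n) V" "holo_Cn n V g" "open S"
  shows "openin (Cn_top n) {z \<in> V. g z \<in> S}"
proof -
  have "continuous_on V g" using holo_Cn_continuous[OF assms(2) openin_Cn_top_subset[OF assms(1)]] .
  then have "openin (top_of_set V) (V \<inter> g -` S)" using assms(3) by (rule continuous_openin_preimage_gen)
  moreover have "{z \<in> V. g z \<in> S} = V \<inter> g -` S" by auto
  ultimately show ?thesis using assms(1) unfolding Cn_top_def by (metis openin_trans)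
qed

lemma hol_model_iff: "f \<in> hol (model n A) W \<longleftrightarrow> openin (ctop (model n A)) W \<and>
       (\<forall>p\<in>W. \<exists>V g. openin (Cn_top n) V \<and> p \<in> V \<and> holo_Cn n V g \<and> (\<forall>z\<in>V \<inter> W. f z = g z))"
  unfolding model_def by simp

lemma hol_model_const: "openin (ctop (model n A)) W \<Longrightarrow> (\<lambda>_. c) \<in> hol (model n A) W"
proof -
  assume W: "openin (ctop (model n A)) W"
  then have "W \<subseteq> topspace (Cn_top n)" unfolding model_def by (auto dest!: openin_subset)
  then show ?thesis unfolding hol_model_iff
    using W by (auto intro!: exI[of _ "topspace (Cn_top n)"] exI[of _ "\<lambda>_. c"] holo_Cn_const)
qed

lemma hol_model_mult:
  assumes "f \<in> hol (model n A) W" "g \<in> hol (model n A) W"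
  shows "(\<lambda>x. f x * g x) \<in> hol (model n A) W"
  unfolding hol_model_iff
proof (intro conjI ballI)
  show "openin (ctop (model n A)) W" using assms(1) hol_model_iff by blast
  fix p assume p: "p \<in> W"
  obtain V f' where V: "openin (Cn_top n) V" "p \<in> V" "holo_Cn n V f'" "\<forall>z\<in>V \<inter> W. f z = f' z"
    using assms(1) p unfolding hol_model_iff by blast
  obtain V' g' where V': "openin (Cn_top n) V'" "p \<in> V'" "holo_Cn n V' g'" "\<forall>z\<in>V' \<inter> W. g z = g' z"
    using assms(2) p unfolding hol_model_iff by blast
  have "holo_Cn n (V \<inter> V') (\<lambda>z. f' z * g' z)"
    using V V' openin_Cn_top_subset[OF V(1)] by (intro holo_Cn_mult) (auto intro: holo_Cn_subset)
  then show "\<exists>V h. openin (Cn_top n) V \<and> p \<in> V \<and> holo_Cn n V h \<and> (\<forall>z\<in>V \<inter> W. f z * g z = h z)"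
    using V V' by (intro exI[of _ "V \<inter> V'"] exI[of _ "\<lambda>z. f' z * g' z"]) auto
qed

lemma hol_model_inverse:
  assumes "f \<in> hol (model n A) W" "\<And>x. x \<in> W \<Longrightarrow> f x \<noteq> 0"
  shows "(\<lambda>x. inverse (f x)) \<in> hol (model n A) W"
  unfolding hol_model_iff
proof (intro conjI ballI)
  show "openin (ctop (model n A)) W" using assms(1) hol_model_iff by blast
  fix p assume p: "p \<in> W"
  obtain V f' where V: "openin (Cn_top n) V" "p \<in> V" "holo_Cn n V f'" "\<forall>z\<in>V \<inter> W. f z = f' z"
    using assms(1) p unfolding hol_model_iff by blast
  \<comment> \<open>\<open>f\<close> is zero-free on \<open>W\<close>, but its extension
    \<open>f'\<close> may vanish at points of \<open>V\<close> outside \<open>W\<close>; removing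
    the zeros of \<open>f'\<close> leaves a neighbourhood of \<open>p\<close>.\<close>
  let ?V = "{z \<in> V. f' z \<in> - {0}}"
  have o: "openin (Cn_top n) ?V" using V by (intro openin_Cn_preimage) auto
  have "holo_Cn n ?V (\<lambda>z. inverse (f' z))"
    using V o openin_Cn_top_subset[OF V(1)] by (intro holo_Cn_inverse) (auto intro: holo_Cn_subset)
  moreover have "p \<in> ?V" using V p assms(2) by (metis (mono_tags, lifting) ComplI IntI mem_Collect_eq singletonD)
  ultimately show "\<exists>V h. openin (Cn_top n) V \<and> p \<in> V \<and> holo_Cn n V h \<and> (\<forall>z\<in>V \<inter> W. inverse (f z) = h z)"
    using V(4) o by (intro exI[of _ ?V] exI[of _ "\<lambda>z. inverse (f' z)"] conjI ballI) (blast | simp)+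
qed

lemma hol_model_open_preimage:
  assumes "f \<in> hol (model n A) W" "open S"
  shows "openin (ctop (model n A)) {x \<in> W. f x \<in> S}"
proof (subst openin_subopen, intro ballI)
  fix p assume p: "p \<in> {x \<in> W. f x \<in> S}"
  then obtain V g where V: "openin (Cn_top n) V" "p \<in> V" "holo_Cn n V g" "\<forall>z\<in>V \<inter> W. f z = g z"
    using assms(1) unfolding hol_model_iff by blast
  have W: "openin (subtopology (Cn_top n) A) W" using assms(1) unfolding hol_model_iff model_def by simp
  have "openin (Cn_top n) {z \<in> V. g z \<in> S}" using V assms(2) by (intro openin_Cn_preimage)
  then have "openin (subtopology (Cn_top n) A) ({z \<in> V. g z \<in> S} \<inter> W)"
    using W unfolding openin_subtopology by blast
  then show "\<exists>T. openin (ctop (model n A)) T \<and> p \<in> T \<and> T \<subseteq> {x \<in> W. f x \<in> S}"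
    using V p by (intro exI[of _ "{z \<in> V. g z \<in> S} \<inter> W"]) (auto simp: model_def)
qed

section \<open>Sheaves of functions and the interface \<open>fspace\<close>\<close>

lemma function_sheafD:
  assumes "function_sheaf T U F"
  shows "s \<in> F W \<Longrightarrow> openin T W" "s \<in> F W \<Longrightarrow> W \<subseteq> U"
    and "s \<in> F W \<Longrightarrow> openin T V \<Longrightarrow> V \<subseteq> W \<Longrightarrow> s \<in> F V"
    and "openin T W \<Longrightarrow> W \<subseteq> U \<Longrightarrow>
       (\<And>x. x \<in> W \<Longrightarrow> \<exists>V t. openin T V \<and> x \<in> V \<and> V \<subseteq> W \<and> t \<in> F V \<and> (\<forall>z\<in>V. s z = t z)) \<Longrightarrow> s \<in> F W"
proof -
  note F = assms[unfolded function_sheaf_def]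
  show "openin T W" "W \<subseteq> U" if "s \<in> F W" using conjunct1[OF F, rule_format, OF that] by simp_all
  show "s \<in> F V" if "s \<in> F W" "openin T V" "V \<subseteq> W"
    using conjunct2[OF conjunct2[OF F], rule_format, of s W V] that by simp
  show "s \<in> F W" if "openin T W" "W \<subseteq> U"
    "\<And>x. x \<in> W \<Longrightarrow> \<exists>V t. openin T V \<and> x \<in> V \<and> V \<subseteq> W \<and> t \<in> F V \<and> (\<forall>z\<in>V. s z = t z)"
    using conjunct1[OF conjunct2[OF F], rule_format, of W s] that by simp
qed

lemma function_sheaf_cong:
  assumes "function_sheaf T U F" "s \<in> F W" "\<And>z. z \<in> W \<Longrightarrow> s z = t z"
  shows "t \<in> F W"
proof (rule function_sheafD(4)[OF assms(1) function_sheafD(1,2)[OF assms(1,2)]])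
  fix x assume "x \<in> W"
  then show "\<exists>V s'. openin T V \<and> x \<in> V \<and> V \<subseteq> W \<and> s' \<in> F V \<and> (\<forall>z\<in>V. t z = s' z)"
    using assms(2,3) function_sheafD(1)[OF assms(1,2)] by (intro exI[of _ W] exI[of _ s]) simp
qed

text \<open>The interface through which bundles see a complex space. Products and inverses are what
  a change of frame requires; open preimages, that is continuity, give closed zero sets, open
  disagreement sets and bounds near compact fibres. Working from these properties keeps charts out
  of the bundle theory.\<close>

locale fspace =
  fixes X :: "'a cspace"
  assumes hol_sheaf: "function_sheaf (ctop X) (pts X) (hol X)"
    and hol_one: "openin (ctop X) W \<Longrightarrow> (\<lambda>_. 1) \<in> hol X W"
    and hol_mult: "f \<in> hol X W \<Longrightarrow> g \<in> hol X W \<Longrightarrow> (\<lambda>x. f x * g x) \<in> hol X W"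
    and hol_inverse: "f \<in> hol X W \<Longrightarrow> (\<And>x. x \<in> W \<Longrightarrow> f x \<noteq> 0) \<Longrightarrow> (\<lambda>x. inverse (f x)) \<in> hol X W"
    and hol_open_preimage: "f \<in> hol X W \<Longrightarrow> open S \<Longrightarrow> openin (ctop X) {x \<in> W. f x \<in> S}"

text \<open>Restates a chart through images of open subsets under \<open>\<phi>\<close>, the form in
  which closure properties of the model can be pulled back. The last clause moves a function on
  \<open>W\<close> to the model, where its values off the image of \<open>W\<close> do not
  matter.\<close>

lemma complex_space_chart:
  assumes "complex_space X" "x \<in> pts X"
  obtains U n A \<phi> where "openin (ctop X) U" "x \<in> U"
    "\<And>W. W \<subseteq> U \<Longrightarrow> openin (ctop X) W \<longleftrightarrow> openin (ctop (model n A)) (\<phi> ` W)"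
    "\<And>S. openin (ctop (model n A)) S \<Longrightarrow> openin (ctop X) {x \<in> U. \<phi> x \<in> S}"
    "\<And>W g. openin (ctop X) W \<Longrightarrow> W \<subseteq> U \<Longrightarrow> g \<in> hol (model n A) (\<phi> ` W) \<longleftrightarrow> g \<circ> \<phi> \<in> hol X W"
    "\<And>W f. f \<in> hol X W \<Longrightarrow> W \<subseteq> U \<Longrightarrow> \<exists>g\<in>hol (model n A) (\<phi> ` W). \<forall>z\<in>W. f z = g (\<phi> z)"
proof -
  have sh: "function_sheaf (ctop X) (pts X) (hol X)" using assms(1) unfolding complex_space_def by (elim conjE)
  obtain U n A \<phi> where U: "openin (ctop X) U" "x \<in> U" "biholomorphic_map (csub X U) (model n A) \<phi>"
    using assms unfolding complex_space_def by meson
  have UX: "U \<subseteq> pts X" using U(1) openin_subset by blast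
  have hm: "homeomorphic_map (subtopology (ctop X) U) (ctop (model n A)) \<phi>"
    using U(3) unfolding biholomorphic_map_def csub_def by simp
  have inj: "inj_on \<phi> U" using homeomorphic_imp_injective_map[OF hm] UX by (simp add: Int_absorb1)
  have op: "openin (ctop X) W \<longleftrightarrow> openin (ctop (model n A)) (\<phi> ` W)" if "W \<subseteq> U" for W
    using homeomorphic_map_openness[OF hm, of W] that U(1) UX
    by (simp add: openin_open_subtopology subset_trans)
  have pre: "openin (ctop X) {x \<in> U. \<phi> x \<in> S}" if "openin (ctop (model n A)) S" for S
    using openin_continuous_map_preimage[OF homeomorphic_imp_continuous_map[OF hm] that] U(1) UX
    by (simp add: openin_open_subtopology Int_absorb1)
  have h: "g \<in> hol (model n A) (\<phi> ` W) \<longleftrightarrow> g \<circ> \<phi> \<in> hol X W" if "openin (ctop X) W" "W \<subseteq> U" for W g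
  proof -
    have "{x \<in> pts (csub X U). \<phi> x \<in> \<phi> ` W} = W"
      using that inj UX unfolding csub_def by (auto simp: inj_on_def)
    then show ?thesis using that op[OF that(2)] U(3) unfolding biholomorphic_map_def
      by (simp add: csub_def lb_res_def)
  qed
  have l: "\<exists>g\<in>hol (model n A) (\<phi> ` W). \<forall>z\<in>W. f z = g (\<phi> z)" if f: "f \<in> hol X W" and W: "W \<subseteq> U" for W f
  proof -
    have eq: "f z = (f \<circ> inv_into U \<phi>) (\<phi> z)" if "z \<in> W" for z
      using that W inj by (auto simp: subset_iff)
    have "(f \<circ> inv_into U \<phi>) \<circ> \<phi> \<in> hol X W"
      using function_sheaf_cong[OF sh f] eq by simp
    then have "f \<circ> inv_into U \<phi> \<in> hol (model n A) (\<phi> ` W)"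
      using h function_sheafD(1)[OF sh f] W by blast
    then show ?thesis using eq by blast
  qed
  show ?thesis using that[OF U(1,2) op pre h l] by blast
qed

theorem complex_space_fspace:
  assumes X: "complex_space X"
  shows "fspace X"
proof
  show sh: "function_sheaf (ctop X) (pts X) (hol X)" using X unfolding complex_space_def by (elim conjE)
  \<comment> \<open>Each closure property is local and passes to functions that factor through a
    chart. This reduces it to one chart, where every member of \<open>hol X W\<close> comes from the
    model.\<close>
  have glue: "h \<in> hol X W" if W: "openin (ctop X) W"
    and loc: "\<And>U n A \<phi>. openin (ctop X) U \<Longrightarrow> U \<subseteq> W \<Longrightarrow>
     (\<And>f. f \<in> hol X W \<Longrightarrow> \<exists>g\<in>hol (model n A) (\<phi> ` U). \<forall>z\<in>U. f z = g (\<phi> z)) \<Longrightarrow>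
     openin (ctop (model n A)) (\<phi> ` U) \<Longrightarrow>
     \<exists>k \<in> hol (model n A) (\<phi> ` U). \<forall>z\<in>U. h z = k (\<phi> z)" for h W
  proof (rule function_sheafD(4)[OF sh W openin_subset[OF W]])
    fix x assume x: "x \<in> W"
    then have xX: "x \<in> pts X" using W openin_subset by blast
    obtain U n A and \<phi> :: "'a \<Rightarrow> nat \<Rightarrow> complex" where U: "openin (ctop X) U" "x \<in> U"
      "\<And>W. W \<subseteq> U \<Longrightarrow> openin (ctop X) W \<longleftrightarrow> openin (ctop (model n A)) (\<phi> ` W)"
      "\<And>S. openin (ctop (model n A)) S \<Longrightarrow> openin (ctop X) {x \<in> U. \<phi> x \<in> S}"
      "\<And>W g. openin (ctop X) W \<Longrightarrow> W \<subseteq> U \<Longrightarrow> g \<in> hol (model n A) (\<phi> ` W) \<longleftrightarrow> g \<circ> \<phi> \<in> hol X W"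
      "\<And>W f. f \<in> hol X W \<Longrightarrow> W \<subseteq> U \<Longrightarrow> \<exists>g\<in>hol (model n A) (\<phi> ` W). \<forall>z\<in>W. f z = g (\<phi> z)"
      by (rule complex_space_chart[OF X xX]) (rule that)
    have o: "openin (ctop X) (U \<inter> W)" using U(1) W by blast
    have "\<exists>k \<in> hol (model n A) (\<phi> ` (U \<inter> W)). \<forall>z\<in>U \<inter> W. h z = k (\<phi> z)"
      using o U(3)[of "U \<inter> W"] U(6)[OF function_sheafD(3)[OF sh _ o]] by (intro loc) auto
    then obtain k where k: "k \<in> hol (model n A) (\<phi> ` (U \<inter> W))" "\<forall>z\<in>U \<inter> W. h z = k (\<phi> z)" by blast
    then have "k \<circ> \<phi> \<in> hol X (U \<inter> W)" using U(5)[OF o] by blast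
    then show "\<exists>V t. openin (ctop X) V \<and> x \<in> V \<and> V \<subseteq> W \<and> t \<in> hol X V \<and> (\<forall>z\<in>V. h z = t z)"
      using o k x U(2) by (intro exI[of _ "U \<inter> W"] exI[of _ "k \<circ> \<phi>"]) auto
  qed
  show "(\<lambda>_. 1) \<in> hol X W" if "openin (ctop X) W" for W
    using that by (rule glue) (metis hol_model_const)
  show "(\<lambda>x. f x * g x) \<in> hol X W" if fg: "f \<in> hol X W" "g \<in> hol X W" for W f g
  proof (rule glue[OF function_sheafD(1)[OF sh fg(1)]])
    fix U n A and \<phi> :: "'a \<Rightarrow> nat \<Rightarrow> complex"
    assume *: "\<And>f. f \<in> hol X W \<Longrightarrow> \<exists>g\<in>hol (model n A) (\<phi> ` U). \<forall>z\<in>U. f z = g (\<phi> z)"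
    obtain f' g' where "f' \<in> hol (model n A) (\<phi> ` U)" "\<forall>z\<in>U. f z = f' (\<phi> z)"
      "g' \<in> hol (model n A) (\<phi> ` U)" "\<forall>z\<in>U. g z = g' (\<phi> z)"
      using *[OF fg(1)] *[OF fg(2)] by (elim bexE)
    then show "\<exists>k\<in>hol (model n A) (\<phi> ` U). \<forall>z\<in>U. f z * g z = k (\<phi> z)"
      by (intro bexI[OF _ hol_model_mult[of f' n A _ g']]) auto
  qed
  show "(\<lambda>x. inverse (f x)) \<in> hol X W" if f: "f \<in> hol X W" "\<And>x. x \<in> W \<Longrightarrow> f x \<noteq> 0" for W f
  proof (rule glue[OF function_sheafD(1)[OF sh f(1)]])
    fix U n A and \<phi> :: "'a \<Rightarrow> nat \<Rightarrow> complex"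
    assume UW: "U \<subseteq> W" and *: "\<And>f. f \<in> hol X W \<Longrightarrow> \<exists>g\<in>hol (model n A) (\<phi> ` U). \<forall>z\<in>U. f z = g (\<phi> z)"
    obtain g where g: "g \<in> hol (model n A) (\<phi> ` U)" "\<forall>z\<in>U. f z = g (\<phi> z)" using *[OF f(1)] by blast
    have "(\<lambda>x. inverse (g x)) \<in> hol (model n A) (\<phi> ` U)"
      using g UW f(2) by (intro hol_model_inverse) (auto simp: subset_iff)
    then show "\<exists>k\<in>hol (model n A) (\<phi> ` U). \<forall>z\<in>U. inverse (f z) = k (\<phi> z)"
      using g(2) by (intro bexI[of _ "\<lambda>x. inverse (g x)"]) simp_all
  qed
  show "openin (ctop X) {x \<in> W. f x \<in> S}" if f: "f \<in> hol X W" and S: "open S" for f W S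
  proof (subst openin_subopen, intro ballI)
    fix x assume x: "x \<in> {x \<in> W. f x \<in> S}"
    have W: "openin (ctop X) W" using function_sheafD(1)[OF sh f] .
    then have xX: "x \<in> pts X" using x openin_subset by blast
    obtain U n A and \<phi> :: "'a \<Rightarrow> nat \<Rightarrow> complex" where U: "openin (ctop X) U" "x \<in> U"
      "\<And>W. W \<subseteq> U \<Longrightarrow> openin (ctop X) W \<longleftrightarrow> openin (ctop (model n A)) (\<phi> ` W)"
      "\<And>S. openin (ctop (model n A)) S \<Longrightarrow> openin (ctop X) {x \<in> U. \<phi> x \<in> S}"
      "\<And>W g. openin (ctop X) W \<Longrightarrow> W \<subseteq> U \<Longrightarrow> g \<in> hol (model n A) (\<phi> ` W) \<longleftrightarrow> g \<circ> \<phi> \<in> hol X W"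
      "\<And>W f. f \<in> hol X W \<Longrightarrow> W \<subseteq> U \<Longrightarrow> \<exists>g\<in>hol (model n A) (\<phi> ` W). \<forall>z\<in>W. f z = g (\<phi> z)"
      by (rule complex_space_chart[OF X xX]) (rule that)
    have o: "openin (ctop X) (U \<inter> W)" using U(1) W by blast
    obtain g where g: "g \<in> hol (model n A) (\<phi> ` (U \<inter> W))" "\<forall>z\<in>U \<inter> W. f z = g (\<phi> z)"
      using U(6)[OF function_sheafD(3)[OF sh f o]] by auto
    let ?T = "{y \<in> U. \<phi> y \<in> {z \<in> \<phi> ` (U \<inter> W). g z \<in> S}} \<inter> (U \<inter> W)"
    have "openin (ctop X) ?T" using U(4)[OF hol_model_open_preimage[OF g(1) S]] o by blast
    then show "\<exists>T. openin (ctop X) T \<and> x \<in> T \<and> T \<subseteq> {x \<in> W. f x \<in> S}"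
      using x U(2) g(2) by (intro exI[of _ ?T]) auto
  qed
qed

section \<open>Local frames and isomorphisms of line bundles\<close>

text \<open>With the quotient \<open>s / e\<close> the coefficient is a term rather than an
  existential witness, so changes of frame become computations. The domain of the bundle is not
  mentioned, which lets one frame serve a bundle and its restrictions.\<close>

definition frame :: "'a cspace \<Rightarrow> 'a lb \<Rightarrow> 'a set \<Rightarrow> ('a \<Rightarrow> complex) \<Rightarrow> bool" where
  "frame X L V e \<longleftrightarrow> openin (ctop X) V \<and> (\<forall>z\<in>V. e z \<noteq> 0) \<and>
     (\<forall>W s. openin (ctop X) W \<and> W \<subseteq> V \<longrightarrow> (s \<in> L W \<longleftrightarrow> (\<lambda>z. s z / e z) \<in> hol X W))"

text \<open>\<open>lb_iso\<close> without extensionality: as plain functions, isomorphisms restrict,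
  multiply and invert freely, and are truncated only on entering a morphism set.\<close>

definition isom :: "'a cspace \<Rightarrow> 'a set \<Rightarrow> 'a lb \<Rightarrow> 'a lb \<Rightarrow> ('a \<Rightarrow> complex) \<Rightarrow> bool" where
  "isom X U L L' h \<longleftrightarrow> (\<forall>x\<in>U. h x \<noteq> 0) \<and>
     (\<forall>W s. openin (ctop X) W \<and> W \<subseteq> U \<longrightarrow> (s \<in> L W \<longleftrightarrow> (\<lambda>x. h x * s x) \<in> L' W))"

lemma lb_iso_iff: "h \<in> lb_iso X U L L' \<longleftrightarrow> h \<in> extensional U \<and> isom X U L L' h"
  unfolding lb_iso_def isom_def by simp

lemma frameD:
  assumes "frame X L V e"
  shows "openin (ctop X) V" "z \<in> V \<Longrightarrow> e z \<noteq> 0"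
    and "openin (ctop X) W \<Longrightarrow> W \<subseteq> V \<Longrightarrow> s \<in> L W \<longleftrightarrow> (\<lambda>z. s z / e z) \<in> hol X W"
  using assms unfolding frame_def by simp_all

lemma frame_subset:
  assumes "frame X L V e" "openin (ctop X) V'" "V' \<subseteq> V"
  shows "frame X L V' e"
  using assms unfolding frame_def by (simp add: subset_iff)

lemma frame_lb_res:
  assumes "V \<subseteq> U"
  shows "frame X (lb_res U L) V e \<longleftrightarrow> frame X L V e"
proof -
  have "lb_res U L W = L W" if "W \<subseteq> V" for W using that assms unfolding lb_res_def by auto
  then show ?thesis unfolding frame_def by auto
qed

lemma isomD:
  assumes "isom X U L L' h"
  shows "x \<in> U \<Longrightarrow> h x \<noteq> 0"
    and "openin (ctop X) W \<Longrightarrow> W \<subseteq> U \<Longrightarrow> s \<in> L W \<longleftrightarrow> (\<lambda>x. h x * s x) \<in> L' W"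
  using assms unfolding isom_def by simp_all

lemma isom_subset: "isom X U L L' h \<Longrightarrow> V \<subseteq> U \<Longrightarrow> isom X V L L' h"
  unfolding isom_def by (simp add: subset_iff)

lemma isom_lb_res:
  assumes "V \<subseteq> U"
  shows "isom X V (lb_res U L) L' h \<longleftrightarrow> isom X V L L' h"
    and "isom X V L (lb_res U L') h \<longleftrightarrow> isom X V L L' h"
proof -
  have "lb_res U M W = M W" if "W \<subseteq> V" for M W using that assms unfolding lb_res_def by auto
  then show "isom X V (lb_res U L) L' h \<longleftrightarrow> isom X V L L' h" "isom X V L (lb_res U L') h \<longleftrightarrow> isom X V L L' h"
    unfolding isom_def by auto
qed

lemma function_sheaf_lb_res:
  assumes "function_sheaf T U L" "V \<subseteq> U"
  shows "function_sheaf T V (lb_res V L)"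
  unfolding function_sheaf_def
proof (intro conjI allI impI)
  fix W s assume s: "s \<in> lb_res V L W"
  then have W: "W \<subseteq> V" "s \<in> L W" unfolding lb_res_def by (auto split: if_splits)
  then show "openin T W" "W \<subseteq> V" using function_sheafD(1)[OF assms(1)] by simp_all
next
  fix W s assume *: "openin T W \<and> W \<subseteq> V \<and>
        (\<forall>x\<in>W. \<exists>V' t. openin T V' \<and> x \<in> V' \<and> V' \<subseteq> W \<and> t \<in> lb_res V L V' \<and> (\<forall>z\<in>V'. s z = t z))"
  have "s \<in> L W"
  proof (rule function_sheafD(4)[OF assms(1)])
    show "openin T W" "W \<subseteq> U" using * assms(2) by auto
    fix x assume "x \<in> W"
    then obtain V' t where "openin T V'" "x \<in> V'" "V' \<subseteq> W" "t \<in> lb_res V L V'" "\<forall>z\<in>V'. s z = t z"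
      using * by meson
    moreover from this(4) have "t \<in> L V'" unfolding lb_res_def by (auto split: if_splits)
    ultimately show "\<exists>V' t. openin T V' \<and> x \<in> V' \<and> V' \<subseteq> W \<and> t \<in> L V' \<and> (\<forall>z\<in>V'. s z = t z)"
      by (intro exI conjI)
  qed
  then show "s \<in> lb_res V L W" using * unfolding lb_res_def by simp
next
  fix W W' s assume *: "s \<in> lb_res V L W \<and> openin T W' \<and> W' \<subseteq> W"
  then have W: "W \<subseteq> V" "s \<in> L W" unfolding lb_res_def by (auto split: if_splits)
  then have "s \<in> L W'" using * function_sheafD(3)[OF assms(1)] by simp
  then show "s \<in> lb_res V L W'" using * W unfolding lb_res_def by auto
qed

lemma lb_res_self:
  assumes "function_sheaf T U L"
  shows "lb_res U L = L"
proof (intro ext Set.set_eqI)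
  fix W s show "s \<in> lb_res U L W \<longleftrightarrow> s \<in> L W"
    using function_sheafD(2)[OF assms, of s W] unfolding lb_res_def by auto
qed

lemma lb_res_lb_res: "W \<subseteq> V \<Longrightarrow> lb_res W (lb_res V L) = lb_res W L"
  by (intro ext) (auto simp: lb_res_def)

lemma isom_cong:
  assumes "function_sheaf (ctop X) U' L'" "isom X U L L' h" "\<And>x. x \<in> U \<Longrightarrow> h x = k x"
  shows "isom X U L L' k"
  unfolding isom_def
proof (intro conjI ballI allI impI)
  show "k x \<noteq> 0" if "x \<in> U" for x using that isomD(1)[OF assms(2)] assms(3) by fastforce
  fix W s assume W: "openin (ctop X) W \<and> W \<subseteq> U"
  then have "s \<in> L W \<longleftrightarrow> (\<lambda>x. h x * s x) \<in> L' W" using isomD(2)[OF assms(2)] by simp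
  also have "\<dots> \<longleftrightarrow> (\<lambda>x. k x * s x) \<in> L' W"
  proof
    show "(\<lambda>x. h x * s x) \<in> L' W \<Longrightarrow> (\<lambda>x. k x * s x) \<in> L' W"
      by (erule function_sheaf_cong[OF assms(1)]) (use W assms(3) in auto)
    show "(\<lambda>x. k x * s x) \<in> L' W \<Longrightarrow> (\<lambda>x. h x * s x) \<in> L' W"
      by (erule function_sheaf_cong[OF assms(1)]) (use W assms(3) in auto)
  qed
  finally show "s \<in> L W \<longleftrightarrow> (\<lambda>x. k x * s x) \<in> L' W" .
qed

lemma lb_iso_restrictI:
  assumes "function_sheaf (ctop X) U' L'" "isom X U L L' h"
  shows "restrict h U \<in> lb_iso X U L L'"
  unfolding lb_iso_iff using isom_cong[OF assms, of "restrict h U"] by simp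

lemma isom_one:
  shows "isom X U L L (\<lambda>_. 1)"
  unfolding isom_def by simp

lemma isom_comp:
  assumes h: "isom X U L L' h" and k: "isom X U L' L'' k"
  shows "isom X U L L'' (\<lambda>x. k x * h x)"
  using isomD[OF h] isomD[OF k] unfolding isom_def by (simp add: mult.assoc)

text \<open>The product \<open>h x * (inverse (h x) * s x)\<close> equals \<open>s x\<close> only on
  \<open>W\<close>; the sheaf property of the target allows the two functions to be
  exchanged.\<close>

lemma isom_inverse:
  assumes "function_sheaf (ctop X) U' L'" and h: "isom X U L L' h"
  shows "isom X U L' L (\<lambda>x. inverse (h x))"
  unfolding isom_def
proof (intro conjI ballI allI impI)
  show "inverse (h x) \<noteq> 0" if "x \<in> U" for x using that isomD(1)[OF h] by simp
  fix W s assume W: "openin (ctop X) W \<and> W \<subseteq> U"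
  have eq: "h x * (inverse (h x) * s x) = s x" if "x \<in> W" for x
    using that W isomD(1)[OF h, of x] by auto
  have "(\<lambda>x. inverse (h x) * s x) \<in> L W \<longleftrightarrow> (\<lambda>x. h x * (inverse (h x) * s x)) \<in> L' W"
    using isomD(2)[OF h, of W "\<lambda>x. inverse (h x) * s x"] W by simp
  also have "\<dots> \<longleftrightarrow> s \<in> L' W"
  proof
    show "(\<lambda>x. h x * (inverse (h x) * s x)) \<in> L' W \<Longrightarrow> s \<in> L' W"
      by (erule function_sheaf_cong[OF assms(1)]) (rule eq)
    show "s \<in> L' W \<Longrightarrow> (\<lambda>x. h x * (inverse (h x) * s x)) \<in> L' W"
      by (erule function_sheaf_cong[OF assms(1)]) (rule eq[symmetric])
  qed
  finally show "s \<in> L' W \<longleftrightarrow> (\<lambda>x. inverse (h x) * s x) \<in> L W" ..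
qed

context fspace
begin

lemma hol_openin: "f \<in> hol X W \<Longrightarrow> openin (ctop X) W"
  by (rule function_sheafD(1)[OF hol_sheaf])

lemma hol_subset: "f \<in> hol X W \<Longrightarrow> openin (ctop X) V \<Longrightarrow> V \<subseteq> W \<Longrightarrow> f \<in> hol X V"
  by (rule function_sheafD(3)[OF hol_sheaf])

lemma hol_cong: "f \<in> hol X W \<Longrightarrow> (\<And>z. z \<in> W \<Longrightarrow> f z = g z) \<Longrightarrow> g \<in> hol X W"
  by (rule function_sheaf_cong[OF hol_sheaf])

lemma hol_glue:
  assumes "openin (ctop X) W" "\<And>x. x \<in> W \<Longrightarrow> \<exists>V. x \<in> V \<and> V \<subseteq> W \<and> f \<in> hol X V"
  shows "f \<in> hol X W"
proof (rule function_sheafD(4)[OF hol_sheaf assms(1) openin_subset[OF assms(1)]])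
  fix x assume "x \<in> W"
  then obtain V where "x \<in> V" "V \<subseteq> W" "f \<in> hol X V" using assms(2) by blast
  then show "\<exists>V t. openin (ctop X) V \<and> x \<in> V \<and> V \<subseteq> W \<and> t \<in> hol X V \<and> (\<forall>z\<in>V. f z = t z)"
    using hol_openin by (intro exI[of _ V] exI[of _ f]) auto
qed

lemma frame_section:
  assumes "frame X L V e"
  shows "e \<in> L V"
proof -
  note V = frameD(1)[OF assms]
  have "(\<lambda>z. e z / e z) \<in> hol X V"
    by (rule hol_cong[OF hol_one[OF V]]) (simp add: frameD(2)[OF assms])
  then show ?thesis using frameD(3)[OF assms V order_refl, of e] by simp
qed

lemma frame_mult_unit:
  assumes e: "frame X L V e" and g: "g \<in> hol X V" "\<And>z. z \<in> V \<Longrightarrow> g z \<noteq> 0"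
  shows "frame X L V (\<lambda>z. g z * e z)"
  unfolding frame_def
proof (intro conjI ballI allI impI)
  show "openin (ctop X) V" by (rule frameD(1)[OF e])
  show "g z * e z \<noteq> 0" if "z \<in> V" for z using that g(2) frameD(2)[OF e] by simp
  fix W s assume W: "openin (ctop X) W \<and> W \<subseteq> V"
  have gW: "g \<in> hol X W" using hol_subset[OF g(1)] W by blast
  have ig: "(\<lambda>z. inverse (g z)) \<in> hol X W" using W g(2) by (intro hol_inverse[OF gW]) blast
  have "(\<lambda>z. s z / e z) \<in> hol X W \<longleftrightarrow> (\<lambda>z. s z / (g z * e z)) \<in> hol X W"
  proof
    assume "(\<lambda>z. s z / e z) \<in> hol X W"
    from hol_mult[OF ig this] show "(\<lambda>z. s z / (g z * e z)) \<in> hol X W"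
      by (rule hol_cong) (simp add: divide_simps)
  next
    assume "(\<lambda>z. s z / (g z * e z)) \<in> hol X W"
    from hol_mult[OF gW this] show "(\<lambda>z. s z / e z) \<in> hol X W"
      using W g(2) by (elim hol_cong) auto
  qed
  then show "s \<in> L W \<longleftrightarrow> (\<lambda>z. s z / (g z * e z)) \<in> hol X W" using frameD(3)[OF e] W by simp
qed

text \<open>\<open>e\<close> is itself a section over \<open>V\<close>, so its coefficient with
  respect to \<open>e'\<close> is holomorphic: these are the transition functions.\<close>

lemma frame_quotient:
  assumes "frame X L V e" "frame X L V e'"
  shows "(\<lambda>z. e z / e' z) \<in> hol X V"
  using frameD(3)[OF assms(2) frameD(1)[OF assms(2)] order_refl, of e] frame_section[OF assms(1)] by simp

lemma frame_cong:
  assumes "frame X L V e" "\<And>z. z \<in> V \<Longrightarrow> e z = e' z"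
  shows "frame X L V e'"
proof -
  have "(\<lambda>z. s z / e z) \<in> hol X W \<longleftrightarrow> (\<lambda>z. s z / e' z) \<in> hol X W" if "W \<subseteq> V" for W s
  proof
    show "(\<lambda>z. s z / e z) \<in> hol X W \<Longrightarrow> (\<lambda>z. s z / e' z) \<in> hol X W"
      by (erule hol_cong) (use that assms(2) in auto)
    show "(\<lambda>z. s z / e' z) \<in> hol X W \<Longrightarrow> (\<lambda>z. s z / e z) \<in> hol X W"
      by (erule hol_cong) (use that assms(2) in auto)
  qed
  then show ?thesis using assms unfolding frame_def by metis
qed

lemma line_bundle_iff: "line_bundle X U L \<longleftrightarrow> openin (ctop X) U \<and> function_sheaf (ctop X) U L \<and>
  (\<forall>x\<in>U. \<exists>V e. x \<in> V \<and> V \<subseteq> U \<and> frame X L V e)"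
proof -
  have eq: "(\<exists>f\<in>hol X W. \<forall>z\<in>W. s z = f z * e z) \<longleftrightarrow> (\<lambda>z. s z / e z) \<in> hol X W"
    if "\<forall>z\<in>V. e z \<noteq> 0" "W \<subseteq> V" for W V e and s :: "'a \<Rightarrow> complex"
  proof
    assume "\<exists>f\<in>hol X W. \<forall>z\<in>W. s z = f z * e z"
    then obtain f where "f \<in> hol X W" "\<forall>z\<in>W. s z = f z * e z" by blast
    then show "(\<lambda>z. s z / e z) \<in> hol X W" using that by (elim hol_cong) auto
  next
    assume "(\<lambda>z. s z / e z) \<in> hol X W"
    then show "\<exists>f\<in>hol X W. \<forall>z\<in>W. s z = f z * e z"
      using that by (intro bexI[of _ "\<lambda>z. s z / e z"]) auto
  qed
  have "(openin (ctop X) V \<and> x \<in> V \<and> V \<subseteq> U \<and> (\<forall>z\<in>V. e z \<noteq> 0) \<and>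
        (\<forall>W s. openin (ctop X) W \<and> W \<subseteq> V \<longrightarrow>
           (s \<in> L W \<longleftrightarrow> (\<exists>f\<in>hol X W. \<forall>z\<in>W. s z = f z * e z)))) \<longleftrightarrow>
      x \<in> V \<and> V \<subseteq> U \<and> frame X L V e" for x V e
    by (cases "\<forall>z\<in>V. e z \<noteq> 0") (auto simp: frame_def eq)
  then show ?thesis unfolding line_bundle_def by simp
qed

lemma line_bundleD:
  assumes "line_bundle X U L"
  shows "openin (ctop X) U" "function_sheaf (ctop X) U L"
  using assms unfolding line_bundle_def by simp_all

lemma line_bundle_frame:
  assumes "line_bundle X U L" "x \<in> U" "openin (ctop X) U'" "x \<in> U'"
  obtains V e where "x \<in> V" "V \<subseteq> U" "V \<subseteq> U'" "frame X L V e"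
proof -
  obtain V e where V: "x \<in> V" "V \<subseteq> U" "frame X L V e"
    using assms(1,2) unfolding line_bundle_iff by meson
  have "frame X L (V \<inter> U') e" using frame_subset[OF V(3)] frameD(1)[OF V(3)] assms(3) by blast
  then show thesis using that[of "V \<inter> U'" e] V assms(4) by blast
qed

lemma line_bundle_frame2:
  assumes "line_bundle X U L" "line_bundle X U M" "x \<in> U" "openin (ctop X) U'" "x \<in> U'"
  obtains V e e' where "x \<in> V" "V \<subseteq> U" "V \<subseteq> U'" "frame X L V e" "frame X M V e'"
proof -
  obtain V e where V: "x \<in> V" "V \<subseteq> U" "V \<subseteq> U'" "frame X L V e"
    by (rule line_bundle_frame[OF assms(1,3,4,5)])
  obtain V' e' where V': "x \<in> V'" "V' \<subseteq> U" "V' \<subseteq> V" "frame X M V' e'"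
    by (rule line_bundle_frame[OF assms(2,3) frameD(1)[OF V(4)] V(1)])
  show thesis
    by (rule that[OF V'(1,2) _ frame_subset[OF V(4) frameD(1)[OF V'(4)] V'(3)] V'(4)]) (use V V' in blast)
qed

lemma isom_frame:
  assumes "function_sheaf (ctop X) U' L'" "isom X U L L' h" "frame X L V e" "V \<subseteq> U"
  shows "frame X L' V (\<lambda>z. h z * e z)"
  unfolding frame_def
proof (intro conjI ballI allI impI)
  show "openin (ctop X) V" by (rule frameD(1)[OF assms(3)])
  show "h z * e z \<noteq> 0" if "z \<in> V" for z
    using that frameD(2)[OF assms(3)] isomD(1)[OF assms(2)] assms(4) by auto
  fix W s assume W: "openin (ctop X) W \<and> W \<subseteq> V"
  have "s \<in> L' W \<longleftrightarrow> (\<lambda>z. inverse (h z) * s z) \<in> L W"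
    using isomD(2)[OF isom_inverse[OF assms(1,2)]] W assms(4) by auto
  also have "\<dots> \<longleftrightarrow> (\<lambda>z. inverse (h z) * s z / e z) \<in> hol X W"
    using frameD(3)[OF assms(3)] W by simp
  also have "(\<lambda>z. inverse (h z) * s z / e z) = (\<lambda>z. s z / (h z * e z))"
    by (intro ext) (simp add: divide_simps)
  finally show "s \<in> L' W \<longleftrightarrow> (\<lambda>z. s z / (h z * e z)) \<in> hol X W" .
qed

lemma isom_frames:
  assumes L: "frame X L V e" and L': "frame X L' V e'"
  shows "isom X V L L' (\<lambda>z. e' z / e z)"
  unfolding isom_def
proof (intro conjI ballI allI impI)
  show "e' z / e z \<noteq> 0" if "z \<in> V" for z using that frameD(2)[OF L] frameD(2)[OF L'] by simp
  fix W s assume W: "openin (ctop X) W \<and> W \<subseteq> V"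
  have "(\<lambda>z. s z / e z) \<in> hol X W \<longleftrightarrow> (\<lambda>z. e' z / e z * s z / e' z) \<in> hol X W"
  proof
    show "(\<lambda>z. s z / e z) \<in> hol X W \<Longrightarrow> (\<lambda>z. e' z / e z * s z / e' z) \<in> hol X W"
      by (erule hol_cong) (use W frameD(2)[OF L'] in auto)
    show "(\<lambda>z. e' z / e z * s z / e' z) \<in> hol X W \<Longrightarrow> (\<lambda>z. s z / e z) \<in> hol X W"
      by (erule hol_cong) (use W frameD(2)[OF L'] in auto)
  qed
  then show "s \<in> L W \<longleftrightarrow> (\<lambda>x. e' x / e x * s x) \<in> L' W" using frameD(3)[OF L] frameD(3)[OF L'] W by simp
qed

lemma isom_glue:
  assumes L: "function_sheaf (ctop X) U L" and L': "function_sheaf (ctop X) U' L'"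
    and U: "V \<subseteq> U" "V \<subseteq> U'"
    and loc: "\<And>x. x \<in> V \<Longrightarrow> \<exists>W. openin (ctop X) W \<and> x \<in> W \<and> isom X W L L' h"
  shows "isom X V L L' h"
  unfolding isom_def
proof (intro conjI ballI allI impI)
  show "h x \<noteq> 0" if "x \<in> V" for x using loc[OF that] isomD(1)[of X _ L L' h x] by blast
  have glue: "s \<in> F W" if F: "function_sheaf (ctop X) A F" "V \<subseteq> A" and W: "openin (ctop X) W \<and> W \<subseteq> V"
    and s: "\<And>W'. W' \<subseteq> W \<Longrightarrow> openin (ctop X) W' \<Longrightarrow> isom X W' L L' h \<Longrightarrow> s \<in> F W'" for F A W s
  proof (rule function_sheafD(4)[OF F(1)])
    show "openin (ctop X) W" "W \<subseteq> A" using W F(2) by auto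
    fix x assume x: "x \<in> W"
    then obtain W' where W': "openin (ctop X) W'" "x \<in> W'" "isom X W' L L' h" using loc[of x] W by blast
    then have o: "openin (ctop X) (W \<inter> W')" using W by blast
    then have "s \<in> F (W \<inter> W')" using isom_subset[OF W'(3)] by (intro s) auto
    then show "\<exists>V' t. openin (ctop X) V' \<and> x \<in> V' \<and> V' \<subseteq> W \<and> t \<in> F V' \<and> (\<forall>z\<in>V'. s z = t z)"
      using o x W'(2) by (intro exI[of _ "W \<inter> W'"] exI[of _ s]) auto
  qed
  fix W s assume W: "openin (ctop X) W \<and> W \<subseteq> V"
  show "s \<in> L W \<longleftrightarrow> (\<lambda>x. h x * s x) \<in> L' W"
  proof
    assume s: "s \<in> L W"
    show "(\<lambda>x. h x * s x) \<in> L' W"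
    proof (rule glue[OF L' U(2) W])
      fix W' assume W': "W' \<subseteq> W" "openin (ctop X) W'" "isom X W' L L' h"
      then show "(\<lambda>x. h x * s x) \<in> L' W'"
        using isomD(2)[OF W'(3,2) order_refl, of s] function_sheafD(3)[OF L s W'(2,1)] by simp
    qed
  next
    assume s: "(\<lambda>x. h x * s x) \<in> L' W"
    show "s \<in> L W"
    proof (rule glue[OF L U(1) W])
      fix W' assume W': "W' \<subseteq> W" "openin (ctop X) W'" "isom X W' L L' h"
      then show "s \<in> L W'"
        using isomD(2)[OF W'(3,2) order_refl, of s] function_sheafD(3)[OF L' s W'(2,1)] by simp
    qed
  qed
qed

text \<open>The usual criterion for isomorphisms below. Since \<open>h\<close> is one function given
  in advance, there is no overlap condition; a single pair of corresponding frames at each point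
  suffices.\<close>

lemma isom_by_frames:
  assumes "function_sheaf (ctop X) U L" "function_sheaf (ctop X) U' L'" "V \<subseteq> U" "V \<subseteq> U'"
    and loc: "\<And>x. x \<in> V \<Longrightarrow> \<exists>W e. x \<in> W \<and> (\<forall>z\<in>W. h z \<noteq> 0) \<and> frame X L W e \<and> frame X L' W (\<lambda>z. h z * e z)"
  shows "isom X V L L' h"
proof (rule isom_glue[OF assms(1-4)])
  fix x assume "x \<in> V"
  then obtain W e where W: "x \<in> W" "\<forall>z\<in>W. h z \<noteq> 0" "frame X L W e" "frame X L' W (\<lambda>z. h z * e z)"
    using loc by blast
  have "isom X W L L' h"
    by (rule isom_cong[OF assms(2) isom_frames[OF W(3,4)]]) (use frameD(2)[OF W(3)] in simp)
  then show "\<exists>W. openin (ctop X) W \<and> x \<in> W \<and> isom X W L L' h" using W(1) frameD(1)[OF W(3)] by (intro exI[of _ W]) simp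
qed

text \<open>A common frame at every point makes the constant 1 an isomorphism, and that is equality.
  Strict associativity, unit laws and compatibility of tensor products with restriction and
  pull-back all come from here.\<close>

lemma lb_eqI:
  assumes L: "function_sheaf (ctop X) U L" and L': "function_sheaf (ctop X) U L'"
    and loc: "\<And>x. x \<in> U \<Longrightarrow> \<exists>V e. x \<in> V \<and> frame X L V e \<and> frame X L' V e"
  shows "L = L'"
proof (intro ext Set.set_eqI)
  have i: "isom X U L L' (\<lambda>_. 1)"
    by (rule isom_by_frames[OF L L' order_refl order_refl]) (use loc in simp)
  fix W s
  show "s \<in> L W \<longleftrightarrow> s \<in> L' W"
  proof (cases "openin (ctop X) W \<and> W \<subseteq> U")
    case True
    then show ?thesis using isomD(2)[OF i, of W s] by simp
  next
    \<comment> \<open>Over a set that is not open or leaves \<open>U\<close>, neither sheaf has a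
      section.\<close>
    case False
    then show ?thesis using function_sheafD(1,2)[OF L, of s W] function_sheafD(1,2)[OF L', of s W] by blast
  qed
qed

lemma line_bundle_lb_res:
  assumes "line_bundle X U L" "openin (ctop X) V" "V \<subseteq> U"
  shows "line_bundle X V (lb_res V L)"
  unfolding line_bundle_iff
proof (intro conjI ballI)
  show "openin (ctop X) V" by fact
  show "function_sheaf (ctop X) V (lb_res V L)"
    by (rule function_sheaf_lb_res[OF line_bundleD(2)[OF assms(1)] assms(3)])
  fix x assume x: "x \<in> V"
  then have "x \<in> U" using assms(3) by blast
  obtain W e where W: "x \<in> W" "W \<subseteq> U" "W \<subseteq> V" "frame X L W e"
    by (rule line_bundle_frame[OF assms(1) \<open>x \<in> U\<close> assms(2) x])
  then show "\<exists>W e. x \<in> W \<and> W \<subseteq> V \<and> frame X (lb_res V L) W e"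
    by (intro exI[of _ W] exI[of _ e]) (simp add: frame_lb_res[OF W(3)])
qed

section \<open>Tensor products and pull-backs\<close>

lemma lb_tensor_commute: "lb_tensor X L M = lb_tensor X M L"
proof -
  have "s \<in> lb_tensor X M L W" if "s \<in> lb_tensor X L M W" for L M W s
    using that unfolding lb_tensor_def mem_Collect_eq by (metis mult.commute)
  then show ?thesis by (intro ext Set.set_eqI iffI)
qed

lemma function_sheaf_lb_tensor:
  assumes L: "function_sheaf (ctop X) U L" and M: "function_sheaf (ctop X) U M"
  shows "function_sheaf (ctop X) U (lb_tensor X L M)"
  unfolding function_sheaf_def
proof (intro conjI allI impI)
  fix W s assume s: "s \<in> lb_tensor X L M W"
  then show "openin (ctop X) W" unfolding lb_tensor_def by simp
  show "W \<subseteq> U"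
  proof
    fix x assume "x \<in> W"
    then obtain V a where "x \<in> V" "a \<in> L V" using s unfolding lb_tensor_def by blast
    then show "x \<in> U" using function_sheafD(2)[OF L, of a V] by blast
  qed
next
  fix W s assume *: "openin (ctop X) W \<and> W \<subseteq> U \<and>
        (\<forall>x\<in>W. \<exists>V t. openin (ctop X) V \<and> x \<in> V \<and> V \<subseteq> W \<and> t \<in> lb_tensor X L M V \<and> (\<forall>z\<in>V. s z = t z))"
  show "s \<in> lb_tensor X L M W" unfolding lb_tensor_def mem_Collect_eq
  proof (intro conjI ballI)
    show "openin (ctop X) W" using * by blast
    fix x assume "x \<in> W"
    then obtain V t where V: "x \<in> V" "V \<subseteq> W" "t \<in> lb_tensor X L M V" "\<forall>z\<in>V. s z = t z"
      using * by meson
    then obtain V' a b where "openin (ctop X) V'" "x \<in> V'" "V' \<subseteq> V" "a \<in> L V'" "b \<in> M V'" "\<forall>z\<in>V'. t z = a z * b z"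
      unfolding lb_tensor_def mem_Collect_eq by meson
    then show "\<exists>V a b. openin (ctop X) V \<and> x \<in> V \<and> V \<subseteq> W \<and> a \<in> L V \<and> b \<in> M V \<and> (\<forall>z\<in>V. s z = a z * b z)"
      using V by (intro exI[of _ V'] exI[of _ a] exI[of _ b]) auto
  qed
next
  fix W W' s assume *: "s \<in> lb_tensor X L M W \<and> openin (ctop X) W' \<and> W' \<subseteq> W"
  show "s \<in> lb_tensor X L M W'" unfolding lb_tensor_def mem_Collect_eq
  proof (intro conjI ballI)
    show "openin (ctop X) W'" using * by blast
    fix x assume x: "x \<in> W'"
    then have "x \<in> W" using * by blast
    then obtain V a b where V: "openin (ctop X) V" "x \<in> V" "V \<subseteq> W" "a \<in> L V" "b \<in> M V" "\<forall>z\<in>V. s z = a z * b z"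
      using * unfolding lb_tensor_def mem_Collect_eq by meson
    have o: "openin (ctop X) (V \<inter> W')" using V(1) * by blast
    then show "\<exists>V a b. openin (ctop X) V \<and> x \<in> V \<and> V \<subseteq> W' \<and> a \<in> L V \<and> b \<in> M V \<and> (\<forall>z\<in>V. s z = a z * b z)"
      using V x function_sheafD(3)[OF L V(4) o] function_sheafD(3)[OF M V(5) o]
      by (intro exI[of _ "V \<inter> W'"] exI[of _ a] exI[of _ b]) auto
  qed
qed

lemma frame_lb_tensor:
  assumes e: "frame X L V e" and e': "frame X M V e'"
  shows "frame X (lb_tensor X L M) V (\<lambda>z. e z * e' z)"
  unfolding frame_def
proof (intro conjI ballI allI impI)
  show "openin (ctop X) V" by (rule frameD(1)[OF e])
  show "e z * e' z \<noteq> 0" if "z \<in> V" for z using that frameD(2)[OF e] frameD(2)[OF e'] by simp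
  fix W s assume W: "openin (ctop X) W \<and> W \<subseteq> V"
  show "s \<in> lb_tensor X L M W \<longleftrightarrow> (\<lambda>z. s z / (e z * e' z)) \<in> hol X W"
  proof
    assume s: "s \<in> lb_tensor X L M W"
    show "(\<lambda>z. s z / (e z * e' z)) \<in> hol X W"
    proof (rule hol_glue)
      show "openin (ctop X) W" using W by blast
      fix x assume "x \<in> W"
      then obtain V' a b where V': "openin (ctop X) V'" "x \<in> V'" "V' \<subseteq> W" "a \<in> L V'" "b \<in> M V'"
        "\<forall>z\<in>V'. s z = a z * b z" using s unfolding lb_tensor_def mem_Collect_eq by meson
      have "V' \<subseteq> V" using V'(3) W by blast
      then have "(\<lambda>z. (a z / e z) * (b z / e' z)) \<in> hol X V'"
        using frameD(3)[OF e V'(1), of a] frameD(3)[OF e' V'(1), of b] V'(4,5) by (intro hol_mult) auto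
      then have "(\<lambda>z. s z / (e z * e' z)) \<in> hol X V'" by (rule hol_cong) (use V'(6) in simp)
      then show "\<exists>V'. x \<in> V' \<and> V' \<subseteq> W \<and> (\<lambda>z. s z / (e z * e' z)) \<in> hol X V'" using V' by blast
    qed
  next
    assume "(\<lambda>z. s z / (e z * e' z)) \<in> hol X W"
    \<comment> \<open>One factorisation on all of \<open>W\<close> is enough: the whole coefficient
      goes into the first factor \<open>s / e'\<close>, and the second factor is the frame
      \<open>e'\<close>.\<close>
    then have "(\<lambda>z. s z / e' z / e z) \<in> hol X W" by (rule hol_cong) simp
    then have "(\<lambda>z. s z / e' z) \<in> L W" using frameD(3)[OF e, of W "\<lambda>z. s z / e' z"] W by simp
    moreover have "e' \<in> M W" using frame_section[OF frame_subset[OF e', of W]] W by simp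
    moreover have "\<forall>z\<in>W. s z = s z / e' z * e' z" using frameD(2)[OF e'] W by auto
    ultimately show "s \<in> lb_tensor X L M W"
      unfolding lb_tensor_def mem_Collect_eq using W
      by (intro conjI ballI exI[of _ W] exI[of _ "\<lambda>z. s z / e' z"] exI[of _ e']) auto
  qed
qed

lemma line_bundle_lb_tensor:
  assumes "line_bundle X U L" "line_bundle X U M"
  shows "line_bundle X U (lb_tensor X L M)"
  unfolding line_bundle_iff
proof (intro conjI ballI)
  show "openin (ctop X) U" by (rule line_bundleD(1)[OF assms(1)])
  then have U: "openin (ctop X) U" .
  show "function_sheaf (ctop X) U (lb_tensor X L M)"
    by (rule function_sheaf_lb_tensor[OF line_bundleD(2)[OF assms(1)] line_bundleD(2)[OF assms(2)]])
  fix x assume x: "x \<in> U"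
  obtain V e e' where V: "x \<in> V" "V \<subseteq> U" "V \<subseteq> U" "frame X L V e" "frame X M V e'"
    by (rule line_bundle_frame2[OF assms x U x])
  then show "\<exists>V e. x \<in> V \<and> V \<subseteq> U \<and> frame X (lb_tensor X L M) V e"
    using frame_lb_tensor[OF V(4,5)] by (intro exI[of _ V] exI[of _ "\<lambda>z. e z * e' z"]) simp
qed

lemma frame_lb_trivial:
  assumes "openin (ctop X) V" "V \<subseteq> U"
  shows "frame X (lb_trivial X U) V (\<lambda>_. 1)"
  using assms unfolding frame_def lb_trivial_def lb_res_def by auto

lemma line_bundle_lb_trivial:
  assumes "openin (ctop X) U"
  shows "line_bundle X U (lb_trivial X U)"
  unfolding line_bundle_iff
proof (intro conjI ballI)
  show "function_sheaf (ctop X) U (lb_trivial X U)"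
    unfolding lb_trivial_def by (rule function_sheaf_lb_res[OF hol_sheaf openin_subset[OF assms]])
  fix x assume "x \<in> U"
  then show "\<exists>V e. x \<in> V \<and> V \<subseteq> U \<and> frame X (lb_trivial X U) V e"
    using frame_lb_trivial[OF assms order_refl] by blast
qed fact

lemma lb_tensor_assoc:
  assumes "line_bundle X U L" "line_bundle X U M" "line_bundle X U N"
  shows "lb_tensor X (lb_tensor X L M) N = lb_tensor X L (lb_tensor X M N)"
proof (rule lb_eqI)
  note lb = line_bundle_lb_tensor
  show "function_sheaf (ctop X) U (lb_tensor X (lb_tensor X L M) N)"
    by (rule line_bundleD(2)[OF lb[OF lb[OF assms(1,2)] assms(3)]])
  show "function_sheaf (ctop X) U (lb_tensor X L (lb_tensor X M N))"
    by (rule line_bundleD(2)[OF lb[OF assms(1) lb[OF assms(2,3)]]])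
  fix x assume x: "x \<in> U"
  obtain V e e' where V: "x \<in> V" "V \<subseteq> U" "V \<subseteq> U" "frame X L V e" "frame X M V e'"
    by (rule line_bundle_frame2[OF assms(1,2) x line_bundleD(1)[OF assms(1)] x])
  obtain V' e'' where V': "x \<in> V'" "V' \<subseteq> U" "V' \<subseteq> V" "frame X N V' e''"
    by (rule line_bundle_frame[OF assms(3) x frameD(1)[OF V(4)] V(1)])
  note e = frame_subset[OF V(4) frameD(1)[OF V'(4)] V'(3)]
  note e' = frame_subset[OF V(5) frameD(1)[OF V'(4)] V'(3)]
  have "frame X (lb_tensor X (lb_tensor X L M) N) V' (\<lambda>z. e z * e' z * e'' z)"
    by (intro frame_lb_tensor e e' V')
  moreover have "frame X (lb_tensor X L (lb_tensor X M N)) V' (\<lambda>z. e z * (e' z * e'' z))"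
    by (intro frame_lb_tensor e e' V')
  ultimately show "\<exists>V e. x \<in> V \<and> frame X (lb_tensor X (lb_tensor X L M) N) V e \<and>
      frame X (lb_tensor X L (lb_tensor X M N)) V e" using V'(1) by (auto simp: mult.assoc)
qed

lemma lb_res_lb_tensor:
  assumes "line_bundle X U L" "line_bundle X U M" "openin (ctop X) V" "V \<subseteq> U"
  shows "lb_res V (lb_tensor X L M) = lb_tensor X (lb_res V L) (lb_res V M)"
proof (rule lb_eqI)
  show "function_sheaf (ctop X) V (lb_res V (lb_tensor X L M))"
    by (rule line_bundleD(2)[OF line_bundle_lb_res[OF line_bundle_lb_tensor[OF assms(1,2)] assms(3,4)]])
  show "function_sheaf (ctop X) V (lb_tensor X (lb_res V L) (lb_res V M))"
    by (rule line_bundleD(2)[OF line_bundle_lb_tensor[OF line_bundle_lb_res[OF assms(1,3,4)]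
      line_bundle_lb_res[OF assms(2,3,4)]]])
  fix x assume x: "x \<in> V"
  then have xU: "x \<in> U" using assms(4) by blast
  obtain W e e' where W: "x \<in> W" "W \<subseteq> U" "W \<subseteq> V" "frame X L W e" "frame X M W e'"
    by (rule line_bundle_frame2[OF assms(1,2) xU assms(3) x])
  have "frame X (lb_res V (lb_tensor X L M)) W (\<lambda>z. e z * e' z)"
    unfolding frame_lb_res[OF W(3)] by (rule frame_lb_tensor[OF W(4,5)])
  moreover have "frame X (lb_tensor X (lb_res V L) (lb_res V M)) W (\<lambda>z. e z * e' z)"
    by (rule frame_lb_tensor) (simp_all add: frame_lb_res[OF W(3)] W)
  ultimately show "\<exists>W e. x \<in> W \<and> frame X (lb_res V (lb_tensor X L M)) W e \<and>
     frame X (lb_tensor X (lb_res V L) (lb_res V M)) W e"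
    using W(1) by (intro exI[of _ W] exI[of _ "\<lambda>z. e z * e' z"]) simp
qed

end

section \<open>Pull-back of line bundles along a holomorphic map\<close>

locale fspace_map = X: fspace X + Y: fspace Y for X :: "'a cspace" and Y :: "'b cspace" +
  fixes \<rho> :: "'b \<Rightarrow> 'a"
  assumes hol_map: "holomorphic_map Y X \<rho>"
begin

abbreviation ov :: "'a set \<Rightarrow> 'b set" where "ov \<equiv> over Y \<rho>"

lemma ov_iff: "y \<in> ov U \<longleftrightarrow> y \<in> pts Y \<and> \<rho> y \<in> U"
  unfolding over_def by simp

lemma ov_mono: "V \<subseteq> U \<Longrightarrow> ov V \<subseteq> ov U" and ov_Int: "ov (U \<inter> V) = ov U \<inter> ov V"
  and ov_pts: "ov (pts X) = pts Y"
  using hol_map unfolding over_def holomorphic_map_def continuous_map_def by auto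

lemma openin_ov: "openin (ctop X) U \<Longrightarrow> openin (ctop Y) (ov U)"
  using hol_map unfolding over_def holomorphic_map_def by (intro openin_continuous_map_preimage) auto

lemma hol_pull: "g \<in> hol X W \<Longrightarrow> (\<lambda>y. g (\<rho> y)) \<in> hol Y (ov W)"
  using hol_map unfolding over_def holomorphic_map_def comp_def by blast

lemma function_sheaf_lb_pull:
  assumes M: "function_sheaf (ctop X) U M"
  shows "function_sheaf (ctop Y) (ov U) (lb_pull Y \<rho> M)"
  unfolding function_sheaf_def
proof (intro conjI allI impI)
  fix W s assume s: "s \<in> lb_pull Y \<rho> M W"
  then show W: "openin (ctop Y) W" unfolding lb_pull_def by simp
  show "W \<subseteq> ov U"
  proof
    fix y assume y: "y \<in> W"
    then obtain V U' t where "y \<in> V" "t \<in> M U'" "\<rho> ` V \<subseteq> U'" using s unfolding lb_pull_def by blast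
    then show "y \<in> ov U" using function_sheafD(2)[OF M, of t U'] openin_subset[OF W] y unfolding ov_iff by blast
  qed
next
  fix W s assume *: "openin (ctop Y) W \<and> W \<subseteq> ov U \<and>
        (\<forall>x\<in>W. \<exists>V t. openin (ctop Y) V \<and> x \<in> V \<and> V \<subseteq> W \<and> t \<in> lb_pull Y \<rho> M V \<and> (\<forall>z\<in>V. s z = t z))"
  show "s \<in> lb_pull Y \<rho> M W" unfolding lb_pull_def mem_Collect_eq
  proof (intro conjI ballI)
    show "openin (ctop Y) W" using * by blast
    fix y assume "y \<in> W"
    then obtain V t where V: "y \<in> V" "V \<subseteq> W" "t \<in> lb_pull Y \<rho> M V" "\<forall>z\<in>V. s z = t z"
      using * by meson
    then obtain V' f U' t' where "openin (ctop Y) V'" "y \<in> V'" "V' \<subseteq> V" "f \<in> hol Y V'" "t' \<in> M U'"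
       "\<rho> ` V' \<subseteq> U'" "\<forall>z\<in>V'. t z = f z * t' (\<rho> z)"
      unfolding lb_pull_def mem_Collect_eq by meson
    then show "\<exists>V f U t. openin (ctop Y) V \<and> y \<in> V \<and> V \<subseteq> W \<and> f \<in> hol Y V \<and> t \<in> M U \<and>
        \<rho> ` V \<subseteq> U \<and> (\<forall>z\<in>V. s z = f z * t (\<rho> z))"
      using V by (intro exI[of _ V'] exI[of _ f] exI[of _ U'] exI[of _ t']) auto
  qed
next
  fix W W' s assume *: "s \<in> lb_pull Y \<rho> M W \<and> openin (ctop Y) W' \<and> W' \<subseteq> W"
  show "s \<in> lb_pull Y \<rho> M W'" unfolding lb_pull_def mem_Collect_eq
  proof (intro conjI ballI)
    show "openin (ctop Y) W'" using * by blast
    fix y assume y: "y \<in> W'"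
    then have "y \<in> W" using * by blast
    then obtain V f U' t where V: "openin (ctop Y) V" "y \<in> V" "V \<subseteq> W" "f \<in> hol Y V" "t \<in> M U'"
       "\<rho> ` V \<subseteq> U'" "\<forall>z\<in>V. s z = f z * t (\<rho> z)"
      using * unfolding lb_pull_def mem_Collect_eq by meson
    have o: "openin (ctop Y) (V \<inter> W')" using V(1) * by blast
    then show "\<exists>V f U t. openin (ctop Y) V \<and> y \<in> V \<and> V \<subseteq> W' \<and> f \<in> hol Y V \<and> t \<in> M U \<and>
        \<rho> ` V \<subseteq> U \<and> (\<forall>z\<in>V. s z = f z * t (\<rho> z))"
      using V y Y.hol_subset[OF V(4) o]
      by (intro exI[of _ "V \<inter> W'"] exI[of _ f] exI[of _ U'] exI[of _ t]) auto
  qed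
qed

lemma frame_lb_pull:
  assumes M: "function_sheaf (ctop X) U M" and e: "frame X M V e"
  shows "frame Y (lb_pull Y \<rho> M) (ov V) (\<lambda>y. e (\<rho> y))"
  unfolding frame_def
proof (intro conjI ballI allI impI)
  note V = frameD(1)[OF e]
  show "openin (ctop Y) (ov V)" by (rule openin_ov[OF V])
  show "e (\<rho> z) \<noteq> 0" if "z \<in> ov V" for z using that frameD(2)[OF e] unfolding ov_iff by simp
  fix W s assume W: "openin (ctop Y) W \<and> W \<subseteq> ov V"
  show "s \<in> lb_pull Y \<rho> M W \<longleftrightarrow> (\<lambda>z. s z / e (\<rho> z)) \<in> hol Y W"
  proof
    assume s: "s \<in> lb_pull Y \<rho> M W"
    show "(\<lambda>z. s z / e (\<rho> z)) \<in> hol Y W"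
    proof (rule Y.hol_glue)
      show "openin (ctop Y) W" using W by blast
      fix y assume y: "y \<in> W"
      then obtain V' f U' t where V': "openin (ctop Y) V'" "y \<in> V'" "V' \<subseteq> W" "f \<in> hol Y V'" "t \<in> M U'"
        "\<rho> ` V' \<subseteq> U'" "\<forall>z\<in>V'. s z = f z * t (\<rho> z)"
        using s unfolding lb_pull_def mem_Collect_eq by meson
      \<comment> \<open>The section \<open>t\<close> may live on a set \<open>U'\<close> that
        reaches beyond the domain of \<open>e\<close>; both are cut down to the intersection before
        the coefficient is formed.\<close>
      have o: "openin (ctop X) (U' \<inter> V)" using function_sheafD(1)[OF M V'(5)] V by blast
      have "t \<in> M (U' \<inter> V)" using function_sheafD(3)[OF M V'(5) o] by blast
      then have "(\<lambda>x. t x / e x) \<in> hol X (U' \<inter> V)" using frameD(3)[OF e o, of t] by simp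
      from hol_pull[OF this] have t: "(\<lambda>y. t (\<rho> y) / e (\<rho> y)) \<in> hol Y (ov (U' \<inter> V))" .
      have "V' \<subseteq> ov (U' \<inter> V)" using V'(3,6) W unfolding ov_Int by (auto simp: subset_iff ov_iff)
      then have "(\<lambda>y. t (\<rho> y) / e (\<rho> y)) \<in> hol Y V'" by (rule Y.hol_subset[OF t V'(1)])
      from Y.hol_mult[OF V'(4) this] have "(\<lambda>z. s z / e (\<rho> z)) \<in> hol Y V'"
        by (rule Y.hol_cong) (use V'(7) in simp)
      then show "\<exists>V'. y \<in> V' \<and> V' \<subseteq> W \<and> (\<lambda>z. s z / e (\<rho> z)) \<in> hol Y V'" using V' by blast
    qed
  next
    assume h: "(\<lambda>z. s z / e (\<rho> z)) \<in> hol Y W"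
    have "\<rho> ` W \<subseteq> V" using W unfolding over_def by blast
    moreover have "s z = s z / e (\<rho> z) * e (\<rho> z)" if "z \<in> W" for z
      using that W frameD(2)[OF e] unfolding over_def by auto
    ultimately show "s \<in> lb_pull Y \<rho> M W"
      unfolding lb_pull_def mem_Collect_eq using W h X.frame_section[OF e]
      by (intro conjI ballI exI[of _ W] exI[of _ "\<lambda>z. s z / e (\<rho> z)"] exI[of _ V] exI[of _ e]) auto
  qed
qed

lemma line_bundle_lb_pull:
  assumes "line_bundle X U M"
  shows "line_bundle Y (ov U) (lb_pull Y \<rho> M)"
  unfolding Y.line_bundle_iff
proof (intro conjI ballI)
  note M = X.line_bundleD[OF assms]
  show "openin (ctop Y) (ov U)" by (rule openin_ov[OF M(1)])
  show "function_sheaf (ctop Y) (ov U) (lb_pull Y \<rho> M)" by (rule function_sheaf_lb_pull[OF M(2)])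
  fix y assume y: "y \<in> ov U"
  then have x: "\<rho> y \<in> U" unfolding ov_iff by simp
  obtain V e where V: "\<rho> y \<in> V" "V \<subseteq> U" "V \<subseteq> U" "frame X M V e"
    by (rule X.line_bundle_frame[OF assms x M(1) x])
  have "y \<in> ov V" "ov V \<subseteq> ov U" using V y ov_mono unfolding ov_iff by auto
  then show "\<exists>V e. y \<in> V \<and> V \<subseteq> ov U \<and> frame Y (lb_pull Y \<rho> M) V e"
    using frame_lb_pull[OF M(2) V(4)] by blast
qed

lemma lb_eq_ovI:
  assumes "line_bundle Y (ov U) L" "line_bundle Y (ov U) L'"
    and loc: "\<And>y. y \<in> ov U \<Longrightarrow> \<rho> y \<in> U \<Longrightarrow> \<exists>V e. y \<in> V \<and> frame Y L V e \<and> frame Y L' V e"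
  shows "L = L'"
  by (rule Y.lb_eqI[OF Y.line_bundleD(2)[OF assms(1)] Y.line_bundleD(2)[OF assms(2)]])
    (use loc ov_iff in blast)

lemma lb_res_lb_pull:
  assumes "line_bundle X U M" "openin (ctop X) V" "V \<subseteq> U"
  shows "lb_res (ov V) (lb_pull Y \<rho> M) = lb_pull Y \<rho> (lb_res V M)"
proof (rule lb_eq_ovI)
  note M' = X.line_bundle_lb_res[OF assms]
  show "line_bundle Y (ov V) (lb_res (ov V) (lb_pull Y \<rho> M))"
    by (rule Y.line_bundle_lb_res[OF line_bundle_lb_pull[OF assms(1)] openin_ov[OF assms(2)] ov_mono[OF assms(3)]])
  show "line_bundle Y (ov V) (lb_pull Y \<rho> (lb_res V M))" by (rule line_bundle_lb_pull[OF M'])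
  fix y assume y: "y \<in> ov V" "\<rho> y \<in> V"
  have xU: "\<rho> y \<in> U" using assms(3) y by blast
  obtain W e where W: "\<rho> y \<in> W" "W \<subseteq> U" "W \<subseteq> V" "frame X M W e"
    by (rule X.line_bundle_frame[OF assms(1) xU assms(2) y(2)])
  have "frame Y (lb_res (ov V) (lb_pull Y \<rho> M)) (ov W) (\<lambda>y. e (\<rho> y))"
    unfolding frame_lb_res[OF ov_mono[OF W(3)]] by (rule frame_lb_pull[OF X.line_bundleD(2)[OF assms(1)] W(4)])
  moreover have "frame Y (lb_pull Y \<rho> (lb_res V M)) (ov W) (\<lambda>y. e (\<rho> y))"
    by (rule frame_lb_pull[OF X.line_bundleD(2)[OF M']]) (simp add: frame_lb_res[OF W(3)] W(4))
  ultimately show "\<exists>W e. y \<in> W \<and> frame Y (lb_res (ov V) (lb_pull Y \<rho> M)) W e \<and>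
     frame Y (lb_pull Y \<rho> (lb_res V M)) W e"
    using W(1) y by (intro exI[of _ "ov W"] exI[of _ "\<lambda>y. e (\<rho> y)"]) (simp add: ov_iff)
qed

lemma lb_pull_lb_tensor:
  assumes "line_bundle X U M" "line_bundle X U N"
  shows "lb_pull Y \<rho> (lb_tensor X M N) = lb_tensor Y (lb_pull Y \<rho> M) (lb_pull Y \<rho> N)"
proof (rule lb_eq_ovI)
  note MN = X.line_bundle_lb_tensor[OF assms]
  show "line_bundle Y (ov U) (lb_pull Y \<rho> (lb_tensor X M N))" by (rule line_bundle_lb_pull[OF MN])
  show "line_bundle Y (ov U) (lb_tensor Y (lb_pull Y \<rho> M) (lb_pull Y \<rho> N))"
    by (intro Y.line_bundle_lb_tensor line_bundle_lb_pull assms)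
  fix y assume y: "y \<in> ov U" "\<rho> y \<in> U"
  obtain V e e' where V: "\<rho> y \<in> V" "V \<subseteq> U" "V \<subseteq> U" "frame X M V e" "frame X N V e'"
    by (rule X.line_bundle_frame2[OF assms y(2) X.line_bundleD(1)[OF assms(1)] y(2)])
  have "frame Y (lb_pull Y \<rho> (lb_tensor X M N)) (ov V) (\<lambda>y. e (\<rho> y) * e' (\<rho> y))"
    by (rule frame_lb_pull[OF X.line_bundleD(2)[OF MN] X.frame_lb_tensor[OF V(4,5)]])
  moreover have "frame Y (lb_tensor Y (lb_pull Y \<rho> M) (lb_pull Y \<rho> N)) (ov V) (\<lambda>y. e (\<rho> y) * e' (\<rho> y))"
    by (rule Y.frame_lb_tensor[OF frame_lb_pull[OF X.line_bundleD(2)[OF assms(1)] V(4)]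
      frame_lb_pull[OF X.line_bundleD(2)[OF assms(2)] V(5)]])
  ultimately show "\<exists>V e. y \<in> V \<and> frame Y (lb_pull Y \<rho> (lb_tensor X M N)) V e \<and>
     frame Y (lb_tensor Y (lb_pull Y \<rho> M) (lb_pull Y \<rho> N)) V e"
    using V(1) y by (intro exI[of _ "ov V"] exI[of _ "\<lambda>y. e (\<rho> y) * e' (\<rho> y)"]) (simp add: ov_iff)
qed

lemma frame_lb_pull_tensor:
  assumes "line_bundle X U M" "frame X M V e" "frame Y L W e'" "W \<subseteq> ov V"
  shows "frame Y (lb_tensor Y (lb_pull Y \<rho> M) L) W (\<lambda>y. e (\<rho> y) * e' y)"
  by (rule Y.frame_lb_tensor[OF frame_subset[OF frame_lb_pull[OF X.line_bundleD(2)[OF assms(1)] assms(2)]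
      frameD(1)[OF assms(3)] assms(4)] assms(3)])

lemma lb_pull_trivial_tensor:
  assumes "openin (ctop X) U" "line_bundle Y (ov U) L"
  shows "lb_tensor Y (lb_pull Y \<rho> (lb_trivial X U)) L = L"
proof (rule lb_eq_ovI)
  note T = X.line_bundle_lb_trivial[OF assms(1)]
  show "line_bundle Y (ov U) (lb_tensor Y (lb_pull Y \<rho> (lb_trivial X U)) L)"
    by (intro Y.line_bundle_lb_tensor line_bundle_lb_pull assms T)
  show "line_bundle Y (ov U) L" by fact
  fix y assume y: "y \<in> ov U" "\<rho> y \<in> U"
  obtain V e where V: "y \<in> V" "V \<subseteq> ov U" "V \<subseteq> ov U" "frame Y L V e"
    by (rule Y.line_bundle_frame[OF assms(2) y(1) openin_ov[OF assms(1)] y(1)])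
  show "\<exists>V e. y \<in> V \<and> frame Y (lb_tensor Y (lb_pull Y \<rho> (lb_trivial X U)) L) V e \<and> frame Y L V e"
    using frame_lb_pull_tensor[OF T X.frame_lb_trivial[OF assms(1) order_refl] V(4,2)] V(1,4) by auto
qed

text \<open>The base frames come first, so that the frame of \<open>L\<close> can be chosen inside
  the preimage of their domain; a frame upstairs need not exist on a full preimage.\<close>

lemma frames_ov:
  assumes "line_bundle X U p" "line_bundle X U q" "line_bundle Y (ov U) L" "y \<in> ov U"
  obtains V W a b e where "\<rho> y \<in> V" "V \<subseteq> U" "frame X p V a" "frame X q V b" "y \<in> W" "W \<subseteq> ov V" "frame Y L W e"
proof -
  have x: "\<rho> y \<in> U" using assms(4) ov_iff by blast
  obtain V a b where V: "\<rho> y \<in> V" "V \<subseteq> U" "V \<subseteq> U" "frame X p V a" "frame X q V b"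
    by (rule X.line_bundle_frame2[OF assms(1,2) x X.line_bundleD(1)[OF assms(1)] x])
  have y: "y \<in> ov V" using V(1) assms(4) ov_iff by blast
  obtain W e where W: "y \<in> W" "W \<subseteq> ov U" "W \<subseteq> ov V" "frame Y L W e"
    by (rule Y.line_bundle_frame[OF assms(3,4) openin_ov[OF frameD(1)[OF V(4)]] y])
  show thesis by (rule that[OF V(1,2,4,5) W(1,3,4)])
qed

text \<open>The action of the Picard stack on morphisms. With \<open>f = 1\<close> it becomes the
  effect on morphisms of the functor that twists a fixed \<open>L\<close>.\<close>

lemma isom_pull_tensor:
  assumes p: "line_bundle X U p" and q: "line_bundle X U q"
    and L: "line_bundle Y (ov U) L" and L': "line_bundle Y (ov U) L'"
    and a: "isom X U p q a" and f: "isom Y (ov U) L L' f"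
  shows "isom Y (ov U) (lb_tensor Y (lb_pull Y \<rho> p) L) (lb_tensor Y (lb_pull Y \<rho> q) L') (\<lambda>y. a (\<rho> y) * f y)"
proof (rule Y.isom_by_frames[OF _ _ order_refl order_refl])
  show "function_sheaf (ctop Y) (ov U) (lb_tensor Y (lb_pull Y \<rho> p) L)"
    "function_sheaf (ctop Y) (ov U) (lb_tensor Y (lb_pull Y \<rho> q) L')"
    by (intro Y.line_bundleD(2)[OF Y.line_bundle_lb_tensor] line_bundle_lb_pull assms)+
  fix y assume y: "y \<in> ov U"
  obtain V W b c e where V: "\<rho> y \<in> V" "V \<subseteq> U" "frame X p V b" "frame X q V c" "y \<in> W" "W \<subseteq> ov V" "frame Y L W e"
    by (rule frames_ov[OF p q L y])
  have WU: "W \<subseteq> ov U" using V(2,6) ov_mono by blast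
  have nz: "\<forall>z\<in>W. a (\<rho> z) * f z \<noteq> 0"
    using WU isomD(1)[OF a] isomD(1)[OF f] ov_iff by auto
  have aq: "frame X q V (\<lambda>z. a z * b z)" by (rule X.isom_frame[OF X.line_bundleD(2)[OF q] a V(3,2)])
  have fe: "frame Y L' W (\<lambda>z. f z * e z)" by (rule Y.isom_frame[OF Y.line_bundleD(2)[OF L'] f V(7) WU])
  have "frame Y (lb_tensor Y (lb_pull Y \<rho> q) L') W (\<lambda>z. a (\<rho> z) * f z * (b (\<rho> z) * e z))"
    by (rule Y.frame_cong[OF frame_lb_pull_tensor[OF q aq fe V(6)]]) (simp add: ac_simps)
  then show "\<exists>W e. y \<in> W \<and> (\<forall>z\<in>W. a (\<rho> z) * f z \<noteq> 0) \<and> frame Y (lb_tensor Y (lb_pull Y \<rho> p) L) W e \<and>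
     frame Y (lb_tensor Y (lb_pull Y \<rho> q) L') W (\<lambda>z. a (\<rho> z) * f z * e z)"
    using frame_lb_pull_tensor[OF p V(3,7,6)] nz V(5)
    by (intro exI[of _ W] exI[of _ "\<lambda>y. b (\<rho> y) * e y"]) simp
qed

end

lemma fspace_map_id: "fspace X \<Longrightarrow> fspace_map X X (\<lambda>x. x)"
proof -
  assume "fspace X"
  then interpret fspace X .
  have "{x \<in> pts X. x \<in> W} = W" if "g \<in> hol X W" for g W
    using openin_subset[OF hol_openin[OF that]] by auto
  then show ?thesis
    by (simp add: fspace_map_def fspace_map_axioms_def \<open>fspace X\<close> holomorphic_map_def comp_def)
qed

text \<open>The regular action tensors without pulling back; this equation fits it into the general
  pattern of an action through \<open>\<rho>\<close>, with \<open>\<rho>\<close> the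
  identity.\<close>

lemma lb_pull_id:
  assumes "fspace X" "line_bundle X U M"
  shows "lb_pull X (\<lambda>x. x) M = M"
proof -
  interpret fspace_map X X "\<lambda>x. x" by (rule fspace_map_id[OF assms(1)])
  have ov: "ov V = V" if "openin (ctop X) V" for V using openin_subset[OF that] ov_iff by auto
  note M = X.line_bundleD[OF assms(2)]
  show ?thesis
  proof (rule X.lb_eqI)
    show "function_sheaf (ctop X) U (lb_pull X (\<lambda>x. x) M)"
      using function_sheaf_lb_pull[OF M(2)] ov[OF M(1)] by simp
    show "function_sheaf (ctop X) U M" by fact
    fix x assume x: "x \<in> U"
    obtain V e where V: "x \<in> V" "V \<subseteq> U" "V \<subseteq> U" "frame X M V e"
      by (rule X.line_bundle_frame[OF assms(2) x M(1) x])
    show "\<exists>V e. x \<in> V \<and> frame X (lb_pull X (\<lambda>x. x) M) V e \<and> frame X M V e"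
      using frame_lb_pull[OF M(2) V(4)] V(1,4) ov[OF frameD(1)[OF V(4)]] by auto
  qed
qed

section \<open>Stacks of line bundles\<close>

context fspace
begin

text \<open>The fibre of the glued bundle at \<open>z\<close> is the fibre of \<open>x (\<kappa> z)\<close> for a chosen index \<open>\<kappa> z\<close>.\<close>

lemma line_bundle_descent:
  assumes x: "\<And>i. i \<in> I \<Longrightarrow> line_bundle X (A i) (x i)"
    and F: "\<And>i j. i \<in> I \<Longrightarrow> j \<in> I \<Longrightarrow> isom X (A i \<inter> A j) (x i) (x j) (F i j)"
    and cocycle: "\<And>i j k z. i \<in> I \<Longrightarrow> j \<in> I \<Longrightarrow> k \<in> I \<Longrightarrow> z \<in> A i \<Longrightarrow> z \<in> A j \<Longrightarrow> z \<in> A k \<Longrightarrow>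
      F j k z * F i j z = F i k z"
  obtains L \<psi> where "line_bundle X (\<Union>i\<in>I. A i) L" "\<And>i. i \<in> I \<Longrightarrow> isom X (A i) L (x i) (\<psi> i)"
    "\<And>i j z. i \<in> I \<Longrightarrow> j \<in> I \<Longrightarrow> z \<in> A i \<Longrightarrow> z \<in> A j \<Longrightarrow> F i j z * \<psi> i z = \<psi> j z"
proof -
  define U where "U = (\<Union>i\<in>I. A i)"
  have "\<forall>z\<in>U. \<exists>i. i \<in> I \<and> z \<in> A i" unfolding U_def by blast
  then obtain \<kappa> where \<kappa>: "\<And>z. z \<in> U \<Longrightarrow> \<kappa> z \<in> I \<and> z \<in> A (\<kappa> z)" by metis
  \<comment> \<open>Transition from the chosen fibre at \<open>z\<close> to the fibre of
    \<open>x i\<close>. The choice \<open>\<kappa>\<close> varies arbitrarily with \<open>z\<close>,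
    which is harmless because frames may be arbitrary non-zero functions.\<close>
  define \<psi> where "\<psi> = (\<lambda>i z. F (\<kappa> z) i z)"
  have AU: "A i \<subseteq> U" if "i \<in> I" for i using that unfolding U_def by blast
  have oA: "openin (ctop X) (A i)" if "i \<in> I" for i by (rule line_bundleD(1)[OF x[OF that]])
  have shx: "function_sheaf (ctop X) (A i) (x i)" if "i \<in> I" for i by (rule line_bundleD(2)[OF x[OF that]])
  have oU: "openin (ctop X) U" unfolding U_def using oA by blast
  have nz: "\<psi> i z \<noteq> 0" if "i \<in> I" "z \<in> A i" for i z
    using isomD(1)[OF F[of "\<kappa> z" i], of z] \<kappa>[of z] AU that unfolding \<psi>_def by blast
  have comp: "F i j z * \<psi> i z = \<psi> j z" if "i \<in> I" "j \<in> I" "z \<in> A i" "z \<in> A j" for i j z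
    using cocycle[of "\<kappa> z" i j z] \<kappa>[of z] AU that unfolding \<psi>_def by blast
  \<comment> \<open>A section is a function whose image in every \<open>x i\<close> is a section
    there, so the sheaf axioms for \<open>L\<close> are inherited from those of the
    \<open>x i\<close>.\<close>
  define L where "L = (\<lambda>W. {s. openin (ctop X) W \<and> W \<subseteq> U \<and> (\<forall>i\<in>I. (\<lambda>z. \<psi> i z * s z) \<in> x i (W \<inter> A i))})"
  have sh: "function_sheaf (ctop X) U L"
    unfolding function_sheaf_def
  proof (intro conjI allI impI)
    show "openin (ctop X) W" "W \<subseteq> U" if "s \<in> L W" for W s using that unfolding L_def by simp_all
  next
    fix W s assume *: "openin (ctop X) W \<and> W \<subseteq> U \<and>
        (\<forall>z\<in>W. \<exists>V t. openin (ctop X) V \<and> z \<in> V \<and> V \<subseteq> W \<and> t \<in> L V \<and> (\<forall>z\<in>V. s z = t z))"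
    have "(\<lambda>z. \<psi> i z * s z) \<in> x i (W \<inter> A i)" if i: "i \<in> I" for i
    proof (rule function_sheafD(4)[OF shx[OF i]])
      show "openin (ctop X) (W \<inter> A i)" "W \<inter> A i \<subseteq> A i" using * oA[OF i] by blast+
      fix z assume z: "z \<in> W \<inter> A i"
      then obtain V t where V: "openin (ctop X) V" "z \<in> V" "V \<subseteq> W" "t \<in> L V" "\<forall>z\<in>V. s z = t z"
        using * by (meson IntD1)
      then have "(\<lambda>z. \<psi> i z * t z) \<in> x i (V \<inter> A i)" using i unfolding L_def by simp
      then show "\<exists>V t. openin (ctop X) V \<and> z \<in> V \<and> V \<subseteq> W \<inter> A i \<and> t \<in> x i V \<and> (\<forall>z\<in>V. \<psi> i z * s z = t z)"
        using V z oA[OF i] by (intro exI[of _ "V \<inter> A i"] exI[of _ "\<lambda>z. \<psi> i z * t z"]) auto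
    qed
    then show "s \<in> L W" using * unfolding L_def by simp
  next
    fix W V s assume *: "s \<in> L W \<and> openin (ctop X) V \<and> V \<subseteq> W"
    have "(\<lambda>z. \<psi> i z * s z) \<in> x i (V \<inter> A i)" if i: "i \<in> I" for i
    proof (rule function_sheafD(3)[OF shx[OF i]])
      show "(\<lambda>z. \<psi> i z * s z) \<in> x i (W \<inter> A i)" using * i unfolding L_def by simp
    qed (use * oA[OF i] in auto)
    moreover have "V \<subseteq> U" using * unfolding L_def by auto
    ultimately show "s \<in> L V" using * unfolding L_def by simp
  qed
  have iso: "isom X (A i) L (x i) (\<psi> i)" if i: "i \<in> I" for i
    unfolding isom_def
  proof (intro conjI ballI allI impI)
    show "\<psi> i z \<noteq> 0" if "z \<in> A i" for z by (rule nz[OF i that])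
    fix W s assume W: "openin (ctop X) W \<and> W \<subseteq> A i"
    show "s \<in> L W \<longleftrightarrow> (\<lambda>z. \<psi> i z * s z) \<in> x i W"
    proof
      have "W \<inter> A i = W" using W by blast
      then show "s \<in> L W \<Longrightarrow> (\<lambda>z. \<psi> i z * s z) \<in> x i W" using i unfolding L_def by auto
    next
      assume s: "(\<lambda>z. \<psi> i z * s z) \<in> x i W"
      \<comment> \<open>A section recognised in one bundle is recognised in all:
        \<open>F i j\<close> carries it to \<open>x j\<close>, and the cocycle identity turns
        \<open>F i j z * \<psi> i z\<close> into \<open>\<psi> j z\<close>.\<close>
      have "(\<lambda>z. \<psi> j z * s z) \<in> x j (W \<inter> A j)" if j: "j \<in> I" for j
      proof -
        have o: "openin (ctop X) (W \<inter> A j)" using W oA[OF j] by blast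
        have "(\<lambda>z. \<psi> i z * s z) \<in> x i (W \<inter> A j)" by (rule function_sheafD(3)[OF shx[OF i] s o]) simp
        then have "(\<lambda>z. F i j z * (\<psi> i z * s z)) \<in> x j (W \<inter> A j)"
          using isomD(2)[OF F[OF i j] o, of "\<lambda>z. \<psi> i z * s z"] W by blast
        then show ?thesis
          by (rule function_sheaf_cong[OF shx[OF j]])
            (use comp[OF i j] W in \<open>auto simp: mult.assoc[symmetric]\<close>)
      qed
      then show "s \<in> L W" using W AU[OF i] unfolding L_def by auto
    qed
  qed
  have "line_bundle X U L"
    unfolding line_bundle_iff
  proof (intro conjI ballI oU sh)
    fix z assume z: "z \<in> U"
    then obtain i where i: "i \<in> I" "z \<in> A i" unfolding U_def by blast
    obtain V e where V: "z \<in> V" "V \<subseteq> A i" "V \<subseteq> A i" "frame X (x i) V e"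
      by (rule line_bundle_frame[OF x[OF i(1)] i(2) oA[OF i(1)] i(2)])
    have "frame X L V (\<lambda>z. inverse (\<psi> i z) * e z)"
      by (rule isom_frame[OF sh isom_inverse[OF shx[OF i(1)] iso[OF i(1)]] V(4,2)])
    then show "\<exists>V e. z \<in> V \<and> V \<subseteq> U \<and> frame X L V e" using V AU[OF i(1)]
      by (intro exI[of _ V] exI[of _ "\<lambda>z. inverse (\<psi> i z) * e z"]) auto
  qed
  then show thesis unfolding U_def by (rule that[OF _ iso comp])
qed

lemma lb_isoD:
  assumes "h \<in> lb_iso X U L L'"
  shows "isom X U L L' h" "restrict h U = h"
  using assms unfolding lb_iso_iff by (simp_all add: extensional_restrict)

lemma lb_iso_cmp:
  assumes "h \<in> lb_iso X U L L'" "k \<in> lb_iso X U L' L''" "line_bundle X U L''"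
  shows "(\<lambda>x\<in>U. k x * h x) \<in> lb_iso X U L L''"
  by (rule lb_iso_restrictI[OF line_bundleD(2)[OF assms(3)] isom_comp[OF lb_isoD(1)[OF assms(1)] lb_isoD(1)[OF assms(2)]]])

lemma lb_iso_restrict:
  assumes "h \<in> lb_iso X U L L'" "line_bundle X U L'" "V \<subseteq> U"
  shows "restrict h V \<in> lb_iso X V (lb_res V L) (lb_res V L')"
  using lb_iso_restrictI[OF line_bundleD(2)[OF assms(2)] isom_subset[OF lb_isoD(1)[OF assms(1)] assms(3)]]
  by (simp add: lb_iso_iff isom_lb_res)

end

section \<open>Stack axioms for classes of line bundles on preimages\<close>

lemma restrict_restrict_subset: "B \<subseteq> A \<Longrightarrow> restrict (restrict f A) B = restrict f B"
  by (simp add: Int_absorb1)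

lemma restrict_eqI: "(\<And>z. z \<in> A \<Longrightarrow> f z = g z) \<Longrightarrow> restrict f A = restrict g A"
  by (auto simp: restrict_def)

lemma restrict_eqD: "restrict f A = restrict g A \<Longrightarrow> z \<in> A \<Longrightarrow> f z = g z"
  by (metis restrict_apply')

text \<open>The case \<open>Y = X\<close>, \<open>\<rho> = id\<close>, \<open>P = True\<close> is the Picard stack acting on itself.\<close>

locale lb_stack = fspace_map X Y \<rho> for X :: "'a cspace" and Y :: "'b cspace" and \<rho> +
  fixes S :: "('a, 'b lb, 'b \<Rightarrow> complex, 'z) gpresheaf_scheme" and P :: "'a set \<Rightarrow> 'b lb \<Rightarrow> bool"
  assumes Ob: "openin (ctop X) U \<Longrightarrow> Ob S U = {L. line_bundle Y (ov U) L \<and> P U L}"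
    and Iso: "openin (ctop X) U \<Longrightarrow> Iso S U = lb_iso Y (ov U)"
    and cmp: "openin (ctop X) U \<Longrightarrow> cmp S U g f = (\<lambda>y\<in>ov U. g y * f y)"
    and idn: "openin (ctop X) U \<Longrightarrow> idn S U L = (\<lambda>y\<in>ov U. 1)"
    and rso: "openin (ctop X) U \<Longrightarrow> rso S U = lb_res (ov U)"
    and rsm: "openin (ctop X) U \<Longrightarrow> rsm S U h = restrict h (ov U)"
    and P_res: "openin (ctop X) U \<Longrightarrow> openin (ctop X) V \<Longrightarrow> V \<subseteq> U \<Longrightarrow> line_bundle Y (ov U) L \<Longrightarrow> P U L \<Longrightarrow>
      P V (lb_res (ov V) L)"
    and P_glue: "openin (ctop X) U \<Longrightarrow> line_bundle Y (ov U) L \<Longrightarrow>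
      (\<And>x. x \<in> U \<Longrightarrow> \<exists>V L' h. openin (ctop X) V \<and> x \<in> V \<and> V \<subseteq> U \<and> line_bundle Y (ov V) L' \<and> P V L' \<and>
         isom Y (ov V) L L' h) \<Longrightarrow> P U L"
begin

lemma ObD: "openin (ctop X) U \<Longrightarrow> L \<in> Ob S U \<Longrightarrow> line_bundle Y (ov U) L" "openin (ctop X) U \<Longrightarrow> L \<in> Ob S U \<Longrightarrow> P U L"
  and ObI: "openin (ctop X) U \<Longrightarrow> line_bundle Y (ov U) L \<Longrightarrow> P U L \<Longrightarrow> L \<in> Ob S U"
  by (auto simp: Ob)

lemma rso_Ob:
  assumes "openin (ctop X) U" "openin (ctop X) V" "V \<subseteq> U" "x \<in> Ob S U"
  shows "rso S V x \<in> Ob S V"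
  unfolding rso[OF assms(2)]
  by (rule ObI[OF assms(2) Y.line_bundle_lb_res[OF ObD(1)[OF assms(1,4)] openin_ov[OF assms(2)] ov_mono[OF assms(3)]]
     P_res[OF assms(1-3) ObD[OF assms(1,4)]]])

lemma groupoid_presheaf: "groupoid_presheaf (ctop X) S"
  unfolding groupoid_presheaf_def
proof (intro conjI allI impI ballI)
  show "idn S U x \<in> Iso S U x x" if "openin (ctop X) U" "x \<in> Ob S U" for U x
    unfolding idn[OF that(1)] Iso[OF that(1)]
    by (rule lb_iso_restrictI[OF Y.line_bundleD(2)[OF ObD(1)[OF that]] isom_one])
  show "cmp S U f (idn S U x) = f" "cmp S U (idn S U y) f = f" if "openin (ctop X) U" "f \<in> Iso S U x y" for U x y f
  proof -
    have "restrict f (ov U) = f" using that(2) unfolding Iso[OF that(1)] by (rule Y.lb_isoD(2))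
    then show "cmp S U f (idn S U x) = f" "cmp S U (idn S U y) f = f"
      unfolding cmp[OF that(1)] idn[OF that(1)] by (simp_all cong: restrict_cong)
  qed
  show "\<exists>g\<in>Iso S U y x. cmp S U g f = idn S U x \<and> cmp S U f g = idn S U y"
    if "openin (ctop X) U" "x \<in> Ob S U" "y \<in> Ob S U" "f \<in> Iso S U x y" for U x y f
  proof (rule bexI)
    have f: "isom Y (ov U) x y f" using that(4) unfolding Iso[OF that(1)] by (rule Y.lb_isoD(1))
    let ?g = "\<lambda>z\<in>ov U. inverse (f z)"
    show "?g \<in> Iso S U y x" unfolding Iso[OF that(1)]
      by (rule lb_iso_restrictI[OF Y.line_bundleD(2)[OF ObD(1)[OF that(1,2)]]
         isom_inverse[OF Y.line_bundleD(2)[OF ObD(1)[OF that(1,3)]] f]])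
    show "cmp S U ?g f = idn S U x \<and> cmp S U f ?g = idn S U y"
      unfolding cmp[OF that(1)] idn[OF that(1)] using isomD(1)[OF f] by (auto intro!: restrict_eqI)
  qed
  show "cmp S U g f \<in> Iso S U x z"
    if "openin (ctop X) U" "z \<in> Ob S U" "f \<in> Iso S U x y" "g \<in> Iso S U y z" for U x y z f g
    using that(3,4) unfolding cmp[OF that(1)] Iso[OF that(1)] by (rule Y.lb_iso_cmp[OF _ _ ObD(1)[OF that(1,2)]])
  show "cmp S U h (cmp S U g f) = cmp S U (cmp S U h g) f" if "openin (ctop X) U" for U f g h
    unfolding cmp[OF that(1)] by (rule restrict_eqI) (simp add: mult.assoc)
  show "rso S V x \<in> Ob S V" if "openin (ctop X) U \<and> openin (ctop X) V \<and> V \<subseteq> U" "x \<in> Ob S U" for U V x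
    using that rso_Ob by blast
  show "rsm S V (idn S U x) = idn S V (rso S V x)" if "openin (ctop X) U \<and> openin (ctop X) V \<and> V \<subseteq> U" for U V x
    using that ov_mono[of V U] by (simp add: rsm idn restrict_restrict_subset Int_absorb1)
  show "rsm S V f \<in> Iso S V (rso S V x) (rso S V y)"
    if "openin (ctop X) U \<and> openin (ctop X) V \<and> V \<subseteq> U" "y \<in> Ob S U" "f \<in> Iso S U x y" for U V x y f
    using that ov_mono[of V U] Y.lb_iso_restrict[OF _ ObD(1), of f U x y "ov V"] by (simp add: rsm rso Iso)
  show "rsm S V (cmp S U g f) = cmp S V (rsm S V g) (rsm S V f)"
    if "openin (ctop X) U \<and> openin (ctop X) V \<and> V \<subseteq> U" for U V f g
  proof -
    have "ov V \<subseteq> ov U" using that by (intro ov_mono) simp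
    then show ?thesis using that by (auto simp: rsm cmp restrict_def fun_eq_iff)
  qed
  show "rso S U x = x" if "openin (ctop X) U" "x \<in> Ob S U" for U x
    unfolding rso[OF that(1)] by (rule lb_res_self[OF Y.line_bundleD(2)[OF ObD(1)[OF that]]])
  show "rsm S U f = f" if "openin (ctop X) U" "f \<in> Iso S U x y" for U f x y
    using that(2) unfolding rsm[OF that(1)] Iso[OF that(1)] by (rule Y.lb_isoD(2))
  show "rso S W (rso S V x) = rso S W x"
    if "openin (ctop X) U \<and> openin (ctop X) V \<and> openin (ctop X) W \<and> W \<subseteq> V \<and> V \<subseteq> U" for U V W x
    using that ov_mono[of W V] by (simp add: rso lb_res_lb_res)
  show "rsm S W (rsm S V f) = rsm S W f"
    if "openin (ctop X) U \<and> openin (ctop X) V \<and> openin (ctop X) W \<and> W \<subseteq> V \<and> V \<subseteq> U" for U V W f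
    using that ov_mono[of W V] by (simp add: rsm Int_absorb1)
qed

lemma ov_Union: "ov (\<Union>\<U>) = (\<Union>V\<in>\<U>. ov V)"
  unfolding over_def by auto

lemma isos_glue: "isos_glue (ctop X) S"
  unfolding isos_glue_def
proof (intro allI impI ballI)
  fix U \<U> x y f
  assume c: "openin (ctop X) U \<and> (\<forall>V\<in>\<U>. openin (ctop X) V) \<and> \<Union>\<U> = U" and xy: "x \<in> Ob S U" "y \<in> Ob S U"
    and f: "(\<forall>V\<in>\<U>. f V \<in> Iso S V (rso S V x) (rso S V y)) \<and>
        (\<forall>V\<in>\<U>. \<forall>W\<in>\<U>. rsm S (V \<inter> W) (f V) = rsm S (V \<inter> W) (f W))"
  have oU: "openin (ctop X) U" and oV: "\<And>V. V \<in> \<U> \<Longrightarrow> openin (ctop X) V" using c by blast+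
  have VU: "ov V \<subseteq> ov U" if "V \<in> \<U>" for V using c that by (intro ov_mono) blast
  have fi: "isom Y (ov V) x y (f V)" if "V \<in> \<U>" for V
    using f that Y.lb_isoD(1)[of "f V" "ov V" "rso S V x" "rso S V y"]
    by (simp add: Iso oV rso isom_lb_res)
  have agree: "f V z = f W z" if "V \<in> \<U>" "W \<in> \<U>" "z \<in> ov V" "z \<in> ov W" for V W z
  proof -
    have "restrict (f V) (ov (V \<inter> W)) = restrict (f W) (ov (V \<inter> W))"
      using bspec[OF bspec[OF conjunct2[OF f] that(1)] that(2)] that by (simp add: rsm oV openin_Int)
    then show ?thesis by (rule restrict_eqD) (use that ov_Int in blast)
  qed
  have "\<forall>z\<in>ov U. \<exists>V\<in>\<U>. z \<in> ov V" using c ov_Union by blast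
  then obtain \<kappa> where \<kappa>: "\<And>z. z \<in> ov U \<Longrightarrow> \<kappa> z \<in> \<U> \<and> z \<in> ov (\<kappa> z)" by metis
  \<comment> \<open>Any member of the cover containing the point gives the same value by agreement
    on overlaps, so an arbitrary choice \<open>\<kappa>\<close> defines the glued
    isomorphism.\<close>
  define g where "g = (\<lambda>z\<in>ov U. f (\<kappa> z) z)"
  have gf: "g z = f V z" if "V \<in> \<U>" "z \<in> ov V" for V z
  proof -
    have z: "z \<in> ov U" using VU that by blast
    then show ?thesis using agree[of "\<kappa> z" V z] \<kappa>[OF z] that unfolding g_def by simp
  qed
  note shx = Y.line_bundleD(2)[OF ObD(1)[OF oU xy(1)]] and shy = Y.line_bundleD(2)[OF ObD(1)[OF oU xy(2)]]
  have "isom Y (ov U) x y g"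
  proof (rule Y.isom_glue[OF shx shy order_refl order_refl])
    fix z assume z: "z \<in> ov U"
    have k: "\<kappa> z \<in> \<U>" "z \<in> ov (\<kappa> z)" using \<kappa>[OF z] by simp_all
    have "isom Y (ov (\<kappa> z)) x y g" by (rule isom_cong[OF shy fi[OF k(1)]]) (simp add: gf[OF k(1)])
    then show "\<exists>W. openin (ctop Y) W \<and> z \<in> W \<and> isom Y W x y g"
      using k openin_ov[OF oV[OF k(1)]] by (intro exI[of _ "ov (\<kappa> z)"]) simp
  qed
  then have g: "g \<in> Iso S U x y" unfolding Iso[OF oU] lb_iso_iff g_def by simp
  have gV: "rsm S V g = f V" if V: "V \<in> \<U>" for V
  proof -
    have "restrict g (ov V) = restrict (f V) (ov V)" by (rule restrict_eqI) (rule gf[OF V])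
    also have "\<dots> = f V" using f V Y.lb_isoD(2)[of "f V" "ov V" "rso S V x" "rso S V y"] by (simp add: Iso oV)
    finally show ?thesis by (simp add: rsm oV V)
  qed
  show "\<exists>!g. g \<in> Iso S U x y \<and> (\<forall>V\<in>\<U>. rsm S V g = f V)"
  proof (rule ex1I[of _ g])
    show "g \<in> Iso S U x y \<and> (\<forall>V\<in>\<U>. rsm S V g = f V)" using g gV by blast
    fix h assume h: "h \<in> Iso S U x y \<and> (\<forall>V\<in>\<U>. rsm S V h = f V)"
    then have hx: "restrict h (ov U) = h" unfolding Iso[OF oU] by (intro Y.lb_isoD(2)) blast
    have "h z = g z" if z: "z \<in> ov U" for z
    proof -
      have k: "\<kappa> z \<in> \<U>" "z \<in> ov (\<kappa> z)" using \<kappa>[OF z] by simp_all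
      have "restrict h (ov (\<kappa> z)) = f (\<kappa> z)" using h k(1) by (simp add: rsm[symmetric] oV)
      then have "h z = f (\<kappa> z) z" using k(2) by (metis restrict_apply')
      then show ?thesis using gf[OF k] by simp
    qed
    then have "restrict h (ov U) = restrict g (ov U)" by (rule restrict_eqI)
    then show "h = g" using hx unfolding g_def by simp
  qed
qed

lemma effective_descent: "effective_descent (ctop X) S"
  unfolding effective_descent_def
proof (intro allI impI)
  fix U \<U> x f
  assume c: "openin (ctop X) U \<and> (\<forall>V\<in>\<U>. openin (ctop X) V) \<and> \<Union>\<U> = U"
    and f: "(\<forall>V\<in>\<U>. x V \<in> Ob S V) \<and>
        (\<forall>V\<in>\<U>. \<forall>W\<in>\<U>. f V W \<in> Iso S (V \<inter> W) (rso S (V \<inter> W) (x V)) (rso S (V \<inter> W) (x W))) \<and>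
        (\<forall>V\<in>\<U>. \<forall>W\<in>\<U>. \<forall>Z\<in>\<U>.
           cmp S (V \<inter> W \<inter> Z) (rsm S (V \<inter> W \<inter> Z) (f W Z)) (rsm S (V \<inter> W \<inter> Z) (f V W))
           = rsm S (V \<inter> W \<inter> Z) (f V Z))"
  have oU: "openin (ctop X) U" and oV: "\<And>V. V \<in> \<U> \<Longrightarrow> openin (ctop X) V" using c by blast+
  have VU: "V \<subseteq> U" if "V \<in> \<U>" for V using c that by blast
  have xV: "x V \<in> Ob S V" if "V \<in> \<U>" for V using f that by blast
  have fi: "isom Y (ov V \<inter> ov W) (x V) (x W) (f V W)" if "V \<in> \<U>" "W \<in> \<U>" for V W
  proof -
    have "f V W \<in> Iso S (V \<inter> W) (rso S (V \<inter> W) (x V)) (rso S (V \<inter> W) (x W))" using f that by blast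
    then show ?thesis
      using Y.lb_isoD(1)[of "f V W" "ov (V \<inter> W)" "rso S (V \<inter> W) (x V)" "rso S (V \<inter> W) (x W)"] that
      by (simp add: Iso rso isom_lb_res oV openin_Int ov_Int)
  qed
  have cocycle: "f W Z z * f V W z = f V Z z"
    if "V \<in> \<U>" "W \<in> \<U>" "Z \<in> \<U>" "z \<in> ov V" "z \<in> ov W" "z \<in> ov Z" for V W Z z
  proof -
    have o: "openin (ctop X) (V \<inter> W \<inter> Z)" by (intro openin_Int oV that)
    have z: "z \<in> ov (V \<inter> W \<inter> Z)" using that unfolding ov_Int by blast
    have "cmp S (V \<inter> W \<inter> Z) (rsm S (V \<inter> W \<inter> Z) (f W Z)) (rsm S (V \<inter> W \<inter> Z) (f V W))
           = rsm S (V \<inter> W \<inter> Z) (f V Z)" using f that by blast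
    from fun_cong[OF this, of z] show ?thesis using z by (simp add: cmp[OF o] rsm[OF o])
  qed
  obtain L \<psi> where L: "line_bundle Y (\<Union>V\<in>\<U>. ov V) L" "\<And>V. V \<in> \<U> \<Longrightarrow> isom Y (ov V) L (x V) (\<psi> V)"
    "\<And>V W z. V \<in> \<U> \<Longrightarrow> W \<in> \<U> \<Longrightarrow> z \<in> ov V \<Longrightarrow> z \<in> ov W \<Longrightarrow> f V W z * \<psi> V z = \<psi> W z"
  proof (rule Y.line_bundle_descent[of \<U> ov x f])
    show "line_bundle Y (ov V) (x V)" if "V \<in> \<U>" for V by (rule ObD(1)[OF oV[OF that] xV[OF that]])
    show "isom Y (ov V \<inter> ov W) (x V) (x W) (f V W)" if "V \<in> \<U>" "W \<in> \<U>" for V W by (rule fi[OF that])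
    show "f W Z z * f V W z = f V Z z"
      if "V \<in> \<U>" "W \<in> \<U>" "Z \<in> \<U>" "z \<in> ov V" "z \<in> ov W" "z \<in> ov Z" for V W Z z by (rule cocycle[OF that])
  qed (rule that)
  have LU: "line_bundle Y (ov U) L" using L(1) c ov_Union[of \<U>] by simp
  \<comment> \<open>The glued bundle is an object because \<open>P\<close> is local up to
    isomorphism (\<open>P_glue\<close>): over each member of the cover, \<open>\<psi> V\<close>
    identifies it with the object \<open>x V\<close>.\<close>
  have PL: "P U L"
  proof (rule P_glue[OF oU LU])
    fix z assume "z \<in> U"
    then obtain V where V: "V \<in> \<U>" "z \<in> V" using c by blast
    then show "\<exists>V L' h. openin (ctop X) V \<and> z \<in> V \<and> V \<subseteq> U \<and> line_bundle Y (ov V) L' \<and> P V L' \<and> isom Y (ov V) L L' h"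
      using oV[OF V(1)] VU[OF V(1)] ObD[OF oV[OF V(1)] xV[OF V(1)]] L(2)[OF V(1)]
      by (intro exI[of _ V] exI[of _ "x V"] exI[of _ "\<psi> V"]) simp
  qed
  show "\<exists>y\<in>Ob S U. \<exists>\<psi>. (\<forall>V\<in>\<U>. \<psi> V \<in> Iso S V (rso S V y) (x V)) \<and>
              (\<forall>V\<in>\<U>. \<forall>W\<in>\<U>. cmp S (V \<inter> W) (f V W) (rsm S (V \<inter> W) (\<psi> V)) = rsm S (V \<inter> W) (\<psi> W))"
  proof (intro bexI[of _ L] exI[of _ "\<lambda>V. restrict (\<psi> V) (ov V)"] conjI ballI)
    show "L \<in> Ob S U" by (rule ObI[OF oU LU PL])
    show "restrict (\<psi> V) (ov V) \<in> Iso S V (rso S V L) (x V)" if V: "V \<in> \<U>" for V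
      unfolding Iso[OF oV[OF V]] rso[OF oV[OF V]]
      by (rule lb_iso_restrictI[OF Y.line_bundleD(2)[OF ObD(1)[OF oV[OF V] xV[OF V]]]])
        (simp add: isom_lb_res L(2)[OF V])
    show "cmp S (V \<inter> W) (f V W) (rsm S (V \<inter> W) (restrict (\<psi> V) (ov V))) = rsm S (V \<inter> W) (restrict (\<psi> W) (ov W))"
      if V: "V \<in> \<U>" and W: "W \<in> \<U>" for V W
    proof -
      have o: "openin (ctop X) (V \<inter> W)" by (intro openin_Int oV that)
      show ?thesis unfolding cmp[OF o] rsm[OF o]
        by (rule restrict_eqI) (use L(3)[OF V W] in \<open>simp add: ov_Int\<close>)
    qed
  qed
qed

lemma is_stack: "is_stack (ctop X) S"
  unfolding is_stack_def by (intro conjI groupoid_presheaf isos_glue effective_descent)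

end

text \<open>\<open>P\<close> has to be stable under twists from the base for the action to stay
  inside the substack; for the gerbe this holds because such a twist is trivial near every
  fibre.\<close>

locale lb_module_stack = lb_stack X Y \<rho> S P for X :: "'a cspace" and Y :: "'b cspace" and \<rho>
   and S :: "('a, 'a lb, 'a \<Rightarrow> complex, 'b lb, 'b \<Rightarrow> complex) mstack" and P +
  assumes act: "openin (ctop X) U \<Longrightarrow> line_bundle X U M \<Longrightarrow> act S U M L = lb_tensor Y (lb_pull Y \<rho> M) L"
    and actm: "openin (ctop X) U \<Longrightarrow> actm S U a f = (\<lambda>y\<in>ov U. a (\<rho> y) * f y)"
    and P_act: "openin (ctop X) U \<Longrightarrow> line_bundle X U M \<Longrightarrow> line_bundle Y (ov U) L \<Longrightarrow> P U L \<Longrightarrow>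
      P U (lb_tensor Y (lb_pull Y \<rho> M) L)"
begin

lemma Pic_simps:
  "Ob (Pic_stack X) U = {L. line_bundle X U L}" "Iso (Pic_stack X) = lb_iso X"
  "cmp (Pic_stack X) U g f = (\<lambda>x\<in>U. g x * f x)" "idn (Pic_stack X) U L = (\<lambda>x\<in>U. 1)"
  "rso (Pic_stack X) = lb_res" "rsm (Pic_stack X) V h = restrict h V"
  "tns (Pic_stack X) U = lb_tensor X" "tnsm (Pic_stack X) U h k = (\<lambda>x\<in>U. h x * k x)"
  "tone (Pic_stack X) = lb_trivial X"
  unfolding Pic_stack_def by simp_all

lemma module_stack: "module_stack (ctop X) (Pic_stack X) S"
  unfolding module_stack_def Pic_simps mem_Collect_eq
proof (intro conjI allI impI ballI)
  show "is_stack (ctop X) S" by (rule is_stack)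
  show "act S U p x \<in> Ob S U" if "openin (ctop X) U" "p \<in> {L. line_bundle X U L}" "x \<in> Ob S U" for U p x
    using that ObD[OF that(1,3)] unfolding act[OF that(1)]
    by (simp add: act ObI Y.line_bundle_lb_tensor line_bundle_lb_pull P_act)
  show "actm S U (\<lambda>x\<in>U. 1) (idn S U x) = idn S U (act S U p x)" if "openin (ctop X) U" for U p x
    unfolding actm[OF that] idn[OF that] by (rule restrict_eqI) (simp add: ov_iff)
  show "actm S U a f \<in> Iso S U (act S U p x) (act S U q y)"
    if "openin (ctop X) U" "p \<in> {L. line_bundle X U L}" "q \<in> {L. line_bundle X U L}" "a \<in> lb_iso X U p q"
      "x \<in> Ob S U" "y \<in> Ob S U" "f \<in> Iso S U x y" for U p q a x y f
  proof -
    have p: "line_bundle X U p" "line_bundle X U q" using that by simp_all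
    note x = ObD(1)[OF that(1,5)] and y = ObD(1)[OF that(1,6)]
    have f: "isom Y (ov U) x y f" using that(7) unfolding Iso[OF that(1)] by (rule Y.lb_isoD(1))
    show ?thesis unfolding Iso[OF that(1)] act[OF that(1) p(1)] act[OF that(1) p(2)] actm[OF that(1)]
      by (rule lb_iso_restrictI[OF Y.line_bundleD(2)[OF Y.line_bundle_lb_tensor[OF line_bundle_lb_pull[OF p(2)] y]]
        isom_pull_tensor[OF p x y X.lb_isoD(1)[OF that(4)] f]])
  qed
  show "actm S U (\<lambda>x\<in>U. b x * a x) (cmp S U g f) = cmp S U (actm S U b g) (actm S U a f)"
    if "openin (ctop X) U" for U a b f g
    unfolding actm[OF that] cmp[OF that] by (rule restrict_eqI) (simp add: ov_iff)
  show "actm S U (\<lambda>x\<in>U. 1) f = f" if "openin (ctop X) U" "f \<in> Iso S U x y" for U x y f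
  proof -
    have "restrict f (ov U) = f" using that(2) unfolding Iso[OF that(1)] by (rule Y.lb_isoD(2))
    moreover have "(\<lambda>y\<in>ov U. (\<lambda>x\<in>U. 1) (\<rho> y) * f y) = restrict f (ov U)"
      by (rule restrict_eqI) (simp add: ov_iff)
    ultimately show ?thesis unfolding actm[OF that(1)] by simp
  qed
  show "actm S U (\<lambda>x\<in>U. a' x * a x) f = actm S U a' (actm S U a f)" if "openin (ctop X) U" for U a a' f
    unfolding actm[OF that] by (rule restrict_eqI) (simp add: ov_iff)
  show "line_bundle X U (lb_trivial X U)" if "openin (ctop X) U" for U by (rule X.line_bundle_lb_trivial[OF that])
  show "act S U (lb_trivial X U) x = x" if "openin (ctop X) U" "x \<in> Ob S U" for U x
    unfolding act[OF that(1) X.line_bundle_lb_trivial[OF that(1)]]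
    by (rule lb_pull_trivial_tensor[OF that(1) ObD(1)[OF that]])
  show "line_bundle X U (lb_tensor X p q)"
    if "p \<in> {L. line_bundle X U L}" "q \<in> {L. line_bundle X U L}" for U p q
    using that by (simp add: X.line_bundle_lb_tensor)
  show "act S U (lb_tensor X p q) x = act S U p (act S U q x)"
    if "openin (ctop X) U" "x \<in> Ob S U" "p \<in> {L. line_bundle X U L}" "q \<in> {L. line_bundle X U L}" for U x p q
  proof -
    have p: "line_bundle X U p" "line_bundle X U q" using that by simp_all
    show ?thesis unfolding act[OF that(1) X.line_bundle_lb_tensor[OF p]] act[OF that(1) p(1)] act[OF that(1) p(2)]
      lb_pull_lb_tensor[OF p]
      by (rule Y.lb_tensor_assoc[OF line_bundle_lb_pull[OF p(1)] line_bundle_lb_pull[OF p(2)] ObD(1)[OF that(1,2)]])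
  qed
  show "rso S V (act S U p x) = act S V (lb_res V p) (rso S V x)"
    if "openin (ctop X) U \<and> openin (ctop X) V \<and> V \<subseteq> U" "p \<in> {L. line_bundle X U L}" "x \<in> Ob S U" for U V p x
  proof -
    have o: "openin (ctop X) U" "openin (ctop X) V" "V \<subseteq> U" and p: "line_bundle X U p" using that by simp_all
    show ?thesis unfolding act[OF o(1) p] act[OF o(2) X.line_bundle_lb_res[OF p o(2,3)]] rso[OF o(2)]
      lb_res_lb_pull[OF p o(2,3), symmetric]
      by (rule Y.lb_res_lb_tensor[OF line_bundle_lb_pull[OF p] ObD(1)[OF o(1) that(3)] openin_ov[OF o(2)] ov_mono[OF o(3)]])
  qed
  show "rsm S V (actm S U a f) = actm S V (restrict a V) (rsm S V f)"
    if "openin (ctop X) U \<and> openin (ctop X) V \<and> V \<subseteq> U" for U V a f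
  proof -
    have o: "openin (ctop X) U" "openin (ctop X) V" and sub: "ov V \<subseteq> ov U" using that ov_mono by simp_all
    show ?thesis unfolding rsm[OF o(2)] actm[OF o(1)] actm[OF o(2)]
      using sub by (intro restrict_eqI) (auto simp: ov_iff)
  qed
qed

end

text \<open>For the identity map the preimage of \<open>U\<close> is \<open>U\<close> as soon as
  \<open>U\<close> lies in the space. The conditions of \<open>lb_stack\<close> are imposed for open
  sets only, which makes this an instance.\<close>

lemma regular_Pic_module_stack:
  assumes "fspace X"
  shows "module_stack (ctop X) (Pic_stack X) (regular (Pic_stack X))"
proof -
  interpret fspace_map X X "\<lambda>x. x" by (rule fspace_map_id[OF assms])
  have ov: "ov U = U" if "openin (ctop X) U" for U using openin_subset[OF that] unfolding over_def by auto
  interpret lb_module_stack X X "\<lambda>x. x" "regular (Pic_stack X)" "\<lambda>U L. True"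
    by unfold_locales (auto simp: regular_def Pic_stack_def ov lb_pull_id[OF assms])
  show ?thesis by (rule module_stack)
qed

section \<open>Descent of holomorphic functions along a resolution\<close>

text \<open>In sheaf terms: \<open>hol_descent\<close> is surjectivity of the map from the structure
  sheaf of \<open>X\<close> to the push-forward of that of \<open>Y\<close>, and \<open>surj\<close>
  makes this map injective. The comparison of bundles relative to \<open>X\<close> uses the
  resolution only through these two properties.\<close>

locale fspace_descent = fspace_map +
  assumes surj: "x \<in> pts X \<Longrightarrow> \<exists>y\<in>pts Y. \<rho> y = x"
    and hol_descent: "openin (ctop X) U \<Longrightarrow> f \<in> hol Y (over Y \<rho> U) \<Longrightarrow>
      \<exists>g\<in>hol X U. \<forall>y\<in>over Y \<rho> U. f y = g (\<rho> y)"

text \<open>Differences are not among the operations of \<open>fspace\<close>; disjoint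
  neighbourhoods of the two values in the complex plane replace them.\<close>

lemma (in fspace) openin_hol_neq:
  assumes f: "f \<in> hol X W" and g: "g \<in> hol X W"
  shows "openin (ctop X) {x \<in> W. f x \<noteq> g x}"
proof (subst openin_subopen, intro ballI)
  fix x assume x: "x \<in> {x \<in> W. f x \<noteq> g x}"
  then obtain S T where S: "open S" "open T" "f x \<in> S" "g x \<in> T" "S \<inter> T = {}"
    using hausdorff[of "f x" "g x"] by blast
  have "openin (ctop X) ({x \<in> W. f x \<in> S} \<inter> {x \<in> W. g x \<in> T})"
    by (intro openin_Int hol_open_preimage f g S)
  then show "\<exists>V. openin (ctop X) V \<and> x \<in> V \<and> V \<subseteq> {x \<in> W. f x \<noteq> g x}"
    using x S by (intro exI[of _ "{x \<in> W. f x \<in> S} \<inter> {x \<in> W. g x \<in> T}"]) auto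
qed

text \<open>Local equations are available at every point of \<open>X\<close>, also off
  \<open>Z\<close>, where one of them is non-zero and stays so nearby.\<close>

lemma (in fspace) closedin_analytic_subset:
  assumes "analytic_subset X Z"
  shows "closedin (ctop X) Z"
  unfolding closedin_def
proof (intro conjI)
  show "Z \<subseteq> pts X" using assms unfolding analytic_subset_def by simp
  show "openin (ctop X) (pts X - Z)"
  proof (subst openin_subopen, intro ballI)
    fix x assume x: "x \<in> pts X - Z"
    then obtain W F where W: "openin (ctop X) W" "x \<in> W" "F \<subseteq> hol X W" "Z \<inter> W = {w\<in>W. \<forall>f\<in>F. f w = 0}"
      using assms unfolding analytic_subset_def by (meson DiffD1)
    then have "x \<notin> {w\<in>W. \<forall>f\<in>F. f w = 0}" using x by blast
    then obtain f where f: "f \<in> F" "f x \<noteq> 0" using W(2) by blast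
    have "openin (ctop X) {w \<in> W. f w \<in> - {0}}" using W(3) f(1) by (intro hol_open_preimage) auto
    moreover have "{w \<in> W. f w \<in> - {0}} \<subseteq> pts X - Z" using W f openin_subset[OF W(1)] by blast
    ultimately show "\<exists>T. openin (ctop X) T \<and> x \<in> T \<and> T \<subseteq> pts X - Z"
      using W(2) f(2) by (intro exI[of _ "{w \<in> W. f w \<in> - {0}}"]) simp
  qed
qed

lemma nowhere_dense_openin:
  assumes "nowhere_dense X Z" "Z \<subseteq> pts X" "openin (ctop X) V" "V \<subseteq> Z"
  shows "V = {}"
proof -
  have "V \<subseteq> (ctop X) interior_of ((ctop X) closure_of Z)"
    by (rule interior_of_maximal) (use assms closure_of_subset[of Z "ctop X"] in auto)
  then show ?thesis using assms(1) unfolding nowhere_dense_def by simp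
qed

lemma nowhere_dense_csub:
  assumes "nowhere_dense X Z" "closedin (ctop X) Z" "openin (ctop X) U"
  shows "nowhere_dense (csub X U) (Z \<inter> U)"
proof -
  let ?T = "subtopology (ctop X) U"
  have "closedin ?T (Z \<inter> U)" using assms(2) by (auto simp: closedin_subtopology)
  then have cl: "?T closure_of (Z \<inter> U) = Z \<inter> U" by (rule closure_of_closedin)
  have "?T interior_of (Z \<inter> U) \<subseteq> Z \<inter> U" by (rule interior_of_subset)
  moreover have "openin (ctop X) (?T interior_of (Z \<inter> U))"
    using openin_interior_of[of ?T "Z \<inter> U"] assms(3) openin_trans_full by blast
  ultimately have "?T interior_of (Z \<inter> U) = {}"
    using nowhere_dense_openin[OF assms(1) closedin_subset[OF assms(2)]] by blast
  then show ?thesis unfolding nowhere_dense_def csub_def using cl by simp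
qed

lemma (in fspace) analytic_subset_csub:
  assumes "analytic_subset X Z" "openin (ctop X) U"
  shows "analytic_subset (csub X U) (Z \<inter> U)"
  unfolding analytic_subset_def
proof (intro conjI ballI)
  have UX: "U \<subseteq> pts X" by (rule openin_subset[OF assms(2)])
  then have pU: "pts (csub X U) = U" unfolding csub_def by auto
  then show "Z \<inter> U \<subseteq> pts (csub X U)" by simp
  fix x assume "x \<in> pts (csub X U)"
  then have x: "x \<in> U" unfolding pU .
  then obtain W F where W: "openin (ctop X) W" "x \<in> W" "finite F" "F \<subseteq> hol X W" "Z \<inter> W = {w\<in>W. \<forall>f\<in>F. f w = 0}"
    using assms(1) UX unfolding analytic_subset_def by (meson subsetD)
  have o: "openin (ctop X) (W \<inter> U)" using W(1) assms(2) by blast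
  have "openin (ctop (csub X U)) (W \<inter> U)"
    using W(1) by (simp add: csub_def openin_subtopology) blast
  moreover have "F \<subseteq> hol (csub X U) (W \<inter> U)"
    using W(4) hol_subset[OF _ o] unfolding csub_def lb_res_def by auto
  moreover have "Z \<inter> U \<inter> (W \<inter> U) = {w\<in>W \<inter> U. \<forall>f\<in>F. f w = 0}" using W(5) by blast
  ultimately show "\<exists>W F. openin (ctop (csub X U)) W \<and> x \<in> W \<and> finite F \<and> F \<subseteq> hol (csub X U) W \<and>
     Z \<inter> U \<inter> W = {w\<in>W. \<forall>f\<in>F. f w = 0}"
    using x W(2,3) by (intro exI[of _ "W \<inter> U"] exI[of _ F]) simp
qed

text \<open>Compactness of the fibre gives one bound on a neighbourhood of it; since
  \<open>\<rho>\<close> is closed, this neighbourhood contains the full preimage of a neighbourhood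
  of \<open>x\<close>.\<close>

lemma (in fspace_map) hol_bounded_near_fibre:
  assumes proper: "proper_map (ctop Y) (ctop X) \<rho>" and U: "openin (ctop X) U"
    and f: "f \<in> hol Y (ov U)" and x: "x \<in> U"
  obtains V B where "openin (ctop X) V" "x \<in> V" "V \<subseteq> U" "\<And>y. y \<in> ov V \<Longrightarrow> cmod (f y) \<le> B"
proof -
  let ?O = "\<lambda>n::nat. {y \<in> ov U. f y \<in> ball 0 (real n)}"
  let ?K = "{y \<in> pts Y. \<rho> y = x}"
  have xX: "x \<in> pts X" using x openin_subset[OF U] by blast
  have K: "compactin (ctop Y) ?K" using proper xX unfolding proper_map_def by blast
  have o: "openin (ctop Y) (?O n)" for n by (rule Y.hol_open_preimage[OF f open_ball])
  have "?K \<subseteq> \<Union>(range ?O)"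
  proof
    fix y assume y: "y \<in> ?K"
    obtain n where "cmod (f y) < real n" using reals_Archimedean2 by blast
    then have "y \<in> ?O n" using y x unfolding ov_iff by simp
    then show "y \<in> \<Union>(range ?O)" by blast
  qed
  then obtain \<F> where \<F>: "finite \<F>" "\<F> \<subseteq> range ?O" "?K \<subseteq> \<Union>\<F>"
    using compactinD[OF K, of "range ?O"] o by blast
  then obtain I where I: "finite I" "\<F> = ?O ` I" using finite_subset_image by meson
  \<comment> \<open>Inserting 0 keeps the maximum meaningful when \<open>I\<close> is empty, as it
    can be for an empty fibre.\<close>
  define N where "N = Max (insert 0 I)"
  have "?O n \<subseteq> ?O N" if "n \<in> I" for n
  proof -
    have "n \<le> N" unfolding N_def using I(1) that by simp
    then show ?thesis by (auto simp: of_nat_le_iff intro: less_le_trans)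
  qed
  then have KN: "?K \<subseteq> ?O N" using \<F>(3) I(2) by blast
  \<comment> \<open>Tube argument: the image of the closed complement of \<open>?O N\<close> is
    closed and avoids \<open>x\<close>.\<close>
  define V where "V = U - \<rho> ` (pts Y - ?O N)"
  have "closedin (ctop X) (\<rho> ` (pts Y - ?O N))"
    using proper o[of N] unfolding proper_map_def closed_map_def by (meson closedin_diff closedin_topspace)
  then have oV: "openin (ctop X) V" unfolding V_def using U by (rule openin_diff[rotated])
  have xV: "x \<in> V" unfolding V_def using x KN by blast
  have "cmod (f y) \<le> real N" if "y \<in> ov V" for y
  proof -
    have "y \<in> ?O N" using that unfolding V_def ov_iff by blast
    then show ?thesis by simp
  qed
  then show thesis using that[OF oV xV, of "real N"] unfolding V_def by blast
qed

theorem fspace_descent_resolution: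
  assumes X: "complex_space X" "normal_space_cx X" and Y: "complex_space Y" and \<rho>: "proper_bimeromorphic Y X \<rho>"
  shows "fspace_descent X Y \<rho>"
proof -
  have hol: "holomorphic_map Y X \<rho>" and proper: "proper_map (ctop Y) (ctop X) \<rho>"
    using \<rho> unfolding proper_bimeromorphic_def by simp_all
  interpret fspace_map X Y \<rho>
    by (rule fspace_map.intro[OF complex_space_fspace[OF X(1)] complex_space_fspace[OF Y]
      fspace_map_axioms.intro[OF hol]])
  obtain Z where Z: "analytic_subset X Z" "nowhere_dense X Z" "nowhere_dense Y (ov Z)"
    "biholomorphic_map (csub Y (ov (pts X - Z))) (csub X (pts X - Z)) \<rho>"
    using \<rho> unfolding proper_bimeromorphic_def by blast
  have cZ: "closedin (ctop X) Z" by (rule X.closedin_analytic_subset[OF Z(1)])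
  let ?Q = "pts X - Z"
  have oQ: "openin (ctop X) ?Q" using cZ unfolding closedin_def by blast
  have pY: "pts (csub Y (ov ?Q)) = ov ?Q" using openin_subset[OF openin_ov[OF oQ]] unfolding csub_def by auto
  have pX: "pts (csub X ?Q) = ?Q" unfolding csub_def by auto
  have hm: "homeomorphic_map (ctop (csub Y (ov ?Q))) (ctop (csub X ?Q)) \<rho>"
    using Z(4) unfolding biholomorphic_map_def by blast
  have inj: "inj_on \<rho> (ov ?Q)" using homeomorphic_imp_injective_map[OF hm] unfolding pY .
  have img: "\<rho> ` ov ?Q = ?Q" using homeomorphic_imp_surjective_map[OF hm] unfolding pX pY .
  have surj: "\<exists>y\<in>pts Y. \<rho> y = x" if "x \<in> pts X" for x
  proof -
    have "closedin (ctop X) (\<rho> ` pts Y)" using proper unfolding proper_map_def closed_map_def by blast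
    then have "openin (ctop X) (pts X - \<rho> ` pts Y)" by blast
    moreover have "pts X - \<rho> ` pts Y \<subseteq> Z" using img ov_iff by blast
    ultimately have "pts X - \<rho> ` pts Y = {}"
      by (rule nowhere_dense_openin[OF Z(2) closedin_subset[OF cZ]])
    then show ?thesis using that by blast
  qed
  show ?thesis
  proof (unfold_locales, rule surj)
    fix U f assume U: "openin (ctop X) U" and f: "f \<in> hol Y (ov U)"
    have "\<forall>x\<in>pts X. \<exists>y. y \<in> pts Y \<and> \<rho> y = x" using surj by blast
    \<comment> \<open>A set-theoretic section. Off \<open>Z\<close> it inverts
      \<open>\<rho>\<close>, so \<open>f (r x)\<close> is the only candidate for the descended
      function there; its values over \<open>Z\<close> are arbitrary.\<close>
    then obtain r where r: "\<And>x. x \<in> pts X \<Longrightarrow> r x \<in> pts Y \<and> \<rho> (r x) = x" by metis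
    let ?W = "U - Z"
    have UX: "U \<subseteq> pts X" by (rule openin_subset[OF U])
    have oW: "openin (ctop X) ?W" using U cZ by (rule openin_diff)
    have fr: "f (r (\<rho> y)) = f y" if "y \<in> ov ?W" for y
    proof -
      have "\<rho> y \<in> ?Q" using that UX unfolding ov_iff by blast
      then have "r (\<rho> y) \<in> ov ?Q" "\<rho> (r (\<rho> y)) = \<rho> y" "y \<in> ov ?Q" using r[of "\<rho> y"] that unfolding ov_iff by auto
      then show ?thesis using inj unfolding inj_on_def by metis
    qed
    have "f \<in> hol Y (ov ?W)" by (rule Y.hol_subset[OF f openin_ov[OF oW] ov_mono]) blast
    then have "(\<lambda>x. f (r x)) \<circ> \<rho> \<in> hol Y (ov ?W)" by (rule Y.hol_cong) (simp add: fr)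
    moreover have WQ: "?W \<subseteq> ?Q" "ov ?W \<subseteq> ov ?Q" using UX by (auto intro!: ov_mono)
    moreover have "{y \<in> pts (csub Y (ov ?Q)). \<rho> y \<in> ?W} = ov ?W" using WQ(2) unfolding pY by (auto simp: ov_iff)
    ultimately have "(\<lambda>x. f (r x)) \<circ> \<rho> \<in> hol (csub Y (ov ?Q)) {y \<in> pts (csub Y (ov ?Q)). \<rho> y \<in> ?W}"
      by (simp add: csub_def lb_res_def)
    moreover have "openin (ctop (csub X ?Q)) ?W"
      using oW WQ(1) oQ unfolding csub_def by (simp add: openin_open_subtopology)
    ultimately have "(\<lambda>x. f (r x)) \<in> hol (csub X ?Q) ?W" using Z(4) unfolding biholomorphic_map_def by blast
    then have "(\<lambda>x. f (r x)) \<in> hol X ?W" using WQ(1) by (simp add: csub_def lb_res_def)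
    moreover have "U - Z \<inter> U = ?W" by blast
    ultimately have h1: "(\<lambda>x. f (r x)) \<in> hol X (U - Z \<inter> U)" by simp
    have h2: "\<forall>x\<in>U. \<exists>V B. openin (ctop X) V \<and> x \<in> V \<and> V \<subseteq> U \<and> (\<forall>z\<in>V - Z \<inter> U. cmod (f (r z)) \<le> B)"
    proof
      fix x assume x: "x \<in> U"
      obtain V B where V: "openin (ctop X) V" "x \<in> V" "V \<subseteq> U" "\<And>y. y \<in> ov V \<Longrightarrow> cmod (f y) \<le> B"
        by (rule hol_bounded_near_fibre[OF proper U f x]) (rule that)
      have "r z \<in> ov V" if "z \<in> V" for z using that r[of z] V(3) UX unfolding ov_iff by auto
      then show "\<exists>V B. openin (ctop X) V \<and> x \<in> V \<and> V \<subseteq> U \<and> (\<forall>z\<in>V - Z \<inter> U. cmod (f (r z)) \<le> B)"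
        using V by (intro exI[of _ V] exI[of _ B]) simp
    qed
    have "\<exists>g\<in>hol X U. \<forall>z\<in>U - Z \<inter> U. g z = f (r z)"
      using X(2)[unfolded normal_space_cx_def, rule_format, of U "Z \<inter> U" "\<lambda>x. f (r x)"]
        U X.analytic_subset_csub[OF Z(1) U] nowhere_dense_csub[OF Z(2) cZ U] h1 h2 by simp
    then obtain g where g: "g \<in> hol X U" "\<And>z. z \<in> U - Z \<Longrightarrow> g z = f (r z)" by blast
    \<comment> \<open>The disagreement set is open and confined to the preimage of \<open>Z\<close>.
      That this preimage is nowhere dense in \<open>Y\<close> is part of the definition of a
      bimeromorphic map and separate from the corresponding property of \<open>Z\<close> in
      \<open>X\<close>.\<close>
    let ?D = "{y \<in> ov U. f y \<noteq> g (\<rho> y)}"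
    have "?D \<subseteq> ov Z"
    proof
      fix y assume y: "y \<in> ?D"
      show "y \<in> ov Z"
      proof (rule ccontr)
        assume "y \<notin> ov Z"
        then have "y \<in> ov ?W" using y unfolding ov_iff by blast
        then have "g (\<rho> y) = f y" using g(2)[of "\<rho> y"] fr unfolding ov_iff by simp
        then show False using y by simp
      qed
    qed
    moreover have "openin (ctop Y) ?D" by (rule Y.openin_hol_neq[OF f hol_pull[OF g(1)]])
    moreover have "ov Z \<subseteq> pts Y" unfolding over_def by blast
    ultimately have "?D = {}" using nowhere_dense_openin[OF Z(3)] by blast
    then show "\<exists>g\<in>hol X U. \<forall>y\<in>ov U. f y = g (\<rho> y)" using g(1) by blast
  qed
qed

section \<open>Torsors under the Picard stack\<close>

text \<open>In a frame \<open>e\<close> the function is the quotient of the two frames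
  \<open>h z * e z\<close> and \<open>e z\<close>.\<close>

lemma (in fspace) line_bundle_hol_endo:
  assumes L: "line_bundle X U L" and h: "isom X U L L h"
  shows "h \<in> hol X U"
proof (rule hol_glue[OF line_bundleD(1)[OF L]])
  fix x assume x: "x \<in> U"
  obtain V e where V: "x \<in> V" "V \<subseteq> U" "V \<subseteq> U" "frame X L V e"
    by (rule line_bundle_frame[OF L x line_bundleD(1)[OF L] x])
  have "(\<lambda>z. h z * e z / e z) \<in> hol X V"
    by (rule frame_quotient[OF isom_frame[OF line_bundleD(2)[OF L] h V(4,2)] V(4)])
  then have "h \<in> hol X V" by (rule hol_cong) (simp add: frameD(2)[OF V(4)])
  then show "\<exists>V. x \<in> V \<and> V \<subseteq> U \<and> h \<in> hol X V" using V by blast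
qed

context fspace_descent
begin

text \<open>No regularity is asked of this section. It only names descended functions:
  \<open>f\<close> composed with \<open>sect\<close> agrees with the descent of \<open>f\<close>
  whatever points are chosen, because \<open>f\<close> is constant on fibres.\<close>

definition sect :: "'a \<Rightarrow> 'b" where "sect x = (SOME y. y \<in> pts Y \<and> \<rho> y = x)"

lemma sect: "x \<in> pts X \<Longrightarrow> sect x \<in> pts Y" "x \<in> pts X \<Longrightarrow> \<rho> (sect x) = x"
proof -
  assume "x \<in> pts X"
  then have "\<exists>y. y \<in> pts Y \<and> \<rho> y = x" using surj by blast
  then have "sect x \<in> pts Y \<and> \<rho> (sect x) = x" unfolding sect_def by (rule someI_ex)
  then show "sect x \<in> pts Y" "\<rho> (sect x) = x" by simp_all
qed

lemma sect_ov: "openin (ctop X) U \<Longrightarrow> x \<in> U \<Longrightarrow> sect x \<in> ov U"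
  using sect[of x] openin_subset[of "ctop X" U] unfolding ov_iff by auto

lemma \<rho>_sect: "openin (ctop X) U \<Longrightarrow> x \<in> U \<Longrightarrow> \<rho> (sect x) = x"
  using sect[of x] openin_subset[of "ctop X" U] by auto

lemma unit_descent:
  assumes U: "openin (ctop X) U" and f: "f \<in> hol Y (ov U)" and nz: "\<And>y. y \<in> ov U \<Longrightarrow> f y \<noteq> 0"
  shows "(\<lambda>x. f (sect x)) \<in> hol X U" "\<And>x. x \<in> U \<Longrightarrow> f (sect x) \<noteq> 0"
    and "\<And>y. y \<in> ov U \<Longrightarrow> f (sect (\<rho> y)) = f y"
proof -
  obtain g where g: "g \<in> hol X U" "\<forall>y\<in>ov U. f y = g (\<rho> y)" using hol_descent[OF U f] by blast
  have eq: "g x = f (sect x)" if "x \<in> U" for x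
    using g(2) sect_ov[OF U that] \<rho>_sect[OF U that] by simp
  show "(\<lambda>x. f (sect x)) \<in> hol X U" using g(1) eq by (rule X.hol_cong)
  show "f (sect x) \<noteq> 0" if "x \<in> U" for x by (rule nz[OF sect_ov[OF U that]])
  show "f (sect (\<rho> y)) = f y" if "y \<in> ov U" for y using that g(2) eq[of "\<rho> y"] by (simp add: ov_iff)
qed

text \<open>Relative to frames of \<open>p\<close> and \<open>q\<close> on the base, the isomorphism
  is multiplication by a holomorphic unit on a full preimage, and such units descend.\<close>

lemma isom_descent:
  assumes p: "line_bundle X U p" and q: "line_bundle X U q" and L: "line_bundle Y (ov U) L"
    and h: "isom Y (ov U) (lb_tensor Y (lb_pull Y \<rho> p) L) (lb_tensor Y (lb_pull Y \<rho> q) L) h"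
  shows "isom X U p q (\<lambda>x. h (sect x))" and "\<And>y. y \<in> ov U \<Longrightarrow> h (sect (\<rho> y)) = h y"
proof -
  note U = X.line_bundleD(1)[OF p]
  note qL = Y.line_bundleD(2)[OF Y.line_bundle_lb_tensor[OF line_bundle_lb_pull[OF q] L]]
  have loc: "\<exists>V a. x \<in> V \<and> V \<subseteq> U \<and> frame X p V a \<and> frame X q V (\<lambda>z. h (sect z) * a z) \<and>
     (\<forall>y\<in>ov V. h (sect (\<rho> y)) = h y)" if x: "x \<in> U" for x
  proof -
    obtain V a b where V: "x \<in> V" "V \<subseteq> U" "V \<subseteq> U" "frame X p V a" "frame X q V b"
      by (rule X.line_bundle_frame2[OF p q x U x])
    note oV = frameD(1)[OF V(4)]
    have VU: "ov V \<subseteq> ov U" by (rule ov_mono[OF V(2)])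
    \<comment> \<open>The coefficient of \<open>h\<close> from the frame
      \<open>a (\<rho> y) * e y\<close> to \<open>b (\<rho> y) * e y\<close>. A frame
      \<open>e\<close> of \<open>L\<close> exists only near single points upstairs, but it cancels,
      so the coefficient makes sense over all of \<open>V\<close>.\<close>
    let ?f = "\<lambda>y. h y * a (\<rho> y) / b (\<rho> y)"
    have ab: "a (\<rho> y) \<noteq> 0" "b (\<rho> y) \<noteq> 0" if "y \<in> ov V" for y
      using that frameD(2)[OF V(4)] frameD(2)[OF V(5)] by (simp_all add: ov_iff)
    have fh: "?f \<in> hol Y (ov V)"
    proof (rule Y.hol_glue[OF openin_ov[OF oV]])
      fix y assume y: "y \<in> ov V"
      then have yU: "y \<in> ov U" using VU by blast
      obtain W e where W: "y \<in> W" "W \<subseteq> ov U" "W \<subseteq> ov V" "frame Y L W e"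
        by (rule Y.line_bundle_frame[OF L yU openin_ov[OF oV] y])
      have "frame Y (lb_tensor Y (lb_pull Y \<rho> q) L) W (\<lambda>y. h y * (a (\<rho> y) * e y))"
        by (rule Y.isom_frame[OF qL h frame_lb_pull_tensor[OF p V(4) W(4,3)] W(2)])
      from Y.frame_quotient[OF this frame_lb_pull_tensor[OF q V(5) W(4,3)]]
      have "?f \<in> hol Y W" by (rule Y.hol_cong) (use frameD(2)[OF W(4)] in simp)
      then show "\<exists>W. y \<in> W \<and> W \<subseteq> ov V \<and> ?f \<in> hol Y W" using W by blast
    qed
    have fn: "?f y \<noteq> 0" if "y \<in> ov V" for y using that ab isomD(1)[OF h] VU by auto
    note f = unit_descent[OF oV fh fn]
    have "frame X q V (\<lambda>z. h (sect z) * a z)"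
      by (rule X.frame_cong[OF X.frame_mult_unit[OF V(5) f(1,2)]])
        (use \<rho>_sect[OF oV] frameD(2)[OF V(5)] in simp_all)
    moreover have "h (sect (\<rho> y)) = h y" if "y \<in> ov V" for y
    proof -
      have "\<rho> (sect (\<rho> y)) = \<rho> y" using that \<rho>_sect[OF oV] by (simp add: ov_iff)
      then show ?thesis using f(3)[OF _ that] ab[OF that] by simp
    qed
    ultimately show ?thesis using V by blast
  qed
  show "isom X U p q (\<lambda>x. h (sect x))"
  proof (rule X.isom_by_frames[OF X.line_bundleD(2)[OF p] X.line_bundleD(2)[OF q] order_refl order_refl])
    fix x assume "x \<in> U"
    then obtain V a where V: "x \<in> V" "V \<subseteq> U" "frame X p V a" "frame X q V (\<lambda>z. h (sect z) * a z)"
      using loc by meson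
    have "\<forall>z\<in>V. h (sect z) \<noteq> 0" using isomD(1)[OF h] sect_ov[OF U] V(2) by blast
    then show "\<exists>V a. x \<in> V \<and> (\<forall>z\<in>V. h (sect z) \<noteq> 0) \<and> frame X p V a \<and> frame X q V (\<lambda>z. h (sect z) * a z)"
      using V by blast
  qed
  show "h (sect (\<rho> y)) = h y" if "y \<in> ov U" for y
  proof -
    have "\<rho> y \<in> U" using that by (simp add: ov_iff)
    then obtain V where "\<rho> y \<in> V" "\<forall>y\<in>ov V. h (sect (\<rho> y)) = h y" using loc by meson
    then show ?thesis using that by (simp add: ov_iff)
  qed
qed

text \<open>Isomorphy over a neighbourhood of a point of the base, hence near its whole fibre. The
  bundles may live over different open sets, which are not recorded; \<open>near_shrink\<close>
  moves \<open>V\<close> inside any given neighbourhood. Equality of germs of relative Picard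
  classes will turn out to be this relation.\<close>

definition near :: "'a \<Rightarrow> 'b lb \<Rightarrow> 'b lb \<Rightarrow> bool" where
  "near u L L' \<longleftrightarrow> (\<exists>V h. openin (ctop X) V \<and> u \<in> V \<and> isom Y (ov V) L L' h)"

lemma near_shrink:
  assumes "near u L L'" "openin (ctop X) U" "u \<in> U"
  obtains V h where "openin (ctop X) V" "u \<in> V" "V \<subseteq> U" "isom Y (ov V) L L' h"
proof -
  obtain V h where V: "openin (ctop X) V" "u \<in> V" "isom Y (ov V) L L' h" using assms(1) unfolding near_def by blast
  have "isom Y (ov (V \<inter> U)) L L' h" using isom_subset[OF V(3)] ov_mono[of "V \<inter> U" V] by blast
  then show thesis using that[of "V \<inter> U" h] V assms by blast
qed

lemma near_refl: "u \<in> pts X \<Longrightarrow> near u L L"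
  unfolding near_def by (intro exI[of _ "pts X"] exI[of _ "\<lambda>_. 1"]) (simp add: isom_one)

lemma near_sym:
  assumes "near u L L'" "line_bundle Y A L'"
  shows "near u L' L"
  using assms(1) isom_inverse[OF Y.line_bundleD(2)[OF assms(2)]] unfolding near_def by meson

lemma near_trans:
  assumes "near u L L'" "near u L' L''"
  shows "near u L L''"
proof -
  obtain V h where V: "openin (ctop X) V" "u \<in> V" "isom Y (ov V) L L' h" using assms(1) unfolding near_def by blast
  obtain W k where W: "openin (ctop X) W" "u \<in> W" "W \<subseteq> V" "isom Y (ov W) L' L'' k"
    by (rule near_shrink[OF assms(2) V(1,2)])
  show ?thesis unfolding near_def using isom_comp[OF isom_subset[OF V(3) ov_mono[OF W(3)]] W(4)] W by blast
qed

lemma near_lb_res: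
  assumes "openin (ctop X) V" "u \<in> V"
  shows "near u (lb_res (ov V) L) L' \<longleftrightarrow> near u L L'" "near u L (lb_res (ov V) L') \<longleftrightarrow> near u L L'"
proof -
  show "near u (lb_res (ov V) L) L' \<longleftrightarrow> near u L L'"
  proof
    assume n: "near u (lb_res (ov V) L) L'"
    obtain W h where W: "openin (ctop X) W" "u \<in> W" "W \<subseteq> V" "isom Y (ov W) (lb_res (ov V) L) L' h"
      by (rule near_shrink[OF n assms])
    then show "near u L L'" unfolding near_def isom_lb_res(1)[OF ov_mono[OF W(3)]] by blast
  next
    assume n: "near u L L'"
    obtain W h where W: "openin (ctop X) W" "u \<in> W" "W \<subseteq> V" "isom Y (ov W) L L' h"
      by (rule near_shrink[OF n assms])
    then show "near u (lb_res (ov V) L) L'" unfolding near_def using isom_lb_res(1)[OF ov_mono[OF W(3)]] by blast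
  qed
  show "near u L (lb_res (ov V) L') \<longleftrightarrow> near u L L'"
  proof
    assume n: "near u L (lb_res (ov V) L')"
    obtain W h where W: "openin (ctop X) W" "u \<in> W" "W \<subseteq> V" "isom Y (ov W) L (lb_res (ov V) L') h"
      by (rule near_shrink[OF n assms])
    then show "near u L L'" unfolding near_def isom_lb_res(2)[OF ov_mono[OF W(3)]] by blast
  next
    assume n: "near u L L'"
    obtain W h where W: "openin (ctop X) W" "u \<in> W" "W \<subseteq> V" "isom Y (ov W) L L' h"
      by (rule near_shrink[OF n assms])
    then show "near u L (lb_res (ov V) L')" unfolding near_def using isom_lb_res(2)[OF ov_mono[OF W(3)]] by blast
  qed
qed

text \<open>A frame of \<open>M\<close> near \<open>u\<close> pulls back to a frame over an entire
  preimage, and multiplication by it is the isomorphism.\<close>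

lemma near_pull_tensor:
  assumes M: "line_bundle X U M" and L: "line_bundle Y (ov U) L" and u: "u \<in> U"
  shows "near u L (lb_tensor Y (lb_pull Y \<rho> M) L)"
proof -
  note U = X.line_bundleD(1)[OF M]
  obtain V e where V: "u \<in> V" "V \<subseteq> U" "V \<subseteq> U" "frame X M V e"
    by (rule X.line_bundle_frame[OF M u U u])
  note oV = frameD(1)[OF V(4)]
  have "isom Y (ov V) L (lb_tensor Y (lb_pull Y \<rho> M) L) (\<lambda>y. e (\<rho> y))"
  proof (rule Y.isom_by_frames[OF Y.line_bundleD(2)[OF L] Y.line_bundleD(2)[OF Y.line_bundle_lb_tensor[OF line_bundle_lb_pull[OF M] L]]
       ov_mono[OF V(2)] ov_mono[OF V(2)]])
    fix y assume y: "y \<in> ov V"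
    then have yU: "y \<in> ov U" using ov_mono[OF V(2)] by blast
    obtain W e' where W: "y \<in> W" "W \<subseteq> ov U" "W \<subseteq> ov V" "frame Y L W e'"
      by (rule Y.line_bundle_frame[OF L yU openin_ov[OF oV] y])
    have "\<forall>z\<in>W. e (\<rho> z) \<noteq> 0" using W(3) frameD(2)[OF V(4)] by (auto simp: ov_iff)
    then show "\<exists>W e'. y \<in> W \<and> (\<forall>z\<in>W. e (\<rho> z) \<noteq> 0) \<and> frame Y L W e' \<and>
      frame Y (lb_tensor Y (lb_pull Y \<rho> M) L) W (\<lambda>z. e (\<rho> z) * e' z)"
      using W frame_lb_pull_tensor[OF M V(4) W(4,3)] by blast
  qed
  then show ?thesis using V oV unfolding near_def by blast
qed

text \<open>Local isomorphisms differ by units pulled back from the base; these glue trivial bundles to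
  the bundle \<open>M\<close>.\<close>

lemma near_imp_twist:
  assumes U: "openin (ctop X) U" and L: "line_bundle Y (ov U) L" and L': "line_bundle Y (ov U) L'"
    and near: "\<And>u. u \<in> U \<Longrightarrow> near u L L'"
  obtains M k where "line_bundle X U M" "isom Y (ov U) (lb_tensor Y (lb_pull Y \<rho> M) L) L' k"
proof -
  have "\<forall>u\<in>U. \<exists>V h. openin (ctop X) V \<and> u \<in> V \<and> V \<subseteq> U \<and> isom Y (ov V) L L' h"
  proof
    fix u assume u: "u \<in> U"
    obtain V h where "openin (ctop X) V" "u \<in> V" "V \<subseteq> U" "isom Y (ov V) L L' h"
      by (rule near_shrink[OF near[OF u] U u])
    then show "\<exists>V h. openin (ctop X) V \<and> u \<in> V \<and> V \<subseteq> U \<and> isom Y (ov V) L L' h" by blast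
  qed
  then obtain V h where V: "\<And>u. u \<in> U \<Longrightarrow> openin (ctop X) (V u)" "\<And>u. u \<in> U \<Longrightarrow> u \<in> V u"
    "\<And>u. u \<in> U \<Longrightarrow> V u \<subseteq> U" "\<And>u. u \<in> U \<Longrightarrow> isom Y (ov (V u)) L L' (h u)" by metis
  note shL = Y.line_bundleD(2)[OF L] and shL' = Y.line_bundleD(2)[OF L']
  \<comment> \<open>On an overlap the two isomorphisms differ by an automorphism of
    \<open>L\<close>, a holomorphic unit upstairs and therefore a function on the base. Evaluating
    at \<open>sect\<close> gives its descent.\<close>
  have quot: "(\<lambda>x. h u (sect x) / h v (sect x)) \<in> hol X (V u \<inter> V v)"
      "y \<in> ov (V u \<inter> V v) \<Longrightarrow> h u (sect (\<rho> y)) / h v (sect (\<rho> y)) = h u y / h v y"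
    if uv: "u \<in> U" "v \<in> U" for u v y
  proof -
    let ?W = "V u \<inter> V v"
    have o: "openin (ctop X) ?W" using V(1) uv by blast
    have WU: "?W \<subseteq> U" using V(3)[OF uv(1)] by blast
    have hu: "isom Y (ov ?W) L L' (h u)" by (rule isom_subset[OF V(4)[OF uv(1)] ov_mono]) blast
    have hv: "isom Y (ov ?W) L L' (h v)" by (rule isom_subset[OF V(4)[OF uv(2)] ov_mono]) blast
    have "isom Y (ov ?W) L L (\<lambda>y. inverse (h v y) * h u y)"
      by (rule isom_comp[OF hu isom_inverse[OF shL' hv]])
    then have "isom Y (ov ?W) (lb_res (ov ?W) L) (lb_res (ov ?W) L) (\<lambda>y. inverse (h v y) * h u y)"
      by (simp add: isom_lb_res)
    from Y.line_bundle_hol_endo[OF Y.line_bundle_lb_res[OF L openin_ov[OF o] ov_mono[OF WU]] this]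
    have q: "(\<lambda>y. h u y / h v y) \<in> hol Y (ov ?W)" by (simp add: divide_inverse mult.commute)
    have nz: "h u y / h v y \<noteq> 0" if "y \<in> ov ?W" for y using that isomD(1)[OF hu] isomD(1)[OF hv] by simp
    show "(\<lambda>x. h u (sect x) / h v (sect x)) \<in> hol X ?W" by (rule unit_descent(1)[OF o q nz])
    show "h u (sect (\<rho> y)) / h v (sect (\<rho> y)) = h u y / h v y" if "y \<in> ov ?W"
      by (rule unit_descent(3)[OF o q nz that])
  qed
  have nz: "h u (sect x) \<noteq> 0" if "u \<in> U" "x \<in> V u" for u x
    by (rule isomD(1)[OF V(4)[OF that(1)] sect_ov[OF V(1)[OF that(1)] that(2)]])
  obtain M \<psi> where M: "line_bundle X (\<Union>u\<in>U. V u) M" "\<And>u. u \<in> U \<Longrightarrow> isom X (V u) M (lb_trivial X (V u)) (\<psi> u)"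
    and \<psi>: "\<And>u v x. u \<in> U \<Longrightarrow> v \<in> U \<Longrightarrow> x \<in> V u \<Longrightarrow> x \<in> V v \<Longrightarrow> h u (sect x) / h v (sect x) * \<psi> u x = \<psi> v x"
  proof (rule X.line_bundle_descent[of U V "\<lambda>u. lb_trivial X (V u)" "\<lambda>u v x. h u (sect x) / h v (sect x)"])
    show "line_bundle X (V u) (lb_trivial X (V u))" if "u \<in> U" for u by (rule X.line_bundle_lb_trivial[OF V(1)[OF that]])
    show "isom X (V u \<inter> V v) (lb_trivial X (V u)) (lb_trivial X (V v)) (\<lambda>x. h u (sect x) / h v (sect x))"
      if uv: "u \<in> U" "v \<in> U" for u v
    proof -
      have o: "openin (ctop X) (V u \<inter> V v)" using V(1) uv by blast
      have "frame X (lb_trivial X (V v)) (V u \<inter> V v) (\<lambda>x. h u (sect x) / h v (sect x) * 1)"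
        by (rule X.frame_mult_unit[OF X.frame_lb_trivial[OF o] quot(1)[OF uv]]) (use nz uv in auto)
      from X.isom_frames[OF X.frame_lb_trivial[OF o] this] show ?thesis by simp
    qed
    show "h v (sect x) / h w (sect x) * (h u (sect x) / h v (sect x)) = h u (sect x) / h w (sect x)"
      if "v \<in> U" "x \<in> V v" for u v w x using nz[OF that] by simp
  qed (rule that)
  have "(\<Union>u\<in>U. V u) = U" using V(2,3) by blast
  then have MU: "line_bundle X U M" using M(1) by simp
  \<comment> \<open>Since \<open>h u y * \<psi> u (\<rho> y)\<close> does not depend on
    \<open>u\<close>, the point \<open>\<rho> y\<close> itself can serve as index: the cover is
    indexed by the points of \<open>U\<close>.\<close>
  let ?k = "\<lambda>y. h (\<rho> y) y * \<psi> (\<rho> y) (\<rho> y)"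
  have k: "?k y = h u y * \<psi> u (\<rho> y)" if u: "u \<in> U" and y: "y \<in> ov (V u)" for u y
  proof -
    have r: "\<rho> y \<in> U" "\<rho> y \<in> V u" "\<rho> y \<in> V (\<rho> y)" using y u V(2,3) by (auto simp: ov_iff)
    then have y': "y \<in> ov (V u \<inter> V (\<rho> y))" using y by (auto simp: ov_iff)
    have "h (\<rho> y) y \<noteq> 0" by (rule isomD(1)[OF V(4)[OF r(1)]]) (use y' ov_Int in blast)
    then show ?thesis using \<psi>[OF u r(1) r(2,3)] quot(2)[OF u r(1) y'] by (simp add: field_simps)
  qed
  have "isom Y (ov U) (lb_tensor Y (lb_pull Y \<rho> M) L) L' ?k"
  proof (rule Y.isom_by_frames[OF Y.line_bundleD(2)[OF Y.line_bundle_lb_tensor[OF line_bundle_lb_pull[OF MU] L]] shL'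
      order_refl order_refl])
    fix y assume y: "y \<in> ov U"
    then have u: "\<rho> y \<in> U" by (simp add: ov_iff)
    let ?V = "V (\<rho> y)"
    have yV: "y \<in> ov ?V" using V(2)[OF u] y by (simp add: ov_iff)
    obtain W e where W: "y \<in> W" "W \<subseteq> ov U" "W \<subseteq> ov ?V" "frame Y L W e"
      by (rule Y.line_bundle_frame[OF L y openin_ov[OF V(1)[OF u]] yV])
    note p = M(2)[OF u]
    \<comment> \<open>The frame of \<open>M\<close> that corresponds to 1 under
      \<open>\<psi> (\<rho> y)\<close>. Its factor \<open>inverse (\<psi> (\<rho> y) x)\<close>
      cancels against \<open>?k\<close>, leaving the image of \<open>e\<close> under
      \<open>h (\<rho> y)\<close>.\<close>
    have f: "frame X M ?V (\<lambda>x. inverse (\<psi> (\<rho> y) x) * 1)"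
      by (rule X.isom_frame[OF X.line_bundleD(2)[OF MU]
        isom_inverse[OF X.line_bundleD(2)[OF X.line_bundle_lb_trivial[OF V(1)[OF u]]] p]
        X.frame_lb_trivial[OF V(1)[OF u] order_refl] order_refl])
    have g: "frame Y L' W (\<lambda>z. h (\<rho> y) z * e z)"
      by (rule Y.isom_frame[OF shL' isom_subset[OF V(4)[OF u] W(3)] W(4) order_refl])
    have pz: "\<psi> (\<rho> y) (\<rho> z) \<noteq> 0" if "z \<in> W" for z using isomD(1)[OF p] W(3) that by (auto simp: ov_iff)
    have hz: "h (\<rho> y) z \<noteq> 0" if "z \<in> W" for z using isomD(1)[OF V(4)[OF u]] W(3) that by blast
    have kz: "?k z = h (\<rho> y) z * \<psi> (\<rho> y) (\<rho> z)" if "z \<in> W" for z using k[OF u] W(3) that by blast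
    have "frame Y L' W (\<lambda>z. ?k z * (inverse (\<psi> (\<rho> y) (\<rho> z)) * 1 * e z))"
      by (rule Y.frame_cong[OF g]) (simp add: kz pz)
    moreover have "\<forall>z\<in>W. ?k z \<noteq> 0" by (simp add: kz pz hz)
    ultimately show "\<exists>W e. y \<in> W \<and> (\<forall>z\<in>W. ?k z \<noteq> 0) \<and> frame Y (lb_tensor Y (lb_pull Y \<rho> M) L) W e \<and>
       frame Y L' W (\<lambda>z. ?k z * e z)"
      using frame_lb_pull_tensor[OF MU f W(4,3)] W(1)
      by (intro exI[of _ W] exI[of _ "\<lambda>z. inverse (\<psi> (\<rho> y) (\<rho> z)) * 1 * e z"]) simp
  qed
  then show thesis by (rule that[OF MU])
qed

section \<open>Relative Picard classes\<close>

text \<open>Twists from the base are invisible near fibres, and conversely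
  \<open>near_imp_twist\<close> produces a twist from nearness. The existential over
  \<open>M\<close> is thereby replaced by a pointwise condition, which behaves well under
  restriction.\<close>

lemma rel_Pic_class_eq:
  assumes U: "openin (ctop X) U" and L: "line_bundle Y (ov U) L"
  shows "rel_Pic_class Y X \<rho> U L = {L'. line_bundle Y (ov U) L' \<and> (\<forall>u\<in>U. near u L L')}"
proof (intro Set.set_eqI iffI)
  fix L' assume "L' \<in> rel_Pic_class Y X \<rho> U L"
  then obtain M h where L': "line_bundle Y (ov U) L'" and M: "line_bundle X U M"
    and h: "h \<in> lb_iso Y (ov U) L' (lb_tensor Y L (lb_pull Y \<rho> M))"
    unfolding rel_Pic_class_def by blast
  have "near u L L'" if u: "u \<in> U" for u
  proof -
    have "near u L' (lb_tensor Y (lb_pull Y \<rho> M) L)" unfolding near_def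
      using Y.lb_isoD(1)[OF h] U u Y.lb_tensor_commute[of L "lb_pull Y \<rho> M"]
      by (intro exI[of _ U] exI[of _ h]) simp
    from near_sym[OF this Y.line_bundle_lb_tensor[OF line_bundle_lb_pull[OF M] L]]
    show ?thesis by (rule near_trans[OF near_pull_tensor[OF M L u]])
  qed
  then show "L' \<in> {L'. line_bundle Y (ov U) L' \<and> (\<forall>u\<in>U. near u L L')}" using L' by blast
next
  fix L' assume "L' \<in> {L'. line_bundle Y (ov U) L' \<and> (\<forall>u\<in>U. near u L L')}"
  then have L': "line_bundle Y (ov U) L'" and n: "\<And>u. u \<in> U \<Longrightarrow> near u L L'" by simp_all
  obtain M k where M: "line_bundle X U M" and k: "isom Y (ov U) (lb_tensor Y (lb_pull Y \<rho> M) L) L' k"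
    by (rule near_imp_twist[OF U L L' n])
  note t = Y.line_bundle_lb_tensor[OF line_bundle_lb_pull[OF M] L]
  have "restrict (\<lambda>y. inverse (k y)) (ov U) \<in> lb_iso Y (ov U) L' (lb_tensor Y (lb_pull Y \<rho> M) L)"
    by (rule lb_iso_restrictI[OF Y.line_bundleD(2)[OF t] isom_inverse[OF Y.line_bundleD(2)[OF L'] k]])
  then have "lb_iso Y (ov U) L' (lb_tensor Y L (lb_pull Y \<rho> M)) \<noteq> {}"
    using Y.lb_tensor_commute[of L "lb_pull Y \<rho> M"] by auto
  then show "L' \<in> rel_Pic_class Y X \<rho> U L" using L' M unfolding rel_Pic_class_def by blast
qed

lemma rel_Pic_class_eq_iff:
  assumes U: "openin (ctop X) U" and L: "line_bundle Y (ov U) L" and L': "line_bundle Y (ov U) L'"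
  shows "rel_Pic_class Y X \<rho> U L = rel_Pic_class Y X \<rho> U L' \<longleftrightarrow> (\<forall>u\<in>U. near u L L')"
proof
  assume eq: "rel_Pic_class Y X \<rho> U L = rel_Pic_class Y X \<rho> U L'"
  have "L' \<in> rel_Pic_class Y X \<rho> U L'"
    unfolding rel_Pic_class_eq[OF U L'] using L' near_refl openin_subset[OF U] by blast
  then show "\<forall>u\<in>U. near u L L'" unfolding eq[symmetric] rel_Pic_class_eq[OF U L] by simp
next
  assume n: "\<forall>u\<in>U. near u L L'"
  then have "near u L N \<longleftrightarrow> near u L' N" if "u \<in> U" for u N
    using that near_trans near_sym[OF _ L'] by blast
  then show "rel_Pic_class Y X \<rho> U L = rel_Pic_class Y X \<rho> U L'"
    unfolding rel_Pic_class_eq[OF U L] rel_Pic_class_eq[OF U L'] by auto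
qed

text \<open>The union in \<open>rel_Pic_res\<close> runs over all representatives; each restricts to
  the same class, and \<open>L\<close> itself is a representative, so the union is that
  class.\<close>

lemma rel_Pic_res_class:
  assumes U: "openin (ctop X) U" and V: "openin (ctop X) V" "V \<subseteq> U" and L: "line_bundle Y (ov U) L"
  shows "rel_Pic_res Y X \<rho> U V (rel_Pic_class Y X \<rho> U L) = rel_Pic_class Y X \<rho> V (lb_res (ov V) L)"
proof -
  have res: "line_bundle Y (ov V) (lb_res (ov V) L')" if "line_bundle Y (ov U) L'" for L'
    by (rule Y.line_bundle_lb_res[OF that openin_ov[OF V(1)] ov_mono[OF V(2)]])
  have "rel_Pic_class Y X \<rho> V (lb_res (ov V) L') = rel_Pic_class Y X \<rho> V (lb_res (ov V) L)"
    if "L' \<in> rel_Pic_class Y X \<rho> U L" for L'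
  proof -
    have L': "line_bundle Y (ov U) L'" "\<forall>u\<in>U. near u L L'" using that unfolding rel_Pic_class_eq[OF U L] by simp_all
    then have "\<forall>u\<in>V. near u L L'" using V(2) by blast
    then show ?thesis using near_sym[OF _ L'(1)]
      by (subst rel_Pic_class_eq_iff[OF V(1) res[OF L'(1)] res[OF L]]) (simp add: near_lb_res[OF V(1)])
  qed
  moreover have "L \<in> rel_Pic_class Y X \<rho> U L"
    unfolding rel_Pic_class_eq[OF U L] using L near_refl openin_subset[OF U] by blast
  ultimately show ?thesis unfolding rel_Pic_res_def by blast
qed

text \<open>The right-hand side involves \<open>L\<close> only through \<open>near u L\<close> and
  does not involve \<open>U\<close>. Hence germs are compared by comparing bundles near the
  fibre.\<close>

lemma germ_rel_Pic:
  assumes U: "openin (ctop X) U" and u: "u \<in> U" and L: "line_bundle Y (ov U) L"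
  shows "germ (ctop X) (rel_Pic Y X \<rho>) (rel_Pic_res Y X \<rho>) u U (rel_Pic_class Y X \<rho> U L) =
    {(V, rel_Pic_class Y X \<rho> V N) | V N. openin (ctop X) V \<and> u \<in> V \<and> line_bundle Y (ov V) N \<and> near u L N}"
proof -
  have "(\<exists>W. openin (ctop X) W \<and> u \<in> W \<and> W \<subseteq> U \<inter> V \<and>
      rel_Pic_res Y X \<rho> U W (rel_Pic_class Y X \<rho> U L) = rel_Pic_res Y X \<rho> V W (rel_Pic_class Y X \<rho> V N)) \<longleftrightarrow> near u L N"
    if V: "openin (ctop X) V" "u \<in> V" and N: "line_bundle Y (ov V) N" for V N
  proof -
    have eq: "rel_Pic_res Y X \<rho> U W (rel_Pic_class Y X \<rho> U L) = rel_Pic_res Y X \<rho> V W (rel_Pic_class Y X \<rho> V N)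
      \<longleftrightarrow> (\<forall>w\<in>W. near w L N)" if W: "openin (ctop X) W" "W \<subseteq> U \<inter> V" for W
    proof -
      have s: "W \<subseteq> U" "W \<subseteq> V" using W(2) by blast+
      note r = Y.line_bundle_lb_res[OF _ openin_ov[OF W(1)] ov_mono]
      show ?thesis
        unfolding rel_Pic_res_class[OF U W(1) s(1) L] rel_Pic_res_class[OF V(1) W(1) s(2) N]
        by (subst rel_Pic_class_eq_iff[OF W(1) r[OF L s(1)] r[OF N s(2)]]) (simp add: near_lb_res[OF W(1)])
    qed
    show ?thesis
    proof
      assume "\<exists>W. openin (ctop X) W \<and> u \<in> W \<and> W \<subseteq> U \<inter> V \<and>
        rel_Pic_res Y X \<rho> U W (rel_Pic_class Y X \<rho> U L) = rel_Pic_res Y X \<rho> V W (rel_Pic_class Y X \<rho> V N)"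
      then show "near u L N" using eq by metis
    next
      assume n: "near u L N"
      have o: "openin (ctop X) (U \<inter> V)" "u \<in> U \<inter> V" using U V u by blast+
      obtain W h where W: "openin (ctop X) W" "u \<in> W" "W \<subseteq> U \<inter> V" "isom Y (ov W) L N h"
        by (rule near_shrink[OF n o])
      \<comment> \<open>An open set witnessing nearness at \<open>u\<close> witnesses it at each of
        its points, so a condition at one point yields equality of classes over
        \<open>W\<close>.\<close>
      then have "\<forall>w\<in>W. near w L N" unfolding near_def by blast
      then show "\<exists>W. openin (ctop X) W \<and> u \<in> W \<and> W \<subseteq> U \<inter> V \<and>
        rel_Pic_res Y X \<rho> U W (rel_Pic_class Y X \<rho> U L) = rel_Pic_res Y X \<rho> V W (rel_Pic_class Y X \<rho> V N)"
        using W eq[OF W(1,3)] by blast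
    qed
  qed
  then show ?thesis unfolding germ_def rel_Pic_def by blast
qed

lemma lb_section_eq_iff:
  assumes U: "openin (ctop X) U" "u \<in> U" and L: "line_bundle Y (ov U) L"
    and V: "openin (ctop X) V" "u \<in> V" and N: "line_bundle Y (ov V) N"
  shows "lb_section Y X \<rho> U L u = lb_section Y X \<rho> V N u \<longleftrightarrow> near u L N"
proof
  have e: "lb_section Y X \<rho> A K u =
     {(B, rel_Pic_class Y X \<rho> B N) | B N. openin (ctop X) B \<and> u \<in> B \<and> line_bundle Y (ov B) N \<and> near u K N}"
    if "openin (ctop X) A" "u \<in> A" "line_bundle Y (ov A) K" for A K
    unfolding lb_section_def using germ_rel_Pic[OF that] that(2) by simp
  have uX: "u \<in> pts X" using openin_subset[OF V(1)] V(2) by blast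
  {
    assume eq: "lb_section Y X \<rho> U L u = lb_section Y X \<rho> V N u"
    \<comment> \<open>The pair of \<open>V\<close> and the class of \<open>N\<close> belongs to its
      own germ. In the other germ it is written with some representative \<open>N'\<close> near
      \<open>L\<close>; equality of classes over \<open>V\<close> relates \<open>N'\<close> to
      \<open>N\<close>.\<close>
    have "(V, rel_Pic_class Y X \<rho> V N) \<in> lb_section Y X \<rho> V N u"
      unfolding e[OF V N] using V N near_refl[OF uX] by blast
    then obtain N' where N': "rel_Pic_class Y X \<rho> V N = rel_Pic_class Y X \<rho> V N'" "line_bundle Y (ov V) N'" "near u L N'"
      unfolding eq[symmetric] e[OF U L] by blast
    then have "near u N N'" using rel_Pic_class_eq_iff[OF V(1) N N'(2)] V(2) by blast
    from near_sym[OF this N'(2)] show "near u L N" by (rule near_trans[OF N'(3)])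
  }
  {
    assume n: "near u L N"
    have "near u L K \<longleftrightarrow> near u N K" for K using n near_trans near_sym[OF n N] by blast
    then show "lb_section Y X \<rho> U L u = lb_section Y X \<rho> V N u" unfolding e[OF U L] e[OF V N] by simp
  }
qed

section \<open>The canonical gerbe\<close>

lemma lb_section_eq_restrict_iff:
  "lb_section Y X \<rho> U L = restrict \<sigma> U \<longleftrightarrow> (\<forall>u\<in>U. lb_section Y X \<rho> U L u = \<sigma> u)"
  unfolding lb_section_def by (auto simp: restrict_def fun_eq_iff)

text \<open>The value of \<open>lb_section\<close> at \<open>u\<close> depends only on the bundle
  near the fibre. Restriction, a local isomorphism and a twist from the base do not change it, which
  is what the three properties of \<open>P\<close> require.\<close>

lemma gerbe_module_stack:
  "lb_module_stack X Y \<rho> (canonical_gerbe Y X \<rho> \<sigma>) (\<lambda>U L. lb_section Y X \<rho> U L = restrict \<sigma> U)"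
proof (unfold_locales, unfold lb_section_eq_restrict_iff)
  show "\<forall>u\<in>V. lb_section Y X \<rho> V (lb_res (ov V) L) u = \<sigma> u"
    if U: "openin (ctop X) U" and V: "openin (ctop X) V" "V \<subseteq> U" and L: "line_bundle Y (ov U) L"
      and s: "\<forall>u\<in>U. lb_section Y X \<rho> U L u = \<sigma> u" for U V L
  proof
    fix u assume u: "u \<in> V"
    then have uU: "u \<in> U" using V(2) by blast
    have "lb_section Y X \<rho> V (lb_res (ov V) L) u = lb_section Y X \<rho> U L u"
      using near_refl[of u L] u openin_subset[OF V(1)]
      by (subst lb_section_eq_iff[OF V(1) u Y.line_bundle_lb_res[OF L openin_ov[OF V(1)] ov_mono[OF V(2)]] U uU L])
        (auto simp: near_lb_res[OF V(1)])
    then show "lb_section Y X \<rho> V (lb_res (ov V) L) u = \<sigma> u" using s uU by simp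
  qed
  show "\<forall>u\<in>U. lb_section Y X \<rho> U L u = \<sigma> u"
    if U: "openin (ctop X) U" and L: "line_bundle Y (ov U) L"
      and loc: "\<And>u. u \<in> U \<Longrightarrow> \<exists>V L' h. openin (ctop X) V \<and> u \<in> V \<and> V \<subseteq> U \<and> line_bundle Y (ov V) L' \<and>
         (\<forall>u\<in>V. lb_section Y X \<rho> V L' u = \<sigma> u) \<and> isom Y (ov V) L L' h" for U L
  proof
    fix u assume u: "u \<in> U"
    obtain V L' h where V: "openin (ctop X) V" "u \<in> V" "line_bundle Y (ov V) L'"
       "\<forall>u\<in>V. lb_section Y X \<rho> V L' u = \<sigma> u" "isom Y (ov V) L L' h" using loc[OF u] by metis
    then have "near u L L'" unfolding near_def by blast
    then have "lb_section Y X \<rho> U L u = lb_section Y X \<rho> V L' u"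
      by (subst lb_section_eq_iff[OF U u L V(1-3)])
    then show "lb_section Y X \<rho> U L u = \<sigma> u" using V(2,4) by simp
  qed
  show "\<forall>u\<in>U. lb_section Y X \<rho> U (lb_tensor Y (lb_pull Y \<rho> M) L) u = \<sigma> u"
    if U: "openin (ctop X) U" and M: "line_bundle X U M" and L: "line_bundle Y (ov U) L"
      and s: "\<forall>u\<in>U. lb_section Y X \<rho> U L u = \<sigma> u" for U M L
  proof
    fix u assume u: "u \<in> U"
    have "lb_section Y X \<rho> U L u = lb_section Y X \<rho> U (lb_tensor Y (lb_pull Y \<rho> M) L) u"
      by (subst lb_section_eq_iff[OF U u L U u Y.line_bundle_lb_tensor[OF line_bundle_lb_pull[OF M] L]])
        (rule near_pull_tensor[OF M L u])
    then show "lb_section Y X \<rho> U (lb_tensor Y (lb_pull Y \<rho> M) L) u = \<sigma> u" using s u by simp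
  qed
qed (simp_all add: canonical_gerbe_def lb_section_eq_restrict_iff)

theorem torsor_canonical_gerbe:
  assumes ne: "\<And>x. x \<in> pts X \<Longrightarrow> \<exists>U L. openin (ctop X) U \<and> x \<in> U \<and> line_bundle Y (ov U) L \<and>
    restrict \<sigma> U = lb_section Y X \<rho> U L"
  shows "torsor (ctop X) (Pic_stack X) (canonical_gerbe Y X \<rho> \<sigma>)"
proof -
  let ?S = "canonical_gerbe Y X \<rho> \<sigma>"
  interpret G: lb_module_stack X Y \<rho> ?S "\<lambda>U L. lb_section Y X \<rho> U L = restrict \<sigma> U" by (rule gerbe_module_stack)
  show ?thesis unfolding torsor_def
  proof (intro conjI allI impI ballI)
    show "module_stack (ctop X) (Pic_stack X) (regular (Pic_stack X))"
      by (rule regular_Pic_module_stack[OF X.fspace_axioms])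
    show "module_stack (ctop X) (Pic_stack X) ?S" by (rule G.module_stack)
    show "\<exists>U. openin (ctop X) U \<and> x \<in> U \<and> Ob ?S U \<noteq> {}" if x: "x \<in> pts X" for x
    proof -
      obtain U L where U: "openin (ctop X) U" "x \<in> U" "line_bundle Y (ov U) L" "restrict \<sigma> U = lb_section Y X \<rho> U L"
        using ne[OF x] by blast
      have "L \<in> Ob ?S U" by (rule G.ObI[OF U(1,3) U(4)[symmetric]])
      then show ?thesis using U by blast
    qed
  next
    fix U L assume U: "openin (ctop X) U" and LO: "L \<in> Ob ?S U"
    note L = G.ObD(1)[OF U LO]
    {
      fix p q assume p: "p \<in> Ob (Pic_stack X) U" and q: "q \<in> Ob (Pic_stack X) U"
      then have pq: "line_bundle X U p" "line_bundle X U q" unfolding G.Pic_simps by simp_all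
      let ?p = "lb_tensor Y (lb_pull Y \<rho> p) L" and ?q = "lb_tensor Y (lb_pull Y \<rho> q) L"
      have F: "actm ?S U a (idn ?S U L) = (\<lambda>y\<in>ov U. a (\<rho> y))" for a
        unfolding G.actm[OF U] G.idn[OF U] by (rule restrict_eqI) simp
      show "bij_betw (\<lambda>a. actm ?S U a (idn ?S U L)) (Iso (Pic_stack X) U p q) (Iso ?S U (act ?S U p L) (act ?S U q L))"
        unfolding F G.Pic_simps G.Iso[OF U] G.act[OF U pq(1)] G.act[OF U pq(2)]
      \<comment> \<open>Pull-back of functions is inverted by evaluation at \<open>sect\<close>;
        going down and up again is the identity because an isomorphism between the twists is
        constant along fibres.\<close>
      proof (rule bij_betwI[where g = "\<lambda>h. \<lambda>x\<in>U. h (sect x)"])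
        show "(\<lambda>a. \<lambda>y\<in>ov U. a (\<rho> y)) \<in> lb_iso X U p q \<rightarrow> lb_iso Y (ov U) ?p ?q"
        proof
          fix a assume "a \<in> lb_iso X U p q"
          from isom_pull_tensor[OF pq L L X.lb_isoD(1)[OF this] isom_one]
          show "(\<lambda>y\<in>ov U. a (\<rho> y)) \<in> lb_iso Y (ov U) ?p ?q"
            using lb_iso_restrictI[OF Y.line_bundleD(2)[OF Y.line_bundle_lb_tensor[OF line_bundle_lb_pull[OF pq(2)] L]]] by simp
        qed
        show "(\<lambda>h. \<lambda>x\<in>U. h (sect x)) \<in> lb_iso Y (ov U) ?p ?q \<rightarrow> lb_iso X U p q"
        proof
          fix h assume "h \<in> lb_iso Y (ov U) ?p ?q"
          from isom_descent(1)[OF pq L Y.lb_isoD(1)[OF this]]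
          show "(\<lambda>x\<in>U. h (sect x)) \<in> lb_iso X U p q" by (rule lb_iso_restrictI[OF X.line_bundleD(2)[OF pq(2)]])
        qed
        show "(\<lambda>x\<in>U. (\<lambda>y\<in>ov U. a (\<rho> y)) (sect x)) = a" if "a \<in> lb_iso X U p q" for a
        proof -
          have "(\<lambda>x\<in>U. (\<lambda>y\<in>ov U. a (\<rho> y)) (sect x)) = restrict a U"
            by (rule restrict_eqI) (simp add: sect_ov[OF U] \<rho>_sect[OF U])
          then show ?thesis using X.lb_isoD(2)[OF that] by simp
        qed
        show "(\<lambda>y\<in>ov U. (\<lambda>x\<in>U. h (sect x)) (\<rho> y)) = h" if "h \<in> lb_iso Y (ov U) ?p ?q" for h
        proof -
          have "(\<lambda>y\<in>ov U. (\<lambda>x\<in>U. h (sect x)) (\<rho> y)) = restrict h (ov U)"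
            by (rule restrict_eqI) (simp add: ov_iff isom_descent(2)[OF pq L Y.lb_isoD(1)[OF that]])
          then show ?thesis using Y.lb_isoD(2)[OF that] by simp
        qed
      qed
    }
    {
      fix N assume NO: "N \<in> Ob ?S U"
      note N = G.ObD(1)[OF U NO]
      \<comment> \<open>Both objects have the value \<open>\<sigma> u\<close> at \<open>u\<close>,
        so they agree near every fibre and differ by a twist.\<close>
      have n: "near u L N" if "u \<in> U" for u
        using lb_section_eq_iff[OF U that L U that N] G.ObD(2)[OF U LO] G.ObD(2)[OF U NO] by simp
      obtain M k where M: "line_bundle X U M" "isom Y (ov U) (lb_tensor Y (lb_pull Y \<rho> M) L) N k"
        by (rule near_imp_twist[OF U L N n])
      have "restrict k (ov U) \<in> Iso ?S U (act ?S U M L) N"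
        unfolding G.Iso[OF U] G.act[OF U M(1)] by (rule lb_iso_restrictI[OF Y.line_bundleD(2)[OF N] M(2)])
      then show "\<exists>p\<in>Ob (Pic_stack X) U. Iso ?S U (act ?S U p L) N \<noteq> {}"
        using M(1) unfolding G.Pic_simps by blast
    }
  qed
qed

end

section \<open>Trivialisations of a torsor\<close>

lemma regular_Pic_simps:
  "Ob (regular (Pic_stack X)) U = {L. line_bundle X U L}" "Iso (regular (Pic_stack X)) = lb_iso X"
  "cmp (regular (Pic_stack X)) U g f = (\<lambda>x\<in>U. g x * f x)" "idn (regular (Pic_stack X)) U L = (\<lambda>x\<in>U. 1)"
  "rso (regular (Pic_stack X)) = lb_res" "rsm (regular (Pic_stack X)) V h = restrict h V"
  "act (regular (Pic_stack X)) U = lb_tensor X" "actm (regular (Pic_stack X)) U h k = (\<lambda>x\<in>U. h x * k x)"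
  unfolding regular_def Pic_stack_def by simp_all

context lb_module_stack
begin

text \<open>Spelled out instead of through \<open>act\<close>, whose formula is available only for
  line bundles on open sets. \<open>L\<close> is cut down to the preimage of \<open>U\<close> so
  that both factors live on the same set.\<close>

definition orbit :: "'b lb \<Rightarrow> 'a set \<Rightarrow> 'a lb \<Rightarrow> 'b lb" where
  "orbit L U p = lb_tensor Y (lb_pull Y \<rho> p) (lb_res (ov U) L)"

context
  fixes L
  assumes L: "L \<in> Ob S (pts X)"
begin

lemma lb_res_global:
  assumes "openin (ctop X) U"
  shows "lb_res (ov U) L \<in> Ob S U"
  using rso_Ob[OF openin_topspace assms openin_subset[OF assms] L] unfolding rso[OF assms] .

lemma orbit_eq_act:
  assumes "openin (ctop X) U" "line_bundle X U p"
  shows "orbit L U p = act S U p (lb_res (ov U) L)"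
  unfolding orbit_def act[OF assms] ..

lemma line_bundle_orbit:
  assumes U: "openin (ctop X) U" and p: "line_bundle X U p"
  shows "line_bundle Y (ov U) (orbit L U p)"
  unfolding orbit_def by (rule Y.line_bundle_lb_tensor[OF line_bundle_lb_pull[OF p] ObD(1)[OF U lb_res_global[OF U]]])

lemma orbit_Ob:
  assumes U: "openin (ctop X) U" and p: "line_bundle X U p"
  shows "orbit L U p \<in> Ob S U"
  using ObI[OF U line_bundle_orbit[OF U p]] P_act[OF U p ObD[OF U lb_res_global[OF U]]] unfolding orbit_def .

lemma orbit_lb_res:
  assumes U: "openin (ctop X) U" and V: "openin (ctop X) V" "V \<subseteq> U" and p: "line_bundle X U p"
  shows "orbit L V (lb_res V p) = lb_res (ov V) (orbit L U p)"
  unfolding orbit_def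
    Y.lb_res_lb_tensor[OF line_bundle_lb_pull[OF p] ObD(1)[OF U lb_res_global[OF U]] openin_ov[OF V(1)] ov_mono[OF V(2)]]
    lb_res_lb_pull[OF p V] lb_res_lb_res[OF ov_mono[OF V(2)]] ..

lemma orbit_lb_tensor:
  assumes U: "openin (ctop X) U" and p: "line_bundle X U p" and q: "line_bundle X U q"
  shows "orbit L U (lb_tensor X p q) = act S U p (orbit L U q)"
  unfolding orbit_def act[OF U p] lb_pull_lb_tensor[OF p q]
  by (rule Y.lb_tensor_assoc[OF line_bundle_lb_pull[OF p] line_bundle_lb_pull[OF q] ObD(1)[OF U lb_res_global[OF U]]])

lemma one_lb_iso:
  assumes "openin (ctop X) U" "N \<in> Ob S U"
  shows "(\<lambda>y\<in>ov U. 1) \<in> Iso S U N N"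
  unfolding Iso[OF assms(1)] by (rule lb_iso_restrictI[OF Y.line_bundleD(2)[OF ObD(1)[OF assms]] isom_one])

lemma pull_Iso:
  assumes U: "openin (ctop X) U" and p: "line_bundle X U p" and q: "line_bundle X U q" and a: "a \<in> lb_iso X U p q"
  shows "(\<lambda>y\<in>ov U. a (\<rho> y)) \<in> Iso S U (orbit L U p) (orbit L U q)"
proof -
  note l = ObD(1)[OF U lb_res_global[OF U]]
  show ?thesis unfolding Iso[OF U]
    using lb_iso_restrictI[OF Y.line_bundleD(2)[OF line_bundle_orbit[OF U q]]]
      isom_pull_tensor[OF p q l l X.lb_isoD(1)[OF a] isom_one] unfolding orbit_def by simp
qed

text \<open>\<open>orbit\<close> commutes with restriction and with the action as equalities
  (\<open>orbit_lb_res\<close>, \<open>orbit_lb_tensor\<close>), so both families of coherence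
  isomorphisms can be the constant 1.\<close>

lemma orbit_morphism:
  "module_morphism (ctop X) (Pic_stack X) (regular (Pic_stack X)) S (orbit L) (\<lambda>U a. \<lambda>y\<in>ov U. a (\<rho> y))
     (\<lambda>U V p. \<lambda>y\<in>ov V. 1) (\<lambda>U p q. \<lambda>y\<in>ov U. 1)"
  unfolding module_morphism_def regular_Pic_simps Pic_simps mem_Collect_eq
proof (intro conjI allI impI ballI)
  let ?lb = "\<lambda>U. {L. line_bundle X U L}"
  show "orbit L U p \<in> Ob S U" if "openin (ctop X) U" "p \<in> ?lb U" for U p using that by (simp add: orbit_Ob)
  show "(\<lambda>y\<in>ov U. (\<lambda>x\<in>U. 1) (\<rho> y)) = idn S U (orbit L U p)" if U: "openin (ctop X) U" for U p
    unfolding idn[OF U] by (rule restrict_eqI) (simp add: ov_iff)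
  show "(\<lambda>y\<in>ov U. a (\<rho> y)) \<in> Iso S U (orbit L U p) (orbit L U q)"
    if U: "openin (ctop X) U" and pq: "p \<in> ?lb U" "q \<in> ?lb U" and a: "a \<in> lb_iso X U p q" for U p q a
    using pq by (intro pull_Iso U a) simp_all
  show "(\<lambda>y\<in>ov U. (\<lambda>x\<in>U. b x * a x) (\<rho> y)) = cmp S U (\<lambda>y\<in>ov U. b (\<rho> y)) (\<lambda>y\<in>ov U. a (\<rho> y))"
    if U: "openin (ctop X) U" for U a b
    unfolding cmp[OF U] by (rule restrict_eqI) (simp add: ov_iff)
  show "(\<lambda>y\<in>ov V. 1) \<in> Iso S V (orbit L V (lb_res V p)) (rso S V (orbit L U p))"
    if o: "openin (ctop X) U \<and> openin (ctop X) V \<and> V \<subseteq> U" and p: "p \<in> ?lb U" for U V p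
  proof -
    have p': "line_bundle X V (lb_res V p)" using p o by (simp add: X.line_bundle_lb_res)
    have "rso S V (orbit L U p) = orbit L V (lb_res V p)" using o p orbit_lb_res[of U V p] by (simp add: rso)
    then show ?thesis using one_lb_iso[OF _ orbit_Ob[OF _ p']] o by simp
  qed
  show "cmp S V (rsm S V (\<lambda>y\<in>ov U. a (\<rho> y))) (\<lambda>y\<in>ov V. 1) = cmp S V (\<lambda>y\<in>ov V. 1) (\<lambda>y\<in>ov V. restrict a V (\<rho> y))"
    if o: "openin (ctop X) U \<and> openin (ctop X) V \<and> V \<subseteq> U" for U V a
  proof -
    have V: "openin (ctop X) V" and sub: "ov V \<subseteq> ov U" using o ov_mono by simp_all
    show ?thesis unfolding cmp[OF V] rsm[OF V] using sub by (intro restrict_eqI) (auto simp: ov_iff)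
  qed
  show "(\<lambda>y\<in>ov W. 1) = cmp S W (rsm S W (\<lambda>y\<in>ov V. 1)) (\<lambda>y\<in>ov W. 1)"
    if o: "openin (ctop X) U \<and> openin (ctop X) V \<and> openin (ctop X) W \<and> W \<subseteq> V \<and> V \<subseteq> U" for U V W
  proof -
    have W: "openin (ctop X) W" and sub: "ov W \<subseteq> ov V" using o ov_mono by simp_all
    show ?thesis unfolding cmp[OF W] rsm[OF W] using sub by (intro restrict_eqI) auto
  qed
  show "(\<lambda>y\<in>ov U. 1) \<in> Iso S U (orbit L U (lb_tensor X p q)) (act S U p (orbit L U q))"
    if U: "openin (ctop X) U" and pq: "p \<in> ?lb U" "q \<in> ?lb U" for U p q
  proof -
    have pq': "line_bundle X U p" "line_bundle X U q" using pq by simp_all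
    show ?thesis unfolding orbit_lb_tensor[OF U pq', symmetric]
      by (rule one_lb_iso[OF U orbit_Ob[OF U X.line_bundle_lb_tensor[OF pq']]])
  qed
  show "cmp S U (actm S U a (\<lambda>y\<in>ov U. f (\<rho> y))) (\<lambda>y\<in>ov U. 1) = cmp S U (\<lambda>y\<in>ov U. 1) (\<lambda>y\<in>ov U. (\<lambda>x\<in>U. a x * f x) (\<rho> y))"
    if U: "openin (ctop X) U" for U a f
    unfolding cmp[OF U] actm[OF U] by (rule restrict_eqI) (simp add: ov_iff)
  show "(\<lambda>y\<in>ov U. 1) = idn S U (orbit L U p)" if U: "openin (ctop X) U" for U p
    unfolding idn[OF U] ..
  show "(\<lambda>y\<in>ov U. 1) = cmp S U (actm S U (\<lambda>x\<in>U. 1) (\<lambda>y\<in>ov U. 1)) (\<lambda>y\<in>ov U. 1)"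
    if U: "openin (ctop X) U" for U
    unfolding cmp[OF U] actm[OF U] by (rule restrict_eqI) (simp add: ov_iff)
  show "cmp S V (rsm S V (\<lambda>y\<in>ov U. 1)) (\<lambda>y\<in>ov V. 1) = cmp S V (actm S V (\<lambda>x\<in>V. 1) (\<lambda>y\<in>ov V. 1)) (\<lambda>y\<in>ov V. 1)"
    if o: "openin (ctop X) U \<and> openin (ctop X) V \<and> V \<subseteq> U" for U V
  proof -
    have V: "openin (ctop X) V" and sub: "ov V \<subseteq> ov U" using o ov_mono by simp_all
    show ?thesis unfolding cmp[OF V] rsm[OF V] actm[OF V] using sub by (intro restrict_eqI) (auto simp: ov_iff)
  qed
qed

end

theorem trivial_iff_global_object:
  assumes torsor: "torsor (ctop X) (Pic_stack X) S"
  shows "module_equivalent (ctop X) (Pic_stack X) (regular (Pic_stack X)) S \<longleftrightarrow> Ob S (pts X) \<noteq> {}"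
proof
  assume "module_equivalent (ctop X) (Pic_stack X) (regular (Pic_stack X)) S"
  then obtain Fo Fm \<beta> \<gamma> where "module_morphism (ctop X) (Pic_stack X) (regular (Pic_stack X)) S Fo Fm \<beta> \<gamma>"
    unfolding module_equivalent_def by (elim exE conjE)
  \<comment> \<open>The image of the structure sheaf under the functor over all of \<open>X\<close>
    is the global object sought.\<close>
  note m = conjunct1[OF this[unfolded module_morphism_def], rule_format, OF openin_topspace]
  have "lb_trivial X (pts X) \<in> Ob (regular (Pic_stack X)) (pts X)"
    unfolding regular_Pic_simps using X.line_bundle_lb_trivial[OF openin_topspace] by simp
  then have "Fo (pts X) (lb_trivial X (pts X)) \<in> Ob S (pts X)" using m by simp
  then show "Ob S (pts X) \<noteq> {}" by blast
next
  assume "Ob S (pts X) \<noteq> {}"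
  then obtain L where L: "L \<in> Ob S (pts X)" by blast
  \<comment> \<open>At \<open>N\<close> the restriction of \<open>L\<close> to the preimage of
    \<open>U\<close>, this says that the orbit functor over \<open>U\<close> is fully faithful and
    essentially surjective.\<close>
  have tors: "\<And>p q. p \<in> Ob (Pic_stack X) U \<Longrightarrow> q \<in> Ob (Pic_stack X) U \<Longrightarrow>
         bij_betw (\<lambda>a. actm S U a (idn S U N)) (Iso (Pic_stack X) U p q) (Iso S U (act S U p N) (act S U q N))"
     "\<And>y. y \<in> Ob S U \<Longrightarrow> \<exists>p\<in>Ob (Pic_stack X) U. Iso S U (act S U p N) y \<noteq> {}"
    if "openin (ctop X) U" "N \<in> Ob S U" for U N
    using torsor that unfolding torsor_def by simp_all
  show "module_equivalent (ctop X) (Pic_stack X) (regular (Pic_stack X)) S"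
    unfolding module_equivalent_def
  proof (intro exI conjI allI impI ballI)
    show "module_morphism (ctop X) (Pic_stack X) (regular (Pic_stack X)) S (orbit L) (\<lambda>U a. \<lambda>y\<in>ov U. a (\<rho> y))
     (\<lambda>U V p. \<lambda>y\<in>ov V. 1) (\<lambda>U p q. \<lambda>y\<in>ov U. 1)" by (rule orbit_morphism[OF L])
    fix U assume U: "openin (ctop X) U"
    note LU = lb_res_global[OF L U]
    {
      fix p q assume "p \<in> Ob (regular (Pic_stack X)) U" "q \<in> Ob (regular (Pic_stack X)) U"
      then have p: "line_bundle X U p" and q: "line_bundle X U q" unfolding regular_Pic_simps by simp_all
      have "actm S U a (idn S U (lb_res (ov U) L)) = (\<lambda>y\<in>ov U. a (\<rho> y))" for a
        unfolding actm[OF U] idn[OF U] by (rule restrict_eqI) simp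
      then show "bij_betw (\<lambda>a. \<lambda>y\<in>ov U. a (\<rho> y)) (Iso (regular (Pic_stack X)) U p q) (Iso S U (orbit L U p) (orbit L U q))"
        using tors(1)[OF U LU, of p q] p q
        by (simp add: regular_Pic_simps Pic_simps orbit_eq_act[OF L U])
    }
    show "\<exists>p\<in>Ob (regular (Pic_stack X)) U. Iso S U (orbit L U p) N \<noteq> {}" if "N \<in> Ob S U" for N
      using tors(2)[OF U LU that] by (auto simp: regular_Pic_simps Pic_simps orbit_eq_act[OF L U])
  qed
qed

end

section \<open>Relative ampleness is local on the base\<close>

text \<open>The condition on one box in the structure sheaf of a product, separated so that the
  first factor can be enlarged or shrunk without touching the other data.\<close>

definition cprod_local :: "'a cspace \<Rightarrow> 'b cspace \<Rightarrow> 'a set \<Rightarrow> 'b set \<Rightarrow> ('a \<times> 'b \<Rightarrow> complex) \<Rightarrow> bool" where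
  "cprod_local X Y U V f \<longleftrightarrow> (\<exists>k l g h D F. (\<forall>i::nat. g i \<in> hol X U) \<and> (\<forall>i::nat. h i \<in> hol Y V) \<and>
     openin (Cn_top (k + l)) D \<and> holo_Cn (k + l) D F \<and>
     (\<forall>x\<in>U. \<forall>y\<in>V. (let v = (\<lambda>i. if i < k then g i x else if i < k + l then h (i - k) y else 0)
              in v \<in> D \<and> f (x, y) = F v)))"

lemma hol_cprod_iff: "f \<in> hol (cprod X Y) W \<longleftrightarrow> openin (prod_topology (ctop X) (ctop Y)) W \<and>
  (\<forall>p\<in>W. \<exists>U V. p \<in> U \<times> V \<and> U \<times> V \<subseteq> W \<and> openin (ctop X) U \<and> openin (ctop Y) V \<and> cprod_local X Y U V f)"
proof -
  have "(\<exists>U V k l g h D F. p \<in> U \<times> V \<and> U \<times> V \<subseteq> W \<and>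
          (\<forall>i::nat. g i \<in> hol X U) \<and> (\<forall>i::nat. h i \<in> hol Y V) \<and>
          openin (ctop X) U \<and> openin (ctop Y) V \<and>
          openin (Cn_top (k + l)) D \<and> holo_Cn (k + l) D F \<and>
          (\<forall>x\<in>U. \<forall>y\<in>V.
             (let v = (\<lambda>i. if i < k then g i x else if i < k + l then h (i - k) y else 0)
              in v \<in> D \<and> f (x, y) = F v))) \<longleftrightarrow>
    (\<exists>U V. p \<in> U \<times> V \<and> U \<times> V \<subseteq> W \<and> openin (ctop X) U \<and> openin (ctop Y) V \<and> cprod_local X Y U V f)"
    (is "?l \<longleftrightarrow> ?r") for p
  proof
    assume ?l
    then obtain U V k l g h D F where U: "p \<in> U \<times> V" "U \<times> V \<subseteq> W" "openin (ctop X) U" "openin (ctop Y) V"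
      and g: "\<forall>i::nat. g i \<in> hol X U" "\<forall>i::nat. h i \<in> hol Y V" "openin (Cn_top (k + l)) D" "holo_Cn (k + l) D F"
       "\<forall>x\<in>U. \<forall>y\<in>V. (let v = (\<lambda>i. if i < k then g i x else if i < k + l then h (i - k) y else 0)
              in v \<in> D \<and> f (x, y) = F v)"
      by (elim exE conjE)
    have "cprod_local X Y U V f" unfolding cprod_local_def
      by (rule exI[of _ k], rule exI[of _ l], rule exI[of _ g], rule exI[of _ h], rule exI[of _ D], rule exI[of _ F])
        (intro conjI g)
    then show ?r using U by blast
  next
    assume ?r
    then obtain U V where U: "p \<in> U \<times> V" "U \<times> V \<subseteq> W" "openin (ctop X) U" "openin (ctop Y) V" "cprod_local X Y U V f"
      by blast
    obtain k l g h D F where g: "\<forall>i::nat. g i \<in> hol X U" "\<forall>i::nat. h i \<in> hol Y V" "openin (Cn_top (k + l)) D"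
       "holo_Cn (k + l) D F" "\<forall>x\<in>U. \<forall>y\<in>V. (let v = (\<lambda>i. if i < k then g i x else if i < k + l then h (i - k) y else 0)
              in v \<in> D \<and> f (x, y) = F v)"
      using U(5) unfolding cprod_local_def by (elim exE conjE)
    show ?l
      by (rule exI[of _ U], rule exI[of _ V], rule exI[of _ k], rule exI[of _ l], rule exI[of _ g], rule exI[of _ h],
         rule exI[of _ D], rule exI[of _ F]) (intro conjI U(1-4) g)
  qed
  then show ?thesis unfolding cprod_def by simp
qed

text \<open>Serves both directions: with \<open>U' = U\<close> when functions over \<open>W\<close>
  are read over the larger \<open>V\<close>, and with a smaller \<open>U'\<close> when functions
  over \<open>V\<close> are restricted.\<close>

lemma cprod_local_mono:
  assumes "cprod_local X Y U V f" "\<And>g. g \<in> hol X U \<Longrightarrow> g \<in> hol X' U'" "U' \<subseteq> U"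
  shows "cprod_local X' Y U' V f"
proof -
  obtain k l g h D F where "\<forall>i::nat. g i \<in> hol X U" and r: "\<forall>i::nat. h i \<in> hol Y V"
     "openin (Cn_top (k + l)) D" "holo_Cn (k + l) D F"
     and F: "\<forall>x\<in>U. \<forall>y\<in>V. (let v = (\<lambda>i. if i < k then g i x else if i < k + l then h (i - k) y else 0)
              in v \<in> D \<and> f (x, y) = F v)"
    using assms(1) unfolding cprod_local_def by blast
  then have g: "\<forall>i. g i \<in> hol X' U'" using assms(2) by blast
  have F': "\<forall>x\<in>U'. \<forall>y\<in>V. (let v = (\<lambda>i. if i < k then g i x else if i < k + l then h (i - k) y else 0)
              in v \<in> D \<and> f (x, y) = F v)" using F assms(3) by blast
  show ?thesis unfolding cprod_local_def
    by (rule exI[of _ k], rule exI[of _ l], rule exI[of _ g], rule exI[of _ h], rule exI[of _ D], rule exI[of _ F])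
      (intro conjI g r F')
qed

context fspace_map
begin

text \<open>\<open>j\<close> lies over the base, so the preimage of the open part of the product
  over \<open>W\<close> is exactly \<open>ov W\<close>. Each clause is then a restriction to an open
  part of the target.\<close>

lemma closed_embedding_over_open:
  assumes V: "openin (ctop X) V" and W: "openin (ctop X) W" "W \<subseteq> V"
    and j: "closed_embedding (csub Y (ov V)) (cprod (csub X V) C) j"
    and fst: "\<And>y. y \<in> ov V \<Longrightarrow> fst (j y) = \<rho> y"
  shows "closed_embedding (csub Y (ov W)) (cprod (csub X W) C) j"
proof -
  let ?PV = "prod_topology (subtopology (ctop X) V) (ctop C)" and ?PW = "prod_topology (subtopology (ctop X) W) (ctop C)"
  let ?B = "W \<times> topspace (ctop C)"
  have WU: "ov W \<subseteq> ov V" by (rule ov_mono[OF W(2)])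
  have PW: "?PW = subtopology ?PV ?B"
    using W(2) by (simp add: subtopology_Times subtopology_subtopology Int_absorb1)
  have oB: "openin ?PV ?B"
    using W V by (simp add: openin_prod_Times_iff openin_open_subtopology)
  have oPW: "openin ?PV A" if "openin ?PW A" for A using that oB unfolding PW by (rule openin_trans_full)
  have ct: "ctop (csub Y (ov A)) = subtopology (ctop Y) (ov A)" "ctop (cprod (csub X A) C) = prod_topology (subtopology (ctop X) A) (ctop C)"
    for A unfolding csub_def cprod_def by simp_all
  have pY: "topspace (subtopology (ctop Y) (ov A)) = ov A" for A unfolding over_def by auto
  have SW: "subtopology (ctop Y) (ov W) = subtopology (subtopology (ctop Y) (ov V)) (ov W)"
    using WU by (simp add: subtopology_subtopology Int_absorb1)
  have cont: "continuous_map (subtopology (ctop Y) (ov V)) ?PV j"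
    and hol: "\<And>A g. g \<in> hol (cprod (csub X V) C) A \<Longrightarrow> g \<circ> j \<in> hol (csub Y (ov V)) {y \<in> ov V. j y \<in> A}"
    and emb: "embedding_map (subtopology (ctop Y) (ov V)) ?PV j"
    and cl: "closedin ?PV (j ` ov V)"
    and stalk: "\<And>y A f. y \<in> A \<Longrightarrow> f \<in> hol (csub Y (ov V)) A \<Longrightarrow>
        \<exists>A' D g. openin (subtopology (ctop Y) (ov V)) A' \<and> y \<in> A' \<and> A' \<subseteq> A \<and> g \<in> hol (cprod (csub X V) C) D \<and> j ` A' \<subseteq> D \<and>
           (\<forall>z\<in>A'. f z = g (j z))"
    using j unfolding closed_embedding_def holomorphic_map_def ct pY by blast+
  have jV: "j y \<in> topspace ?PV" if "y \<in> ov V" for y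
    using cont that pY[of V] unfolding continuous_map_def by blast
  have jW: "j y \<in> ?B \<longleftrightarrow> y \<in> ov W" if "y \<in> ov V" for y
    using jV[OF that] fst[OF that] that by (auto simp: ov_iff mem_Times_iff)
  have imW: "j ` ov W \<subseteq> ?B" using jW WU by blast
  \<comment> \<open>\<open>W\<close> is open in \<open>V\<close>, so a function holomorphic over
    \<open>W\<close> counts as one over \<open>V\<close> on the same set; holomorphy of
    \<open>g \<circ> j\<close> can then be taken from the given embedding.\<close>
  have up: "g \<in> hol (cprod (csub X V) C) A" if g: "g \<in> hol (cprod (csub X W) C) A" for g A
    unfolding hol_cprod_iff
  proof (intro conjI ballI)
    show "openin (prod_topology (ctop (csub X V)) (ctop C)) A"
      using g oPW unfolding hol_cprod_iff by (simp add: csub_def)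
    fix p assume p: "p \<in> A"
    obtain U B where U: "p \<in> U \<times> B" "U \<times> B \<subseteq> A" "openin (ctop (csub X W)) U" "openin (ctop C) B"
      "cprod_local (csub X W) C U B g"
      using bspec[OF conjunct2[OF g[unfolded hol_cprod_iff]] p] by (elim exE conjE)
    have "f \<in> hol (csub X V) U" if "f \<in> hol (csub X W) U" for f
      using that W(2) unfolding csub_def lb_res_def by (auto split: if_splits)
    then have "cprod_local (csub X V) C U B g" by (rule cprod_local_mono[OF U(5)]) simp_all
    moreover have "openin (ctop (csub X V)) U"
      using U(3) V W by (auto simp: csub_def openin_open_subtopology)
    ultimately show "\<exists>U B. p \<in> U \<times> B \<and> U \<times> B \<subseteq> A \<and> openin (ctop (csub X V)) U \<and> openin (ctop C) B \<and>
      cprod_local (csub X V) C U B g" using U(1,2,4) by (intro exI[of _ U] exI[of _ B] conjI)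
  qed
  \<comment> \<open>The opposite passage serves the stalks: the given extension of a germ lives over
    \<open>V\<close> and has to be cut down to \<open>?B\<close>.\<close>
  have down: "g \<in> hol (cprod (csub X W) C) (A \<inter> ?B)" if g: "g \<in> hol (cprod (csub X V) C) A" for g A
    unfolding hol_cprod_iff
  proof (intro conjI ballI)
    have "openin ?PV A" using g unfolding hol_cprod_iff by (simp add: csub_def)
    then have "openin ?PW (A \<inter> ?B)" unfolding PW openin_subtopology by blast
    then show "openin (prod_topology (ctop (csub X W)) (ctop C)) (A \<inter> ?B)" by (simp add: csub_def)
    fix p assume p: "p \<in> A \<inter> ?B"
    obtain U B where U: "p \<in> U \<times> B" "U \<times> B \<subseteq> A" "openin (ctop (csub X V)) U" "openin (ctop C) B"
      "cprod_local (csub X V) C U B g"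
      using bspec[OF conjunct2[OF g[unfolded hol_cprod_iff]] IntD1[OF p]] by (elim exE conjE)
    have oU: "openin (ctop X) U" "U \<subseteq> V" using U(3) V by (simp_all add: csub_def openin_open_subtopology)
    have o: "openin (ctop X) (U \<inter> W)" using oU W(1) by blast
    have "f \<in> hol (csub X W) (U \<inter> W)" if "f \<in> hol (csub X V) U" for f
      using that oU X.hol_subset[OF _ o] unfolding csub_def lb_res_def by auto
    then have "cprod_local (csub X W) C (U \<inter> W) B g" by (rule cprod_local_mono[OF U(5)]) simp_all
    moreover have "openin (ctop (csub X W)) (U \<inter> W)" using o W by (simp add: csub_def openin_open_subtopology)
    moreover have "p \<in> (U \<inter> W) \<times> B" using p U(1) by auto
    moreover have "(U \<inter> W) \<times> B \<subseteq> A \<inter> ?B" using U(2) openin_subset[OF U(4)] by auto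
    ultimately show "\<exists>U B. p \<in> U \<times> B \<and> U \<times> B \<subseteq> A \<inter> ?B \<and> openin (ctop (csub X W)) U \<and> openin (ctop C) B \<and>
      cprod_local (csub X W) C U B g" using U(4) by (intro exI[of _ "U \<inter> W"] exI[of _ B] conjI)
  qed
  have c: "continuous_map (subtopology (ctop Y) (ov W)) ?PW j"
    unfolding PW SW continuous_map_in_subtopology
    using continuous_map_from_subtopology[OF cont] imW pY[of W] SW by auto
  have h: "g \<circ> j \<in> hol (csub Y (ov W)) {y \<in> ov W. j y \<in> A}" if g: "g \<in> hol (cprod (csub X W) C) A" for A g
  proof -
    have "A \<subseteq> ?B"
      using g openin_subset[of ?PW A] unfolding hol_cprod_iff by (auto simp: csub_def)
    then have eq: "{y \<in> ov V. j y \<in> A} = {y \<in> ov W. j y \<in> A}" using jW WU by blast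
    show ?thesis using hol[OF up[OF g]] unfolding eq by (auto simp: csub_def lb_res_def split: if_splits)
  qed
  have e: "embedding_map (subtopology (ctop Y) (ov W)) ?PW j"
  proof -
    have "homeomorphic_map (subtopology (ctop Y) (ov V)) (subtopology ?PV (j ` ov V)) j"
      using emb unfolding embedding_map_def pY .
    then have "homeomorphic_map (subtopology (subtopology (ctop Y) (ov V)) (ov W))
        (subtopology (subtopology ?PV (j ` ov V)) (j ` ov W)) j"
    proof (rule homeomorphic_map_subtopologies)
      have "topspace (subtopology (ctop Y) (ov V)) \<inter> ov W = ov W" unfolding pY using WU by blast
      moreover have "topspace (subtopology ?PV (j ` ov V)) \<inter> j ` ov W = j ` ov W"
        using closedin_subset[OF cl] WU unfolding topspace_subtopology by blast
      ultimately show "j ` (topspace (subtopology (ctop Y) (ov V)) \<inter> ov W) = topspace (subtopology ?PV (j ` ov V)) \<inter> j ` ov W"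
        by simp
    qed
    moreover have "subtopology (subtopology ?PV (j ` ov V)) (j ` ov W) = subtopology ?PW (j ` ov W)"
    proof -
      have "j ` ov V \<inter> j ` ov W = ?B \<inter> j ` ov W" using imW WU by blast
      then show ?thesis unfolding PW subtopology_subtopology by simp
    qed
    ultimately show ?thesis unfolding embedding_map_def pY SW[symmetric] by simp
  qed
  have k: "closedin ?PW (j ` ov W)"
  proof -
    have "j ` ov V \<inter> ?B \<subseteq> j ` ov W"
    proof
      fix p assume p: "p \<in> j ` ov V \<inter> ?B"
      then obtain y where y: "y \<in> ov V" "p = j y" by blast
      have "j y \<in> ?B" using p unfolding y(2) by (rule IntD2)
      then have "y \<in> ov W" unfolding jW[OF y(1)] .
      then show "p \<in> j ` ov W" unfolding y(2) by (rule imageI)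
    qed
    then have "j ` ov W = j ` ov V \<inter> ?B" using imW WU by blast
    then show ?thesis using cl unfolding PW closedin_subtopology by blast
  qed
  have s: "\<exists>A' D g. openin (subtopology (ctop Y) (ov W)) A' \<and> y \<in> A' \<and> A' \<subseteq> A \<and> g \<in> hol (cprod (csub X W) C) D \<and> j ` A' \<subseteq> D \<and>
           (\<forall>z\<in>A'. f z = g (j z))" if y: "y \<in> A" and f: "f \<in> hol (csub Y (ov W)) A" for y A f
  proof -
    have AW: "A \<subseteq> ov W" using f unfolding csub_def lb_res_def by (auto split: if_splits)
    then have "f \<in> hol (csub Y (ov V)) A" using f WU unfolding csub_def lb_res_def by auto
    from stalk[OF y this] obtain A' D g where A': "openin (subtopology (ctop Y) (ov V)) A'" "y \<in> A'" "A' \<subseteq> A"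
        "g \<in> hol (cprod (csub X V) C) D" "j ` A' \<subseteq> D" "\<forall>z\<in>A'. f z = g (j z)" by blast
    have A'W: "A' \<subseteq> ov W" using A'(3) AW by (rule subset_trans)
    moreover have "openin (ctop Y) A'" using A'(1) unfolding openin_open_subtopology[OF openin_ov[OF V]] ..
    ultimately have "openin (subtopology (ctop Y) (ov W)) A'"
      by (simp add: openin_open_subtopology[OF openin_ov[OF W(1)]])
    moreover have "j ` A' \<subseteq> D \<inter> ?B" by (rule Int_greatest[OF A'(5) subset_trans[OF image_mono[OF A'W] imW]])
    ultimately show ?thesis using A'(2,3,6) down[OF A'(4)]
      by (intro exI[of _ A'] exI[of _ "D \<inter> ?B"] exI[of _ g] conjI)
  qed
  show ?thesis
    unfolding closed_embedding_def holomorphic_map_def ct pY using c h e k s by simp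
qed

lemma proj_pt_scale: "c \<noteq> 0 \<Longrightarrow> proj_pt (\<lambda>i. c * z i) = proj_pt z"
proof -
  have sub: "proj_pt (\<lambda>i. c * z i) \<subseteq> proj_pt z" if "c \<noteq> 0" for c z
  proof
    fix w assume "w \<in> proj_pt (\<lambda>i. c * z i)"
    then obtain d where "d \<noteq> 0" "w = (\<lambda>i. d * (c * z i))" unfolding proj_pt_def by blast
    then have "d * c \<noteq> 0 \<and> w = (\<lambda>i. (d * c) * z i)" using that by (simp add: mult.assoc)
    then show "w \<in> proj_pt z" unfolding proj_pt_def by blast
  qed
  assume c: "c \<noteq> 0"
  have "proj_pt (\<lambda>i. inverse c * (c * z i)) \<subseteq> proj_pt (\<lambda>i. c * z i)" using c by (intro sub) simp
  moreover have "(\<lambda>i. inverse c * (c * z i)) = z" using c by (simp add: fun_eq_iff mult.assoc[symmetric])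
  ultimately show ?thesis using sub[OF c, of z] by simp
qed

text \<open>A common non-zero factor does not change points of projective space, so the scaled
  sections define literally the same map. For the two maps to be equal as total functions, the
  factor must be non-zero at every point and not only on \<open>ov W\<close>.\<close>

lemma rel_very_ample_transfer:
  assumes V: "openin (ctop X) V" and W: "openin (ctop X) W" "W \<subseteq> V"
    and M: "rel_very_ample Y X \<rho> V M"
    and k: "\<And>y. k y \<noteq> 0" "\<And>s. s \<in> M (ov V) \<Longrightarrow> (\<lambda>y. k y * s y) \<in> M' (ov W)"
  shows "rel_very_ample Y X \<rho> W M'"
proof -
  obtain N s where s: "\<forall>i\<le>N. s i \<in> M (ov V)" "\<forall>y\<in>ov V. \<exists>i\<le>N. s i y \<noteq> 0"
     "closed_embedding (csub Y (ov V)) (cprod (csub X V) (CP N))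
       (\<lambda>y. (\<rho> y, proj_pt (\<lambda>i. if i \<le> N then s i y else 0)))"
    using M unfolding rel_very_ample_def by blast
  let ?s = "\<lambda>i y. k y * s i y"
  have "proj_pt (\<lambda>i. if i \<le> N then ?s i y else 0) = proj_pt (\<lambda>i. if i \<le> N then s i y else 0)" for y
  proof -
    have "(\<lambda>i. if i \<le> N then ?s i y else 0) = (\<lambda>i. k y * (if i \<le> N then s i y else 0))" by auto
    then show ?thesis using proj_pt_scale[OF k(1)] by simp
  qed
  then have "closed_embedding (csub Y (ov W)) (cprod (csub X W) (CP N))
       (\<lambda>y. (\<rho> y, proj_pt (\<lambda>i. if i \<le> N then ?s i y else 0)))"
    using closed_embedding_over_open[OF V W s(3)] by simp
  moreover have "\<forall>i\<le>N. ?s i \<in> M' (ov W)" using s(1) k(2) by blast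
  moreover have "\<forall>y\<in>ov W. \<exists>i\<le>N. ?s i y \<noteq> 0" using s(2) k(1) ov_mono[OF W(2)] by fastforce
  ultimately show ?thesis unfolding rel_very_ample_def by (intro exI[of _ N] exI[of _ ?s] conjI)
qed

end

text \<open>Very ampleness only asks for sections to be carried forwards, so a one-sided hypothesis
  on \<open>h\<close> suffices. Sections of a power factor only locally, hence the induction is over
  all smaller open sets \<open>W'\<close>.\<close>

lemma (in fspace) lb_pow_isom:
  assumes h: "\<And>W s. W \<subseteq> B \<Longrightarrow> openin (ctop X) W \<Longrightarrow> s \<in> L W \<Longrightarrow> (\<lambda>x. h x * s x) \<in> L' W"
    and L: "function_sheaf (ctop X) A L"
  shows "s \<in> lb_pow X A L m W \<Longrightarrow> W' \<subseteq> W \<Longrightarrow> W' \<subseteq> B \<Longrightarrow> openin (ctop X) W' \<Longrightarrow>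
    (\<lambda>x. h x ^ m * s x) \<in> lb_pow X B L' m W'"
proof (induction m arbitrary: s W W')
  case 0
  then have "s \<in> hol X W" unfolding lb_pow.simps lb_trivial_def lb_res_def by (auto split: if_splits)
  then show ?case using 0 hol_subset[of s W W'] unfolding lb_pow.simps lb_trivial_def lb_res_def by simp
next
  case (Suc m)
  show ?case unfolding lb_pow.simps lb_tensor_def mem_Collect_eq
  proof (intro conjI ballI)
    show "openin (ctop X) W'" by fact
    fix x assume x: "x \<in> W'"
    then have "x \<in> W" using Suc.prems(2) by blast
    then obtain V a b where V: "openin (ctop X) V" "x \<in> V" "V \<subseteq> W" "a \<in> L V" "b \<in> lb_pow X A L m V"
        "\<forall>z\<in>V. s z = a z * b z"
      using Suc.prems(1) unfolding lb_pow.simps lb_tensor_def mem_Collect_eq by meson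
    have o: "openin (ctop X) (V \<inter> W')" using V(1) Suc.prems(4) by blast
    have B: "V \<inter> W' \<subseteq> B" using Suc.prems(3) by blast
    have a: "(\<lambda>x. h x * a x) \<in> L' (V \<inter> W')"
      by (rule h[OF B o function_sheafD(3)[OF L V(4) o]]) blast
    have b: "(\<lambda>x. h x ^ m * b x) \<in> lb_pow X B L' m (V \<inter> W')" by (rule Suc.IH[OF V(5) _ B o]) blast
    show "\<exists>V a b. openin (ctop X) V \<and> x \<in> V \<and> V \<subseteq> W' \<and> a \<in> L' V \<and> b \<in> lb_pow X B L' m V \<and>
       (\<forall>z\<in>V. h z ^ Suc m * s z = a z * b z)"
      using o x V(2,6) a b
      by (intro exI[of _ "V \<inter> W'"] exI[of _ "\<lambda>x. h x * a x"] exI[of _ "\<lambda>x. h x ^ m * b x"]) auto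
  qed
qed

lemma (in fspace_descent) rel_ample_local:
  assumes L: "line_bundle Y (ov U) L"
    and loc: "\<And>x. x \<in> U \<Longrightarrow> \<exists>V N. openin (ctop X) V \<and> x \<in> V \<and> V \<subseteq> U \<and> rel_ample Y X \<rho> V N \<and> near x N L"
  shows "rel_ample Y X \<rho> U L"
  unfolding rel_ample_def
proof (intro conjI ballI L)
  fix x assume "x \<in> U"
  then obtain V N where V: "openin (ctop X) V" "x \<in> V" "V \<subseteq> U" "rel_ample Y X \<rho> V N" "near x N L"
    using loc by blast
  obtain A m where A: "openin (ctop X) A" "x \<in> A" "A \<subseteq> V" "m \<ge> 1"
      "rel_very_ample Y X \<rho> A (lb_pow Y (ov A) (lb_res (ov A) N) m)" and N: "line_bundle Y (ov V) N"
    using V(2,4) unfolding rel_ample_def by meson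
  obtain W h where W: "openin (ctop X) W" "x \<in> W" "W \<subseteq> A" "isom Y (ov W) N L h"
    by (rule near_shrink[OF V(5) A(1,2)])
  \<comment> \<open>The value 1 off \<open>ov W\<close> is chosen because the transfer wants a
    factor without zeros at every point.\<close>
  define k where "k y = (if y \<in> ov W then h y else 1)" for y
  have nz: "k y \<noteq> 0" for y using isomD(1)[OF W(4)] unfolding k_def by simp
  have "isom Y (ov W) N L k"
    by (rule isom_cong[OF Y.line_bundleD(2)[OF L] W(4)]) (simp add: k_def)
  then have k: "isom Y (ov W) (lb_res (ov A) N) (lb_res (ov W) L) k"
    using ov_mono[OF W(3)] by (simp add: isom_lb_res)
  note sh = function_sheaf_lb_res[OF Y.line_bundleD(2)[OF N] ov_mono[OF A(3)]]
  have "rel_very_ample Y X \<rho> W (lb_pow Y (ov W) (lb_res (ov W) L) m)"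
  \<comment> \<open>The power \<open>m\<close> is the one that works for \<open>N\<close>; on
    \<open>m\<close>-th powers the isomorphism acts by the \<open>m\<close>-th power of
    \<open>k\<close>.\<close>
  proof (rule rel_very_ample_transfer[OF A(1) W(1,3) A(5), where k = "\<lambda>y. k y ^ m"])
    show "k y ^ m \<noteq> 0" for y using nz by simp
    fix s assume s: "s \<in> lb_pow Y (ov A) (lb_res (ov A) N) m (ov A)"
    show "(\<lambda>y. k y ^ m * s y) \<in> lb_pow Y (ov W) (lb_res (ov W) L) m (ov W)"
      by (rule Y.lb_pow_isom[OF _ sh s ov_mono[OF W(3)] order_refl openin_ov[OF W(1)]])
        (simp add: isomD(2)[OF k, symmetric])
  qed
  then show "\<exists>W m. openin (ctop X) W \<and> x \<in> W \<and> W \<subseteq> U \<and> m \<ge> 1 \<and>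
      rel_very_ample Y X \<rho> W (lb_pow Y (ov W) (lb_res (ov W) L) m)"
    using W(1,2,3) A(3,4) V(3) by blast
qed

section \<open>Relatively ample bundles as global objects of the gerbe\<close>

theorem theorem1p18:
  fixes X :: "'a cspace" and Y :: "'b cspace" and \<rho> :: "'b \<Rightarrow> 'a"
    and \<sigma> :: "('a, 'b) rel_Pic_section"
  assumes "complex_space X"
    and "normal_space_cx X"
    and "canonical_Q_Cartier X"
    and "crepant_resolution Y X \<rho>"
    and "locally_projective Y X \<rho>"
    and "\<sigma> \<in> rel_Pic_sheaf Y X \<rho> (pts X)"
    and "rel_ample_section Y X \<rho> \<sigma>"
  shows "torsor (ctop X) (Pic_stack X) (canonical_gerbe Y X \<rho> \<sigma>) \<and>
         ((\<exists>L. rel_ample Y X \<rho> (pts X) L \<and> locally_in_class Y X \<rho> \<sigma> L)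
         \<longleftrightarrow> trivial_gerbe X (canonical_gerbe Y X \<rho> \<sigma>))"
proof -
  have Y: "complex_space Y" "proper_bimeromorphic Y X \<rho>" using assms(4) unfolding crepant_resolution_def by simp_all
  interpret fspace_descent X Y \<rho> by (rule fspace_descent_resolution[OF assms(1,2) Y])
  let ?S = "canonical_gerbe Y X \<rho> \<sigma>"
  interpret G: lb_module_stack X Y \<rho> ?S "\<lambda>U L. lb_section Y X \<rho> U L = restrict \<sigma> U" by (rule gerbe_module_stack)
  have loc: "\<exists>U N. openin (ctop X) U \<and> x \<in> U \<and> rel_ample Y X \<rho> U N \<and> restrict \<sigma> U = lb_section Y X \<rho> U N"
    if "x \<in> pts X" for x using assms(7) that unfolding rel_ample_section_def by blast
  have torsor: "torsor (ctop X) (Pic_stack X) ?S"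
  proof (rule torsor_canonical_gerbe)
    fix x assume "x \<in> pts X"
    then obtain U N where U: "openin (ctop X) U" "x \<in> U" "rel_ample Y X \<rho> U N" "restrict \<sigma> U = lb_section Y X \<rho> U N"
      using loc by meson
    then have "line_bundle Y (ov U) N" unfolding rel_ample_def by (elim conjE)
    then show "\<exists>U L. openin (ctop X) U \<and> x \<in> U \<and> line_bundle Y (ov U) L \<and> restrict \<sigma> U = lb_section Y X \<rho> U L"
      using U(1,2,4) by (intro exI[of _ U] exI[of _ N] conjI)
  qed
  \<comment> \<open>Objects over all of \<open>X\<close> are described through
    \<open>restrict \<sigma> (pts X)\<close>, \<open>locally_in_class\<close> through
    \<open>\<sigma>\<close>; sections of the sheafification are extensional, so the two
    agree.\<close>
  have \<sigma>: "restrict \<sigma> (pts X) = \<sigma>"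
    using assms(6) unfolding rel_Pic_sheaf_def sheafification_def by (simp add: extensional_restrict)
  have ample: "rel_ample Y X \<rho> (pts X) L" if LO: "L \<in> Ob ?S (pts X)" for L
  proof (rule rel_ample_local)
    note L = G.ObD(1)[OF openin_topspace LO]
    show "line_bundle Y (ov (pts X)) L" by (rule L)
    fix x assume x: "x \<in> pts X"
    then obtain U N where U: "openin (ctop X) U" "x \<in> U" "rel_ample Y X \<rho> U N" "restrict \<sigma> U = lb_section Y X \<rho> U N"
      using loc by meson
    then have N: "line_bundle Y (ov U) N" unfolding rel_ample_def by (elim conjE)
    \<comment> \<open>Both bundles have the value \<open>\<sigma> x\<close> at \<open>x\<close>.
      Hence they agree near the fibre, and ampleness passes from \<open>N\<close> to
      \<open>L\<close>.\<close>
    have "lb_section Y X \<rho> U N x = lb_section Y X \<rho> (pts X) L x"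
      using U(2,4) x G.ObD(2)[OF openin_topspace LO] by (metis restrict_apply')
    then have "near x N L" unfolding lb_section_eq_iff[OF U(1,2) N openin_topspace x L] .
    then show "\<exists>V N. openin (ctop X) V \<and> x \<in> V \<and> V \<subseteq> pts X \<and> rel_ample Y X \<rho> V N \<and> near x N L"
      using U(1-3) openin_subset[OF U(1)] by (intro exI[of _ U] exI[of _ N] conjI)
  qed
  \<comment> \<open>Ampleness is automatic for a global object, so the bundles asked for are exactly
    the global objects, and their existence is triviality of the torsor.\<close>
  have "L \<in> Ob ?S (pts X) \<longleftrightarrow> rel_ample Y X \<rho> (pts X) L \<and> locally_in_class Y X \<rho> \<sigma> L" for L
    using ample[of L] unfolding locally_in_class_def by (auto simp: G.Ob ov_pts \<sigma>)
  then show ?thesis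
    using torsor G.trivial_iff_global_object[OF torsor] unfolding trivial_gerbe_def by blast
qed

end
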